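(* Let $(\mathcal{M},\tau)$ be a II$_1$ factor and let $a,b\in\mathcal{M}^+$. (1) $a\precsim b$ if and only if there exists $c\in\overline{\mathcal{U}_\mathcal{M}(b)}$ with $a\le c$, and this holds if and only if there exists $d\in\overline{\mathcal{U}_\mathcal{M}(a)}$ with $d\le b$. Moreover, $c$ can be chosen to commute with $a$, and $d$ can be chosen to commute with $b$. (2) $a\prec_w b$ if and only if there exists $c\in\mathcal{M}^+$ such that $a\le c\prec b$. Moreover, $c$ can be chosen to commute with $a$.
   Context: $\tau$ is the faithful normal tracial state of $\mathcal{M}$, $\mathcal{U}_\mathcal{M}$ its unitary group, $\mathcal{U}_\mathcal{M}(x)=\{uxu^*:\ u\in\mathcal{U}_\mathcal{M}\}$ and $\overline{\mathcal{U}_\mathcal{M}(x)}$ its operator-norm closure. Singular values: $\mu_x(t)=\inf\{\|xe\|:\ e\in\mathcal{M}\text{ a projection},\ \tau(1-e)\le t\}$, $t\ge0$. For $x,y\in\mathcal{M}^+$: $x\precsim y$ (y spectrally dominates x) iff $\mu_x(t)\le\mu_y(t)$ for all $t\ge0$ (equivalently $\tau(P^x((t,\infty)))\le\tau(P^y((t,\infty)))$ for all $t\ge0$, $P^x$ denoting spectral projections); $x\prec_w y$ iff $\int_0^s\mu_x(t)\,dt\le\int_0^s\mu_y(t)\,dt$ for all $s\ge0$; $x\prec y$ iff $x\prec_w y$ and $\tau(x)=\tau(y)$. *)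

theory Defs
  imports "HOL-Analysis.Analysis"
begin

text \<open>
  A (unital) C*-algebra is encoded on a real Banach algebra type 'a together with
  an involution star and a central element j with j*j = -1 playing the role of the
  imaginary unit (so that complex scalar multiplication is cscale below).
\<close>

definition cscale :: "'a::real_normed_algebra_1 \<Rightarrow> complex \<Rightarrow> 'a \<Rightarrow> 'a" where
  "cscale j z x = Re z *\<^sub>R x + Im z *\<^sub>R (j * x)"

definition cstar_algebra :: "('a::{real_normed_algebra_1,banach} \<Rightarrow> 'a) \<Rightarrow> 'a \<Rightarrow> bool" where
  "cstar_algebra star j \<longleftrightarrow>
     j * j = - 1 \<and> (\<forall>x. j * x = x * j) \<and>
     (\<forall>z x. norm (cscale j z x) = cmod z * norm x) \<and>
     (\<forall>x. star (star x) = x) \<and>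
     (\<forall>x y. star (x + y) = star x + star y) \<and>
     (\<forall>x y. star (x * y) = star y * star x) \<and>
     (\<forall>z x. star (cscale j z x) = cscale j (cnj z) (star x)) \<and>
     (\<forall>x. norm (star x * x) = (norm x)\<^sup>2)"

definition selfadj :: "('a \<Rightarrow> 'a) \<Rightarrow> 'a \<Rightarrow> bool" where
  "selfadj star x \<longleftrightarrow> star x = x"

definition positive :: "('a::times \<Rightarrow> 'a) \<Rightarrow> 'a \<Rightarrow> bool" where
  "positive star x \<longleftrightarrow> (\<exists>y. x = star y * y)"

definition ople :: "('a::{times,minus} \<Rightarrow> 'a) \<Rightarrow> 'a \<Rightarrow> 'a \<Rightarrow> bool" where
  "ople star x y \<longleftrightarrow> positive star (y - x)"

definition is_projection :: "('a::times \<Rightarrow> 'a) \<Rightarrow> 'a \<Rightarrow> bool" where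
  "is_projection star p \<longleftrightarrow> star p = p \<and> p * p = p"

definition is_unitary :: "('a::{times,one} \<Rightarrow> 'a) \<Rightarrow> 'a \<Rightarrow> bool" where
  "is_unitary star u \<longleftrightarrow> star u * u = 1 \<and> u * star u = 1"

definition bdd_directed :: "('a::{real_normed_algebra_1} \<Rightarrow> 'a) \<Rightarrow> 'a set \<Rightarrow> bool" where
  "bdd_directed star D \<longleftrightarrow> D \<noteq> {} \<and> (\<forall>x\<in>D. selfadj star x) \<and>
     (\<forall>x\<in>D. \<forall>y\<in>D. \<exists>z\<in>D. ople star x z \<and> ople star y z) \<and>
     (\<exists>K. \<forall>x\<in>D. norm x \<le> K)"

definition is_op_lub :: "('a::{real_normed_algebra_1} \<Rightarrow> 'a) \<Rightarrow> 'a set \<Rightarrow> 'a \<Rightarrow> bool" where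
  "is_op_lub star D s \<longleftrightarrow> selfadj star s \<and> (\<forall>x\<in>D. ople star x s) \<and>
     (\<forall>s'. selfadj star s' \<and> (\<forall>x\<in>D. ople star x s') \<longrightarrow> ople star s s')"

text \<open>
  II_1 factor: a C*-algebra which is monotone complete (bounded increasing nets of
  self-adjoint elements have a least upper bound), carries a faithful normal tracial
  state tau, has trivial centre and is infinite dimensional. By Kadison's
  characterisation of W*-algebras, monotone completeness together with a faithful
  normal state is equivalent to being a von Neumann algebra; a von Neumann factor
  with a faithful normal tracial state which is infinite dimensional is of type II_1.
\<close>
definition II1_factor :: "('a::{real_normed_algebra_1,banach} \<Rightarrow> 'a) \<Rightarrow> 'a \<Rightarrow> ('a \<Rightarrow> complex) \<Rightarrow> bool" where
  "II1_factor star j \<tau> \<longleftrightarrow>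
     cstar_algebra star j \<and>
     \<comment> \<open>tau is a complex-linear functional\<close>
     (\<forall>x y. \<tau> (x + y) = \<tau> x + \<tau> y) \<and>
     (\<forall>z x. \<tau> (cscale j z x) = z * \<tau> x) \<and>
     \<comment> \<open>positive, unital, tracial, faithful\<close>
     (\<forall>x. positive star x \<longrightarrow> Im (\<tau> x) = 0 \<and> Re (\<tau> x) \<ge> 0) \<and>
     \<tau> 1 = 1 \<and>
     (\<forall>x y. \<tau> (x * y) = \<tau> (y * x)) \<and>
     (\<forall>x. positive star x \<and> \<tau> x = 0 \<longrightarrow> x = 0) \<and>
     \<comment> \<open>monotone completeness and normality of tau\<close>
     (\<forall>D. bdd_directed star D \<longrightarrow> (\<exists>s. is_op_lub star D s)) \<and>
     (\<forall>D s. bdd_directed star D \<and> is_op_lub star D s \<longrightarrow>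
          Re (\<tau> s) = (SUP x\<in>D. Re (\<tau> x))) \<and>
     \<comment> \<open>factor: trivial centre\<close>
     (\<forall>x. (\<forall>y. x * y = y * x) \<longrightarrow> (\<exists>z. x = cscale j z 1)) \<and>
     \<comment> \<open>infinite dimensional\<close>
     \<not> (\<exists>B. finite B \<and> span B = (UNIV :: 'a set))"

definition unitary_orbit :: "('a::{times,one} \<Rightarrow> 'a) \<Rightarrow> 'a \<Rightarrow> 'a set" where
  "unitary_orbit star x = {u * x * star u | u. is_unitary star u}"

definition sing_val :: "('a::real_normed_algebra_1 \<Rightarrow> 'a) \<Rightarrow> ('a \<Rightarrow> complex) \<Rightarrow> 'a \<Rightarrow> real \<Rightarrow> real" where
  "sing_val star \<tau> x t = Inf {norm (x * e) | e. is_projection star e \<and> Re (\<tau> (1 - e)) \<le> t}"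

definition spec_dom :: "('a::real_normed_algebra_1 \<Rightarrow> 'a) \<Rightarrow> ('a \<Rightarrow> complex) \<Rightarrow> 'a \<Rightarrow> 'a \<Rightarrow> bool" where
  "spec_dom star \<tau> x y \<longleftrightarrow> (\<forall>t\<ge>0. sing_val star \<tau> x t \<le> sing_val star \<tau> y t)"

definition weak_maj :: "('a::real_normed_algebra_1 \<Rightarrow> 'a) \<Rightarrow> ('a \<Rightarrow> complex) \<Rightarrow> 'a \<Rightarrow> 'a \<Rightarrow> bool" where
  "weak_maj star \<tau> x y \<longleftrightarrow>
     (\<forall>s\<ge>0. integral {0..s} (sing_val star \<tau> x) \<le> integral {0..s} (sing_val star \<tau> y))"

definition maj :: "('a::real_normed_algebra_1 \<Rightarrow> 'a) \<Rightarrow> ('a \<Rightarrow> complex) \<Rightarrow> 'a \<Rightarrow> 'a \<Rightarrow> bool" where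
  "maj star \<tau> x y \<longleftrightarrow> weak_maj star \<tau> x y \<and> \<tau> x = \<tau> y"

end

theory Submission
  imports Defs
begin

text \<open>
  The positive cone and square roots of a C*-algebra come from the binomial series. Suprema of bounded
  increasing nets are limits in the trace norm \<open>\<tau> (x\<^sup>* x)\<close>, in which multiplication is continuous because
  \<open>\<tau>\<close> is tracial; this gives a family \<open>E a r\<close> of spectral projections, and \<open>\<mu>\<close> is the generalised inverse of
  \<open>r \<mapsto> \<tau> (E a r)\<close>, so that \<open>a \<precsim> b\<close> says \<open>\<tau> (E a r') \<le> \<tau> (E b r)\<close> for \<open>r < r'\<close>.

  (1) Put the projections \<open>E a r\<close> in a maximal chain. There are no minimal projections, so the chain contains
  exactly one projection \<open>e t\<close> of each trace \<open>t\<close>. With \<open>a = \<integral> E a r dr\<close>, the element \<open>c = \<integral> e (\<tau> (E b r)) dr\<close>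
  commutes with \<open>a\<close> and dominates it. Its Riemann sums are combinations of chains of projections with the
  same traces as those for \<open>b\<close>, hence unitarily equivalent to them, since in the factor projections of equal
  trace are equivalent. The element \<open>d\<close> arises in the same way from a chain through the \<open>E b r\<close>.

  (2) Take \<open>c = max a r\<close> with \<open>r\<close> such that \<open>\<tau> c = \<tau> b\<close>. Then \<open>\<mu>\<close> of \<open>c\<close> agrees with that of \<open>a\<close> up to
  some point, and is constant from there on, where concavity of \<open>s \<mapsto> \<integral>\<^sub>0\<^sup>s \<mu> b\<close> gives the majorization.
\<close>

section \<open>Preliminaries\<close>

text \<open>The factor is given abstractly, without a Hilbert space or a functional calculus.
  Positivity is therefore first the norm condition \<open>norm (r *\<^sub>R 1 - x) \<le> r\<close>
  on self-adjoint \<open>x\<close>, for which sums are harmless and the square root series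
  converges; that every \<open>star y * y\<close> satisfies it is shown only once supports exist.
  Each element built from \<open>x\<close> carries the clause that it commutes with whatever
  commutes with \<open>x\<close>. This is how products of roots, supports and spectral projections
  are known to commute. A spectral projection at an eigenvalue is an arbitrary choice, so traces can
  be compared only between levels \<open>r < r'\<close>. In the Riemann sums this costs a shift by
  one index, an error of one mesh width that disappears in the limit. Comparison of projections
  rests on one estimate: if \<open>norm (p * e * p) < 1\<close> for projections, then
  \<open>(1 - e) * p\<close> is bounded below on \<open>p\<close>, and dividing by its absolute
  value carries \<open>p\<close> isometrically under \<open>1 - e\<close>.\<close>

lemma gbinomial_Suc_rec:
  "((a::real) gchoose Suc n) = (a gchoose n) * ((a - real n) / real (Suc n))"
  by (simp add: gbinomial_prod_rev)

lemma gbinomial_half_sign: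
  fixes n :: nat
  assumes "n \<ge> 1"
  shows "((1/2::real) gchoose n) * (-1) ^ n \<le> 0"
  using assms
proof (induction n rule: dec_induct)
  case base
  then show ?case by simp
next
  case (step n)
  have "((1/2::real) gchoose Suc n) = ((1/2) gchoose n) * ((1/2 - real n) / real (Suc n))"
    by (rule gbinomial_Suc_rec)
  then have "((1/2::real) gchoose Suc n) * (-1) ^ Suc n =
      (((1/2) gchoose n) * (-1) ^ n) * ((real n - 1/2) / real (Suc n))"
    by (simp only: power_Suc) (simp add: field_simps)
  moreover have "(real n - 1/2) / real (Suc n) \<ge> 0" using step by simp
  ultimately show ?case
    using step.IH mult_nonpos_nonneg by metis
qed

lemma gbinomial_minus_half_sign:
  "((-1/2::real) gchoose n) * (-1) ^ n \<ge> 0"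
proof (induction n)
  case 0
  then show ?case by simp
next
  case (Suc n)
  have "((-1/2::real) gchoose Suc n) = ((-1/2) gchoose n) * ((-1/2 - real n) / real (Suc n))"
    by (rule gbinomial_Suc_rec)
  then have "((-1/2::real) gchoose Suc n) * (-1) ^ Suc n =
      (((-1/2) gchoose n) * (-1) ^ n) * ((real n + 1/2) / real (Suc n))"
    by (simp only: power_Suc) (simp add: field_simps)
  then show ?case using Suc by simp
qed

text \<open>All coefficients of \<open>sqrt (1 - x)\<close> after the first are non-positive, so the
  absolute values add up to a signed partial sum, which has a closed form. The bound gives absolute
  convergence on the closed unit ball, boundary included.\<close>

lemma gbinomial_half_sum_le:
  "(\<Sum>k<n. \<bar>(1/2::real) gchoose Suc k\<bar>) \<le> 1"
proof -
  have "(\<Sum>k<n. \<bar>(1/2::real) gchoose Suc k\<bar>) = (\<Sum>k<n. - (((1/2::real) gchoose Suc k) * (-1) ^ Suc k))"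
  proof (rule sum.cong)
    fix k
    have "\<bar>(1/2::real) gchoose Suc k\<bar> = \<bar>((1/2::real) gchoose Suc k) * (-1) ^ Suc k\<bar>"
      by (simp add: abs_mult power_abs)
    then show "\<bar>(1/2::real) gchoose Suc k\<bar> = - (((1/2::real) gchoose Suc k) * (-1) ^ Suc k)"
      using gbinomial_half_sign[of "Suc k"] by simp
  qed simp
  also have "\<dots> = 1 - (\<Sum>k\<le>n. ((1/2::real) gchoose k) * (-1) ^ k)"
    by (simp add: sum.atMost_shift sum_negf)
  also have "\<dots> = 1 - (-1) ^ n * ((-1/2::real) gchoose n)"
    by (simp only: gbinomial_sum_lower_neg) simp
  also have "\<dots> \<le> 1" using gbinomial_minus_half_sign[of n] by (simp add: mult.commute)
  finally show ?thesis .
qed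

lemma gbinomial_half_summable: "summable (\<lambda>n. \<bar>(1/2::real) gchoose n\<bar>)"
proof -
  have "summable (\<lambda>n. \<bar>(1/2::real) gchoose Suc n\<bar>)"
    by (rule summableI_nonneg_bounded[where x=1]) (auto simp: gbinomial_half_sum_le)
  then show ?thesis by (rule summable_Suc_iff[THEN iffD1])
qed

definition sqrt_series :: "'a::{real_normed_algebra_1,banach} \<Rightarrow> 'a" where
  "sqrt_series u = (\<Sum>n. ((1/2::real) gchoose n) *\<^sub>R u ^ n)"

lemma sqrt_series_summable_norm:
  fixes u :: "'a::{real_normed_algebra_1,banach}"
  assumes "norm u \<le> 1"
  shows "summable (\<lambda>n. norm (((1/2::real) gchoose n) *\<^sub>R u ^ n))"
proof (rule summable_comparison_test'[OF gbinomial_half_summable, of 0])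
  fix n :: nat
  have "norm (u ^ n) \<le> 1"
    using norm_power_ineq[of u n] power_le_one[OF norm_ge_zero assms, of n] by linarith
  then show "norm (norm (((1/2::real) gchoose n) *\<^sub>R u ^ n)) \<le> \<bar>(1/2::real) gchoose n\<bar>"
    by (simp add: mult_left_le)
qed

lemmas sqrt_series_summable = sqrt_series_summable_norm[THEN summable_norm_cancel]

text \<open>The Cauchy product has the coefficients \<open>1 gchoose k\<close> by Vandermonde's
  identity, and these vanish for \<open>k > 1\<close>.\<close>

lemma sqrt_series_square:
  fixes u :: "'a::{real_normed_algebra_1,banach}"
  assumes "norm u \<le> 1"
  shows "sqrt_series u * sqrt_series u = 1 + u"
proof -
  have "(\<lambda>k. \<Sum>i\<le>k. (((1/2::real) gchoose i) *\<^sub>R u ^ i) * (((1/2::real) gchoose (k - i)) *\<^sub>R u ^ (k - i)))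
      sums (sqrt_series u * sqrt_series u)"
    unfolding sqrt_series_def
    by (rule Cauchy_product_sums) (rule sqrt_series_summable_norm[OF assms])+
  also have "(\<lambda>k. \<Sum>i\<le>k. (((1/2::real) gchoose i) *\<^sub>R u ^ i) * (((1/2::real) gchoose (k - i)) *\<^sub>R u ^ (k - i)))
      = (\<lambda>k. ((1::real) gchoose k) *\<^sub>R u ^ k)"
  proof
    fix k
    have "(\<Sum>i\<le>k. (((1/2::real) gchoose i) *\<^sub>R u ^ i) * (((1/2::real) gchoose (k - i)) *\<^sub>R u ^ (k - i)))
       = (\<Sum>i\<le>k. (((1/2::real) gchoose i) * ((1/2::real) gchoose (k - i))) *\<^sub>R u ^ k)"
      by (rule sum.cong) (auto simp flip: power_add)
    also have "\<dots> = ((1::real) gchoose k) *\<^sub>R u ^ k"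
      using gbinomial_Vandermonde[of "1/2::real" "1/2" k]
      by (simp add: scaleR_sum_left[symmetric] atMost_atLeast0)
    finally show "(\<Sum>i\<le>k. (((1/2::real) gchoose i) *\<^sub>R u ^ i) * (((1/2::real) gchoose (k - i)) *\<^sub>R u ^ (k - i)))
       = ((1::real) gchoose k) *\<^sub>R u ^ k" .
  qed
  finally have 1: "(\<lambda>k. ((1::real) gchoose k) *\<^sub>R u ^ k) sums (sqrt_series u * sqrt_series u)" .
  have z: "((1::real) gchoose k) = 0" if "k \<notin> {0,1}" for k :: nat
  proof -
    have "((1::real) gchoose k) = of_nat (1 choose k)"
      using binomial_gbinomial[of 1 k, where 'a=real] by simp
    also have "1 choose k = 0" using that by (intro binomial_eq_0) auto
    finally show ?thesis by simp
  qed
  have "(\<lambda>k. ((1::real) gchoose k) *\<^sub>R u ^ k) sums (\<Sum>k\<in>{0,1}. ((1::real) gchoose k) *\<^sub>R u ^ k)"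
    by (rule sums_finite) (auto simp: z)
  then have "(\<lambda>k. ((1::real) gchoose k) *\<^sub>R u ^ k) sums (1 + u)"
    by simp
  then show ?thesis using 1 sums_unique2 by blast
qed

text \<open>This makes the root positive again: after scaling by \<open>sqrt r\<close>, the bound is
  the norm condition in \<open>pos\<close>.\<close>

lemma sqrt_series_near_one:
  fixes u :: "'a::{real_normed_algebra_1,banach}"
  assumes "norm u \<le> 1"
  shows "norm (1 - sqrt_series u) \<le> 1"
proof -
  have s: "summable (\<lambda>n. norm (((1/2::real) gchoose n) *\<^sub>R u ^ n))"
    by (rule sqrt_series_summable_norm[OF assms])
  have "sqrt_series u = 1 + (\<Sum>n. ((1/2::real) gchoose Suc n) *\<^sub>R u ^ Suc n)"
    unfolding sqrt_series_def using suminf_split_head[OF sqrt_series_summable[OF assms]] by simp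
  then have "norm (1 - sqrt_series u) = norm (\<Sum>n. ((1/2::real) gchoose Suc n) *\<^sub>R u ^ Suc n)"
    by (simp only: diff_add_eq_diff_diff_swap) (simp add: norm_minus_commute)
  also have "\<dots> \<le> (\<Sum>n. norm (((1/2::real) gchoose Suc n) *\<^sub>R u ^ Suc n))"
    using s by (intro summable_norm) (subst summable_Suc_iff, assumption)
  also have "\<dots> \<le> 1"
  proof (rule suminf_le_const)
    show "summable (\<lambda>n. norm (((1/2::real) gchoose Suc n) *\<^sub>R u ^ Suc n))"
      using s by (subst summable_Suc_iff)
    fix n
    have "(\<Sum>i<n. norm (((1/2::real) gchoose Suc i) *\<^sub>R u ^ Suc i)) \<le> (\<Sum>k<n. \<bar>(1/2::real) gchoose Suc k\<bar>)"
    proof (rule sum_mono)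
      fix i
      have "norm (u ^ Suc i) \<le> 1"
        using norm_power_ineq[of u "Suc i"] power_le_one[OF norm_ge_zero assms, of "Suc i"] by linarith
      then show "norm (((1/2::real) gchoose Suc i) *\<^sub>R u ^ Suc i) \<le> \<bar>(1/2::real) gchoose Suc i\<bar>"
        unfolding norm_scaleR by (intro mult_left_le) auto
    qed
    also have "\<dots> \<le> 1" by (rule gbinomial_half_sum_le)
    finally show "(\<Sum>i<n. norm (((1/2::real) gchoose Suc i) *\<^sub>R u ^ Suc i)) \<le> 1" .
  qed
  finally show ?thesis .
qed

lemma sqrt_series_commute:
  fixes u :: "'a::{real_normed_algebra_1,banach}"
  assumes "norm u \<le> 1" "z * u = u * z"
  shows "z * sqrt_series u = sqrt_series u * z"
proof -
  have p: "z * u ^ n = u ^ n * z" for n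
    using power_commuting_commutes[OF assms(2)[symmetric], of n] by simp
  have "z * sqrt_series u = (\<Sum>n. z * (((1/2::real) gchoose n) *\<^sub>R u ^ n))"
    unfolding sqrt_series_def by (rule suminf_mult[symmetric]) (rule sqrt_series_summable[OF assms(1)])
  also have "\<dots> = (\<Sum>n. (((1/2::real) gchoose n) *\<^sub>R u ^ n) * z)"
    by (simp add: p)
  also have "\<dots> = sqrt_series u * z"
    unfolding sqrt_series_def by (rule suminf_mult2[symmetric]) (rule sqrt_series_summable[OF assms(1)])
  finally show ?thesis .
qed

text \<open>Comparisons of singular values can break down at a single point: the trace of a spectral
  projection, or \<open>t = 1\<close>, from which on they vanish.\<close>

lemma integral_le_except_point:
  fixes f g :: "real \<Rightarrow> real"
  assumes f: "f integrable_on {u..v}" and g: "g integrable_on {u..v}"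
    and le: "\<And>t. u \<le> t \<Longrightarrow> t \<le> v \<Longrightarrow> t \<noteq> p \<Longrightarrow> f t \<le> g t"
  shows "integral {u..v} f \<le> integral {u..v} g"
proof -
  define h where "h = (\<lambda>t. if t = p then g t else f t)"
  have "h integrable_on {u..v}"
    by (rule integrable_spike_finite[OF _ _ f, of "{p}"]) (auto simp: h_def)
  moreover have "integral {u..v} f = integral {u..v} h"
    by (rule integral_spike[of "{p}"]) (auto simp: h_def)
  ultimately show ?thesis using integral_le[of h "{u..v}" g] g le by (auto simp: h_def)
qed

text \<open>A substitute for Zorn's lemma that only needs upper bounds of sequences, at the price of a
  monotone real function: step \<open>n\<close> comes within \<open>1 / (n + 1)\<close> of the supremum still reachable.\<close>

lemma maximal_by_measure:
  fixes R :: "'b \<Rightarrow> 'b \<Rightarrow> bool" and \<phi> :: "'b \<Rightarrow> real"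
  assumes x0: "x0 \<in> S" and refl: "\<And>x. x \<in> S \<Longrightarrow> R x x"
    and trans: "\<And>x y z. x \<in> S \<Longrightarrow> y \<in> S \<Longrightarrow> z \<in> S \<Longrightarrow> R x y \<Longrightarrow> R y z \<Longrightarrow> R x z"
    and mono: "\<And>x y. x \<in> S \<Longrightarrow> y \<in> S \<Longrightarrow> R x y \<Longrightarrow> \<phi> x \<le> \<phi> y"
    and bdd: "\<And>x. x \<in> S \<Longrightarrow> \<phi> x \<le> K"
    and seq: "\<And>X. (\<And>n. X n \<in> S) \<Longrightarrow> (\<And>n. R (X n) (X (Suc n))) \<Longrightarrow> \<exists>u\<in>S. \<forall>n. R (X n) u"
  obtains m where "m \<in> S" "\<And>y. y \<in> S \<Longrightarrow> R m y \<Longrightarrow> \<phi> y \<le> \<phi> m"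
proof -
  define M where "M x = (SUP y\<in>{y\<in>S. R x y}. \<phi> y)" for x
  have bd: "bdd_above (\<phi> ` {y\<in>S. R x y})" for x using bdd by (auto intro!: bdd_aboveI2)
  have le: "\<phi> y \<le> M x" if "y \<in> S" "R x y" for x y
    unfolding M_def by (rule cSUP_upper[OF _ bd]) (use that in auto)
  have "\<exists>X. \<forall>n. X n \<in> S \<and> (R (X n) (X (Suc n)) \<and> M (X n) - inverse (real (Suc n)) < \<phi> (X (Suc n)))"
  proof (rule dependent_nat_choice)
    fix x n assume x: "x \<in> S"
    have "M x - inverse (real (Suc n)) < M x" by simp
    then have "\<exists>y\<in>{y\<in>S. R x y}. M x - inverse (real (Suc n)) < \<phi> y"
      by (subst less_cSUP_iff[OF _ bd, symmetric]) (use x refl in \<open>auto simp: M_def\<close>)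
    then show "\<exists>y. y \<in> S \<and> R x y \<and> M x - inverse (real (Suc n)) < \<phi> y" by blast
  qed (use x0 in blast)
  then obtain X where X: "\<And>n. X n \<in> S" "\<And>n. R (X n) (X (Suc n))"
    "\<And>n. M (X n) - inverse (real (Suc n)) < \<phi> (X (Suc n))" by blast
  obtain u where u: "u \<in> S" "\<And>n. R (X n) u" using seq[of X, OF X(1,2)] by blast
  show thesis
  proof (rule that[OF u(1)])
    fix y assume y: "y \<in> S" "R u y"
    have "\<phi> y \<le> \<phi> u + inverse (real (Suc n))" for n
      using le[OF y(1) trans[OF X(1) u(1) y(1) u(2) y(2), of n]] X(3)[of n] mono[OF X(1) u(1) u(2), of "Suc n"]
      by linarith
    moreover have "(\<lambda>n. \<phi> u + inverse (real (Suc n))) \<longlonglongrightarrow> \<phi> u + 0"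
      by (intro tendsto_intros LIMSEQ_inverse_real_of_nat)
    ultimately show "\<phi> y \<le> \<phi> u" using LIMSEQ_le_const[of _ "\<phi> u" "\<phi> y"] by auto
  qed
qed

section \<open>Positive elements\<close>

locale II1 =
  fixes star :: "'a::{real_normed_algebra_1,banach} \<Rightarrow> 'a" and j :: 'a and \<tau> :: "'a \<Rightarrow> complex"
  assumes II1: "II1_factor star j \<tau>"
begin

section \<open>The involution and the imaginary unit \<open>j\<close>\<close>

lemma is_cstar_algebra: "cstar_algebra star j" using II1 by (simp add: II1_factor_def)

lemma j_sq: "j * j = -1" and j_central: "j * x = x * j"
  and norm_cscale: "norm (cscale j z x) = cmod z * norm x"
  and star_star[simp]: "star (star x) = x" and star_add: "star (x + y) = star x + star y"
  and star_mult: "star (x * y) = star y * star x"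
  and star_cscale: "star (cscale j z x) = cscale j (cnj z) (star x)"
  and norm_star_mult: "norm (star x * x) = (norm x)\<^sup>2"
  using is_cstar_algebra unfolding cstar_algebra_def by blast+

lemma star_scaleR: "star (r *\<^sub>R x) = r *\<^sub>R star x"
  using star_cscale[of "of_real r" x] by (simp add: cscale_def)

lemma star_j_mult: "star (j * x) = - (j * star x)"
  using star_cscale[of \<i> x] by (simp add: cscale_def)

lemma star_minus: "star (- x) = - star x"
  using star_scaleR[of "-1" x] by simp

lemma star_diff: "star (x - y) = star x - star y"
  using star_add[of x "- y"] by (simp add: star_minus)

lemma star_0[simp]: "star 0 = 0" using star_diff[of 0 0] by simp

lemma star_1[simp]: "star 1 = 1"
  by (metis mult.right_neutral mult.left_neutral star_mult star_star)

lemma star_sum: "star (sum f A) = (\<Sum>i\<in>A. star (f i))"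
  by (induction A rule: infinite_finite_induct) (auto simp: star_add)

lemma star_power: "star (x ^ n) = star x ^ n"
  by (induction n) (auto simp: star_mult power_commutes)

lemma star_j: "star j = - j"
  using star_j_mult[of 1] by simp

lemma mult_star_j: "x * star j = - (j * x)" "star j * x = - (j * x)"
  by (simp_all add: star_j j_central)

lemma mult_star_j_mult: "x * (star j * y) = - (j * (x * y))"
  by (metis j_central mult.assoc mult_minus_left mult_minus_right star_j)

lemmas star_simps = star_add star_diff star_minus star_scaleR star_mult star_power star_sum
  mult_star_j mult_star_j_mult

lemma norm_star[simp]: "norm (star x) = norm x"
proof -
  have 1: "norm y \<le> norm (star y)" for y
  proof (cases "y = 0")
    case False
    have "(norm y)\<^sup>2 \<le> norm (star y) * norm y"
      using norm_star_mult[of y] norm_mult_ineq[of "star y" y] by simp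
    then show ?thesis using False by (simp add: power2_eq_square)
  qed simp
  show ?thesis using 1[of x] 1[of "star x"] by simp
qed

lemma norm_j_mult[simp]: "norm (j * x) = norm x"
  using norm_cscale[of \<i> x] by (simp add: cscale_def)

lemma norm_mult_star: "norm (x * star x) = (norm x)\<^sup>2"
  using norm_star_mult[of "star x"] by simp

lemma star_mult_eq_0: "star x * x = 0 \<longleftrightarrow> x = 0"
  using norm_star_mult[of x] by auto

lemma bounded_linear_star: "bounded_linear star"
  by (rule bounded_linear_intro[where K=1]) (auto simp: star_add star_scaleR)

lemma j_mult_mult: "x * (j * y) = j * (x * y)"
  by (metis j_central mult.assoc)

lemma j_mult_j: "j * (j * x) = - x"
  by (metis j_sq mult.assoc mult_minus1)

lemma star_sqrt_series:
  assumes "norm u \<le> 1" "star u = u"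
  shows "star (sqrt_series u) = sqrt_series u"
  unfolding sqrt_series_def
  by (subst bounded_linear.suminf[OF bounded_linear_star sqrt_series_summable[OF assms(1)]])
     (simp add: star_simps assms)

text \<open>For self-adjoint \<open>x\<close> the inequality says that the spectrum lies in the
  interval from 0 to \<open>2 r\<close>. In this form sums are immediate by the triangle inequality;
  agreement with \<open>positive\<close> comes later, in \<open>positive_eq_pos\<close>.\<close>

definition pos :: "'a \<Rightarrow> bool" where
  "pos x \<longleftrightarrow> star x = x \<and> (\<exists>r. norm (r *\<^sub>R 1 - x) \<le> r)"

lemma pos_star: "pos x \<Longrightarrow> star x = x" by (simp add: pos_def)

text \<open>Writing \<open>x = r (1 + u)\<close> with \<open>norm u \<le> 1\<close> brings the root
  within reach of the series. The last clause stands for the root being a limit of polynomials in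
  \<open>x\<close>.\<close>

lemma pos_sqrt:
  assumes "pos x"
  shows "\<exists>y. pos y \<and> y * y = x \<and> (\<forall>z. z * x = x * z \<longrightarrow> z * y = y * z)"
proof -
  obtain r where r: "norm (r *\<^sub>R 1 - x) \<le> r" and sx: "star x = x"
    using assms by (auto simp: pos_def)
  have r0: "r \<ge> 0" using r norm_ge_zero order_trans by blast
  show ?thesis
  proof (cases "r = 0")
    case True
    then have "x = 0" using r by simp
    then show ?thesis by (intro exI[of _ 0]) (auto simp: pos_def intro!: exI[of _ 0])
  next
    case False
    then have rp: "r > 0" using r0 by simp
    define u where "u = (1/r) *\<^sub>R x - 1"
    have xu: "x = r *\<^sub>R (1 + u)" using rp by (simp add: u_def)
    have "norm u = norm ((1/r) *\<^sub>R (r *\<^sub>R 1 - x))"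
      using rp by (simp add: u_def scaleR_diff_right norm_minus_commute)
    also have "\<dots> = (1/r) * norm (r *\<^sub>R 1 - x)" using rp by (simp only: norm_scaleR) simp
    also have "\<dots> \<le> 1" using r rp by (simp add: field_simps)
    finally have u1: "norm u \<le> 1" .
    have su: "star u = u" by (simp add: u_def star_simps sx)
    define y where "y = sqrt r *\<^sub>R sqrt_series u"
    have "star y = y" by (simp add: y_def star_simps star_sqrt_series[OF u1 su])
    moreover have "norm (sqrt r *\<^sub>R 1 - y) \<le> sqrt r"
    proof -
      have "norm (sqrt r *\<^sub>R 1 - y) = sqrt r * norm (1 - sqrt_series u)"
        using rp by (simp add: y_def scaleR_diff_right[symmetric])
      then show ?thesis using sqrt_series_near_one[OF u1] rp by (simp add: mult_left_le)
    qed
    ultimately have "pos y" by (auto simp: pos_def)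
    moreover have "y * y = x"
      using rp by (simp add: y_def sqrt_series_square[OF u1] xu)
    moreover have "z * y = y * z" if "z * x = x * z" for z
    proof -
      have "z * u = u * z" using that by (simp add: u_def algebra_simps)
      then show ?thesis by (simp add: y_def sqrt_series_commute[OF u1])
    qed
    ultimately show ?thesis by blast
  qed
qed

lemma norm_sa_square: "star y = y \<Longrightarrow> norm (y * y) = (norm y)\<^sup>2"
  using norm_star_mult[of y] by simp

text \<open>If \<open>\<parallel>y\<parallel> \<le> 1\<close> then \<open>u = y + j z\<close> with \<open>z\<^sup>2 = 1 - y\<^sup>2\<close> is unitary, so its imaginary part \<open>z\<close>
  has norm at most 1.\<close>

lemma norm_one_minus_square:
  assumes sy: "star y = y" and y1: "norm y \<le> 1"
  shows "norm (1 - y * y) \<le> 1"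
proof -
  have "norm (1 *\<^sub>R 1 - (1 - y * y)) \<le> 1"
    using norm_sa_square[OF sy] power_le_one[OF norm_ge_zero y1, of 2] by simp
  then have "pos (1 - y * y)" by (auto simp: pos_def star_simps sy simp del: scaleR_one)
  then obtain z where z: "pos z" "z * z = 1 - y * y" "\<And>w. w * (1 - y * y) = (1 - y * y) * w \<Longrightarrow> w * z = z * w"
    using pos_sqrt by blast
  have sz: "star z = z" using z(1) by (simp add: pos_def)
  have yz: "y * z = z * y" by (rule z(3)) (simp add: algebra_simps)
  define u where "u = y + j * z"
  have "star u * u = (y - j * z) * (y + j * z)" by (simp add: u_def star_simps sy sz)
  also have "\<dots> = y * y + z * z"
    by (simp add: algebra_simps j_mult_mult[of y] j_mult_mult[of z] j_mult_j yz)
  finally have "star u * u = 1" by (simp add: z(2))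
  then have u1: "norm u = 1" using norm_star_mult[of u] power2_eq_iff_nonneg[of "norm u" 1] by simp
  have "u - star u = 2 *\<^sub>R (j * z)" by (simp add: u_def star_simps sy sz scaleR_2)
  then have "2 * norm z = norm (u - star u)" by simp
  then have "2 * norm z \<le> norm u + norm (star u)" using norm_triangle_ineq4[of u "star u"] by simp
  then have "norm z \<le> 1" using u1 by simp
  then show ?thesis using norm_sa_square[OF sz] z(2) power_le_one[OF norm_ge_zero, of z 2] by simp
qed

lemma norm_square_diff:
  assumes sy: "star y = y"
  shows "norm ((norm y)\<^sup>2 *\<^sub>R 1 - y * y) \<le> (norm y)\<^sup>2"
proof (cases "y = 0")
  case False
  define w where "w = (1 / norm y) *\<^sub>R y"
  have "norm (1 - w * w) \<le> 1"
    by (rule norm_one_minus_square) (use False in \<open>auto simp: w_def star_simps sy\<close>)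
  moreover have "(norm y)\<^sup>2 *\<^sub>R 1 - y * y = (norm y)\<^sup>2 *\<^sub>R (1 - w * w)"
    using False by (simp add: w_def algebra_simps power2_eq_square)
  ultimately show ?thesis by (simp add: mult_left_le)
qed simp

lemma pos_square: "star y = y \<Longrightarrow> pos (y * y)"
  using norm_square_diff[of y] by (auto simp: pos_def star_simps)

text \<open>The witness \<open>r\<close> in \<open>pos\<close> can always be the norm. This uniform
  choice is what allows passage to norm limits in \<open>pos_limit\<close>.\<close>

lemma pos_norm:
  assumes "pos x" shows "norm (norm x *\<^sub>R 1 - x) \<le> norm x"
proof -
  obtain y where "pos y" "y * y = x" using pos_sqrt[OF assms] by blast
  then show ?thesis using norm_square_diff[of y] norm_sa_square[of y] by (simp add: pos_def)
qed

lemma pos_norm_ge: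
  assumes "pos x" "norm x \<le> r" shows "norm (r *\<^sub>R 1 - x) \<le> r"
proof -
  have "norm ((r - norm x) *\<^sub>R 1 + (norm x *\<^sub>R 1 - x)) \<le> norm ((r - norm x) *\<^sub>R (1::'a)) + norm (norm x *\<^sub>R 1 - x)"
    by (rule norm_triangle_ineq)
  also have "\<dots> \<le> (r - norm x) + norm x"
    using pos_norm[OF assms(1)] assms(2) by simp
  finally show ?thesis by (simp add: algebra_simps)
qed

lemma pos_add: assumes "pos x" "pos y" shows "pos (x + y)"
proof -
  obtain r s where "norm (r *\<^sub>R 1 - x) \<le> r" "norm (s *\<^sub>R 1 - y) \<le> s"
    using assms by (auto simp: pos_def)
  then have "norm ((r *\<^sub>R 1 - x) + (s *\<^sub>R 1 - y)) \<le> r + s"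
    by (intro norm_triangle_mono)
  then have "norm ((r + s) *\<^sub>R 1 - (x + y)) \<le> r + s" by (simp add: algebra_simps)
  then show ?thesis using assms by (auto simp: pos_def star_simps)
qed

lemma pos_0[simp]: "pos 0" by (auto simp: pos_def intro!: exI[of _ 0])

lemma pos_1[simp]: "pos 1" using pos_square[of 1] by simp

lemma pos_scaleR: assumes "pos x" "t \<ge> 0" shows "pos (t *\<^sub>R x)"
proof -
  obtain r where "norm (r *\<^sub>R 1 - x) \<le> r" using assms by (auto simp: pos_def)
  moreover have "(t * r) *\<^sub>R 1 - t *\<^sub>R x = t *\<^sub>R (r *\<^sub>R 1 - x)" by (simp add: scaleR_diff_right)
  ultimately have "norm ((t * r) *\<^sub>R 1 - t *\<^sub>R x) \<le> t * r"
    using assms(2) by (simp add: mult_left_mono)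
  then show ?thesis using assms by (auto simp: pos_def star_simps)
qed

lemma pos_scaleR_one: "t \<ge> 0 \<Longrightarrow> pos (t *\<^sub>R 1)" by (simp add: pos_scaleR)

lemma pos_sum: "(\<And>i. i \<in> A \<Longrightarrow> pos (f i)) \<Longrightarrow> pos (sum f A)"
  by (induction A rule: infinite_finite_induct) (auto simp: pos_add)

lemma pos_trans: "pos (y - x) \<Longrightarrow> pos (z - y) \<Longrightarrow> pos (z - x)"
  using pos_add[of "y - x" "z - y"] by simp

lemma pos_limit:
  assumes "\<And>n. pos (X n)" "X \<longlonglongrightarrow> x" shows "pos x"
proof -
  have "(\<lambda>n. star (X n)) \<longlonglongrightarrow> star x"
    using bounded_linear.tendsto[OF bounded_linear_star assms(2)] .
  then have "X \<longlonglongrightarrow> star x" using assms(1) by (simp add: pos_star)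
  then have "star x = x" using assms(2) by (rule LIMSEQ_unique)
  moreover have "norm (norm x *\<^sub>R 1 - x) \<le> norm x"
  proof (rule tendsto_le)
    show "(\<lambda>n. norm (X n)) \<longlonglongrightarrow> norm x" using assms(2) by (intro tendsto_intros)
    show "(\<lambda>n. norm (norm (X n) *\<^sub>R 1 - X n)) \<longlonglongrightarrow> norm (norm x *\<^sub>R 1 - x)"
      using assms(2) by (intro tendsto_intros)
  qed (use assms(1) pos_norm in auto)
  ultimately show ?thesis by (auto simp: pos_def)
qed

lemma pos_closure:
  assumes "\<And>\<epsilon>. \<epsilon> > 0 \<Longrightarrow> pos (x + \<epsilon> *\<^sub>R y)" shows "pos x"
proof (rule pos_limit)
  show "pos (x + inverse (real (Suc n)) *\<^sub>R y)" for n by (rule assms) simp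
  have "(\<lambda>n. x + inverse (real (Suc n)) *\<^sub>R y) \<longlonglongrightarrow> x + 0 *\<^sub>R y"
    by (intro tendsto_intros LIMSEQ_inverse_real_of_nat)
  then show "(\<lambda>n. x + inverse (real (Suc n)) *\<^sub>R y) \<longlonglongrightarrow> x" by simp
qed

text \<open>With commuting roots \<open>y\<close> of \<open>x\<close> and \<open>z\<close> of
  \<open>- x\<close>, the element \<open>w = y + j * z\<close> has
  \<open>star w * w = x - x = 0\<close>. Hence \<open>w\<close> and
  \<open>star w = y - j * z\<close> vanish, and so does their sum.\<close>

lemma pos_antisym: assumes "pos x" "pos (- x)" shows "x = 0"
proof -
  obtain y where y: "pos y" "y * y = x" "\<And>z. z * x = x * z \<Longrightarrow> z * y = y * z"
    using pos_sqrt[OF assms(1)] by blast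
  obtain z where z: "pos z" "z * z = - x" "\<And>w. w * (- x) = (- x) * w \<Longrightarrow> w * z = z * w"
    using pos_sqrt[OF assms(2)] by blast
  have "y * z = z * y" by (rule z(3)) (simp flip: y(2) add: mult.assoc)
  then have "star (y + j * z) * (y + j * z) = y * y + z * z"
    using y(1) z(1) by (simp add: pos_def star_simps algebra_simps j_mult_mult[of y] j_mult_mult[of z] j_mult_j)
  then have "y + j * z = 0" using star_mult_eq_0[of "y + j * z"] y(2) z(2) by simp
  moreover from this have "star (y + j * z) = 0" by simp
  then have "y - j * z = 0" using y(1) z(1) by (simp add: star_simps pos_def)
  ultimately have "(y + j * z) + (y - j * z) = 0" by simp
  then have "2 *\<^sub>R y = 0" by (simp add: scaleR_2)
  then show ?thesis using y(2) by simp
qed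

text \<open>The roots of commuting positive elements commute, so the product is the square of a
  self-adjoint element.\<close>

lemma pos_comm_mult: assumes "pos x" "pos y" "x * y = y * x" shows "pos (x * y)"
proof -
  obtain s where s: "pos s" "s * s = x" "\<And>z. z * x = x * z \<Longrightarrow> z * s = s * z"
    using pos_sqrt[OF assms(1)] by blast
  obtain t where t: "pos t" "t * t = y" "\<And>z. z * y = y * z \<Longrightarrow> z * t = t * z"
    using pos_sqrt[OF assms(2)] by blast
  have "y * s = s * y" using s(3) assms(3) by simp
  then have st: "s * t = t * s" using t(3) by simp
  then have "star (s * t) = s * t" using s(1) t(1) by (simp add: star_simps pos_def)
  moreover have "x * y = (s * t) * (s * t)"
    unfolding s(2)[symmetric] t(2)[symmetric] by (metis st mult.assoc)
  ultimately show ?thesis using pos_square by simp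
qed

lemma pos_norm_diff: assumes "star x = x" "norm x \<le> r" shows "pos (r *\<^sub>R 1 - x)"
  using assms by (auto simp: pos_def star_simps intro!: exI[of _ r])

lemma pos_norm_add: assumes "star x = x" "norm x \<le> r" shows "pos (r *\<^sub>R 1 + x)"
  using pos_norm_diff[of "- x" r] assms by (simp add: star_simps)

text \<open>The two factors commute, so \<open>r * r - x * x\<close> has a root \<open>y\<close>.
  Then \<open>x + j * y\<close> is \<open>r\<close> times an isometry, and \<open>x\<close> is its
  real part.\<close>

lemma norm_le_of_pos:
  assumes "pos (r *\<^sub>R 1 - x)" "pos (r *\<^sub>R 1 + x)" "r \<ge> 0"
  shows "norm x \<le> r"
proof -
  have "star (r *\<^sub>R 1 + x) = r *\<^sub>R 1 + x" using assms(2) by (rule pos_star)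
  then have sx: "star x = x" by (simp add: star_simps)
  have "pos ((r *\<^sub>R 1 - x) * (r *\<^sub>R 1 + x))"
    by (rule pos_comm_mult) (use assms in \<open>auto simp: algebra_simps\<close>)
  then have "pos ((r * r) *\<^sub>R 1 - x * x)" by (simp add: algebra_simps)
  then obtain y where y: "pos y" "y * y = (r * r) *\<^sub>R 1 - x * x"
     "\<And>z. z * ((r * r) *\<^sub>R 1 - x * x) = ((r * r) *\<^sub>R 1 - x * x) * z \<Longrightarrow> z * y = y * z"
    using pos_sqrt by blast
  have xy: "x * y = y * x" by (rule y(3)) (simp add: algebra_simps)
  define u where "u = x + j * y"
  have su: "star u = x - j * y" using y(1) by (simp add: u_def star_simps pos_def sx)
  have "star u * u = x * x + y * y"
    by (simp add: su) (simp add: u_def algebra_simps j_mult_mult[of y] j_mult_mult[of x] j_mult_j xy)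
  then have "norm (star u * u) = r\<^sup>2" by (simp add: y(2) power2_eq_square)
  then have nu: "norm u = r" using norm_star_mult[of u] assms(3) by (simp add: power2_eq_iff_nonneg)
  have "u + star u = 2 *\<^sub>R x" by (simp add: su) (simp add: u_def scaleR_2)
  then have "2 * norm x = norm (u + star u)" by simp
  then have "2 * norm x \<le> norm u + norm (star u)" using norm_triangle_ineq[of u "star u"] by simp
  then show ?thesis using nu by simp
qed

lemma norm_le_of_pos': "pos x \<Longrightarrow> pos (r *\<^sub>R 1 - x) \<Longrightarrow> r \<ge> 0 \<Longrightarrow> norm x \<le> r"
  by (rule norm_le_of_pos) (auto simp: pos_add pos_scaleR_one)

section \<open>Trace norm and projections\<close>

abbreviation proj :: "'a \<Rightarrow> bool" where "proj \<equiv> is_projection star"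

definition tr :: "'a \<Rightarrow> real" where "tr x = Re (\<tau> x)"

lemma II1_conditions:
  shows tau_add[rule_format]: "\<forall>x y. \<tau> (x + y) = \<tau> x + \<tau> y"
    and tau_cscale[rule_format]: "\<forall>z x. \<tau> (cscale j z x) = z * \<tau> x"
    and tau_positive[rule_format]: "\<forall>x. positive star x \<longrightarrow> Im (\<tau> x) = 0 \<and> Re (\<tau> x) \<ge> 0"
    and tau_1: "\<tau> 1 = 1"
    and tau_comm[rule_format]: "\<forall>x y. \<tau> (x * y) = \<tau> (y * x)"
    and tau_faithful[rule_format, OF conjI]: "\<forall>x. positive star x \<and> \<tau> x = 0 \<longrightarrow> x = 0"
    and monotone_complete[rule_format]: "\<forall>D. bdd_directed star D \<longrightarrow> (\<exists>s. is_op_lub star D s)"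
    and normal[rule_format, OF conjI]: "\<forall>D s. bdd_directed star D \<and> is_op_lub star D s \<longrightarrow>
          Re (\<tau> s) = (SUP x\<in>D. Re (\<tau> x))"
    and trivial_center[THEN spec, THEN mp]: "\<forall>x. (\<forall>y. x * y = y * x) \<longrightarrow> (\<exists>z. x = cscale j z 1)"
    and infinite_dim: "\<not> (\<exists>B. finite B \<and> span B = (UNIV :: 'a set))"
  using II1 unfolding II1_factor_def by - (elim conjE; assumption)+


section \<open>The real part of the trace\<close>

lemma tau_scaleR: "\<tau> (r *\<^sub>R x) = r *\<^sub>R \<tau> x"
  using tau_cscale[of "of_real r" x] by (simp add: cscale_def scaleR_conv_of_real)

lemma tau_diff: "\<tau> (x - y) = \<tau> x - \<tau> y"
  using tau_add[of "x - y" y] by simp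

lemma tau_j_mult: "\<tau> (j * x) = \<i> * \<tau> x"
  using tau_cscale[of \<i> x] by (simp add: cscale_def)

lemma tr_add: "tr (x + y) = tr x + tr y" by (simp add: tr_def tau_add)
lemma tr_scaleR: "tr (r *\<^sub>R x) = r * tr x" by (simp add: tr_def tau_scaleR)
lemma tr_minus: "tr (- x) = - tr x" using tr_scaleR[of "-1" x] by simp
lemma tr_diff: "tr (x - y) = tr x - tr y" using tr_add[of x "- y"] by (simp add: tr_minus)
lemma tr_0[simp]: "tr 0 = 0" using tr_scaleR[of 0 0] by simp
lemma tr_1[simp]: "tr 1 = 1" by (simp add: tr_def tau_1)
lemma tr_comm: "tr (x * y) = tr (y * x)" by (simp add: tr_def tau_comm)
lemma tr_sum: "tr (sum f A) = (\<Sum>i\<in>A. tr (f i))"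
  by (induction A rule: infinite_finite_induct) (auto simp: tr_add)

lemmas tr_simps = tr_add tr_diff tr_minus tr_scaleR tr_sum

lemma positive_star_mult[simp]: "positive star (star x * x)" by (auto simp: positive_def)

lemma tr_star_mult_nonneg: "tr (star x * x) \<ge> 0"
  using tau_positive[of "star x * x"] by (simp add: tr_def)

lemma tr_star_mult_eq_0: "tr (star x * x) = 0 \<Longrightarrow> x = 0"
  using tau_positive[of "star x * x"] tau_faithful[of "star x * x"] star_mult_eq_0[of x]
  by (auto simp: tr_def complex_eq_iff)

lemma pos_positive: "pos x \<Longrightarrow> positive star x"
  using pos_sqrt[of x] pos_star unfolding positive_def by metis

lemma tr_pos: "pos x \<Longrightarrow> tr x \<ge> 0"
  using pos_positive tau_positive by (auto simp: tr_def)

lemma tr_mono: "pos (y - x) \<Longrightarrow> tr x \<le> tr y"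
  using tr_pos[of "y - x"] by (simp add: tr_simps)

lemma tr_pos_eq_0: "pos x \<Longrightarrow> tr x = 0 \<Longrightarrow> x = 0"
  by (metis pos_positive positive_def tr_star_mult_eq_0 mult_zero_right)

text \<open>That \<open>\<tau>\<close> respects the involution is not an axiom. It follows from
  positivity: the trace of \<open>star (x + j) * (x + j)\<close> must be real, and its imaginary
  part contains \<open>tr (star x) - tr x\<close>.\<close>

lemma tr_star: "tr (star x) = tr x"
proof -
  have "star (x + j) * (x + j) = star x * x + j * star x - j * x + 1"
    by (simp add: star_simps star_j algebra_simps j_sq j_central[of "star x"])
  then have "Im (\<tau> (star (x + j) * (x + j))) = Im (\<tau> (star x * x)) + tr (star x) - tr x"
    by (simp only: tau_add tau_diff tau_j_mult tau_1) (simp add: tr_def)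
  then show ?thesis using tau_positive[of "star (x + j) * (x + j)"] tau_positive[of "star x * x"] by simp
qed

text \<open>The squared 2-norm of the trace. It is kept squared; the parallelogram law in
  \<open>N_add\<close> serves as triangle inequality.\<close>

definition N :: "'a \<Rightarrow> real" where "N x = tr (star x * x)"

lemma N_nonneg[simp]: "N x \<ge> 0" by (simp add: N_def tr_star_mult_nonneg)
lemma N_0[simp]: "N 0 = 0" by (simp add: N_def)
lemma N_eq_0: "N x = 0 \<Longrightarrow> x = 0" by (simp add: N_def tr_star_mult_eq_0)
lemma N_star[simp]: "N (star x) = N x" by (simp add: N_def) (rule tr_comm)
lemma N_scaleR: "N (r *\<^sub>R x) = r\<^sup>2 * N x" by (simp add: N_def star_simps tr_simps power2_eq_square)
lemma N_minus[simp]: "N (- x) = N x" using N_scaleR[of "-1" x] by simp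
lemma N_commute: "N (x - y) = N (y - x)" using N_minus[of "x - y"] by simp

lemma N_add: "N (x + y) \<le> 2 * N x + 2 * N y"
proof -
  have "N (x + y) + N (x - y) = 2 * N x + 2 * N y"
    by (simp add: N_def star_simps tr_simps algebra_simps)
  then show ?thesis using N_nonneg[of "x - y"] by linarith
qed

lemma N_mult_left: "N (x * y) \<le> (norm x)\<^sup>2 * N y"
proof -
  have "pos ((norm x)\<^sup>2 *\<^sub>R 1 - star x * x)"
    by (rule pos_norm_diff) (auto simp: star_simps norm_star_mult)
  then obtain z where z: "pos z" "z * z = (norm x)\<^sup>2 *\<^sub>R 1 - star x * x" using pos_sqrt by blast
  have "z * (z * y) = (z * z) * y" by (simp only: mult.assoc)
  then have "z * (z * y) = (norm x)\<^sup>2 *\<^sub>R y - star x * (x * y)"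
    by (simp add: z(2) left_diff_distrib mult.assoc)
  then have "N (z * y) = (norm x)\<^sup>2 * N y - N (x * y)"
    by (simp add: N_def star_simps pos_star[OF z(1)] mult.assoc right_diff_distrib tr_simps)
  then show ?thesis using N_nonneg[of "z * y"] by linarith
qed

lemma N_mult_right: "N (x * y) \<le> N x * (norm y)\<^sup>2"
  using N_mult_left[of "star y" "star x"] N_star[of "x * y"] by (simp add: star_simps mult.commute)

lemma N_j_mult[simp]: "N (j * x) = N x"
proof -
  have "star j * (j * x) = x" by (simp add: star_j j_mult_j)
  then have "star x * (star j * (j * x)) = star x * x" by simp
  then show ?thesis unfolding N_def by (simp only: star_mult mult.assoc)
qed

text \<open>Cauchy-Schwarz against the unit, read off from
  \<open>N (x - tr x *\<^sub>R 1) \<ge> 0\<close>.\<close>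

lemma tr_le_N: "(tr x)\<^sup>2 \<le> N x"
proof -
  have "N (x - tr x *\<^sub>R 1) = N x - (tr x)\<^sup>2"
    by (simp add: N_def star_simps algebra_simps tr_simps tr_star power2_eq_square)
  then show ?thesis using N_nonneg[of "x - tr x *\<^sub>R 1"] by linarith
qed

text \<open>Convergence in the 2-norm, which on norm-bounded sets takes the place of strong operator
  convergence. Boundedness is not built in, so \<open>tconv_mult\<close> asks for it
  separately.\<close>

definition tconv :: "(nat \<Rightarrow> 'a) \<Rightarrow> 'a \<Rightarrow> bool" where
  "tconv X x \<longleftrightarrow> (\<lambda>n. N (X n - x)) \<longlonglongrightarrow> 0"

lemma tconvI:
  assumes "\<And>n. N (X n - x) \<le> f n" "f \<longlonglongrightarrow> 0"
  shows "tconv X x"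
  unfolding tconv_def
  by (rule tendsto_sandwich[OF _ _ tendsto_const assms(2)]) (auto simp: assms(1))

lemma tconv_const: "tconv (\<lambda>n. x) x" by (simp add: tconv_def)

lemma tconv_add: assumes "tconv X x" "tconv Y y" shows "tconv (\<lambda>n. X n + Y n) (x + y)"
proof (rule tconvI)
  show "N (X n + Y n - (x + y)) \<le> 2 * N (X n - x) + 2 * N (Y n - y)" for n
    using N_add[of "X n - x" "Y n - y"] by (simp add: algebra_simps)
  show "(\<lambda>n. 2 * N (X n - x) + 2 * N (Y n - y)) \<longlonglongrightarrow> 0"
    using assms unfolding tconv_def by (auto intro!: tendsto_eq_intros)
qed

lemma tconv_scaleR: assumes "tconv X x" shows "tconv (\<lambda>n. r *\<^sub>R X n) (r *\<^sub>R x)"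
proof (rule tconvI)
  show "N (r *\<^sub>R X n - r *\<^sub>R x) \<le> r\<^sup>2 * N (X n - x)" for n
    by (simp add: scaleR_diff_right[symmetric] N_scaleR)
  show "(\<lambda>n. r\<^sup>2 * N (X n - x)) \<longlonglongrightarrow> 0"
    using assms unfolding tconv_def by (auto intro!: tendsto_eq_intros)
qed

lemma tconv_minus: "tconv X x \<Longrightarrow> tconv (\<lambda>n. - X n) (- x)"
  using tconv_scaleR[of X x "-1"] by simp

lemma tconv_diff: "tconv X x \<Longrightarrow> tconv Y y \<Longrightarrow> tconv (\<lambda>n. X n - Y n) (x - y)"
  using tconv_add[OF _ tconv_minus, of X x Y y] by simp

lemma tconv_star: "tconv X x \<Longrightarrow> tconv (\<lambda>n. star (X n)) (star x)"
  by (simp add: tconv_def flip: star_diff)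

lemma tconv_j_mult: "tconv X x \<Longrightarrow> tconv (\<lambda>n. j * X n) (j * x)"
  by (simp add: tconv_def flip: right_diff_distrib)

lemma tconv_mult:
  assumes "tconv X x" "tconv Y y" "\<And>n. norm (X n) \<le> K"
  shows "tconv (\<lambda>n. X n * Y n) (x * y)"
proof (rule tconvI)
  fix n
  have "N (X n * Y n - x * y) = N (X n * (Y n - y) + (X n - x) * y)" by (simp add: algebra_simps)
  also have "\<dots> \<le> 2 * N (X n * (Y n - y)) + 2 * N ((X n - x) * y)" by (rule N_add)
  also have "\<dots> \<le> 2 * (K\<^sup>2 * N (Y n - y)) + 2 * (N (X n - x) * (norm y)\<^sup>2)"
  proof (intro add_mono mult_left_mono)
    have "N (X n * (Y n - y)) \<le> (norm (X n))\<^sup>2 * N (Y n - y)" by (rule N_mult_left)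
    also have "\<dots> \<le> K\<^sup>2 * N (Y n - y)"
      using assms(3)[of n] by (intro mult_right_mono power_mono) auto
    finally show "N (X n * (Y n - y)) \<le> K\<^sup>2 * N (Y n - y)" .
  qed (auto simp: N_mult_right)
  finally show "N (X n * Y n - x * y) \<le> 2 * (K\<^sup>2 * N (Y n - y)) + 2 * (N (X n - x) * (norm y)\<^sup>2)" .
  show "(\<lambda>n. 2 * (K\<^sup>2 * N (Y n - y)) + 2 * (N (X n - x) * (norm y)\<^sup>2)) \<longlonglongrightarrow> 0"
    using assms unfolding tconv_def by (auto intro!: tendsto_eq_intros)
qed

lemma tconv_mult_left: "tconv X x \<Longrightarrow> tconv (\<lambda>n. c * X n) (c * x)"
  by (rule tconv_mult[OF tconv_const]) auto

lemma tconv_mult_right: "tconv X x \<Longrightarrow> tconv (\<lambda>n. X n * c) (x * c)"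
  using tconv_star[OF tconv_mult_left[OF tconv_star], of X x "star c"] by (simp add: star_simps)

lemma tconv_unique: assumes "tconv X x" "tconv X y" shows "x = y"
proof -
  have "tconv (\<lambda>n. 0) (x - y)" using tconv_diff[OF assms] by simp
  then have "N (x - y) = 0" by (simp add: tconv_def LIMSEQ_const_iff N_commute)
  then have "x - y = 0" by (rule N_eq_0)
  then show ?thesis by simp
qed

lemma tconv_tr: assumes "tconv X x" shows "(\<lambda>n. tr (X n)) \<longlonglongrightarrow> tr x"
proof -
  have "(\<lambda>n. tr (X n - x)) \<longlonglongrightarrow> 0"
  proof (rule Lim_null_comparison)
    show "\<forall>\<^sub>F n in sequentially. norm (tr (X n - x)) \<le> sqrt (N (X n - x))"
      using real_le_rsqrt[of "\<bar>tr (X _ - x)\<bar>"] tr_le_N by (auto intro!: always_eventually real_le_rsqrt)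
    show "(\<lambda>n. sqrt (N (X n - x))) \<longlonglongrightarrow> 0"
      using assms unfolding tconv_def by (auto intro!: tendsto_eq_intros)
  qed
  then show ?thesis by (simp add: tr_simps LIM_zero_iff)
qed

lemma tconv_Suc: "tconv X x \<Longrightarrow> tconv (\<lambda>n. X (Suc n)) x"
  unfolding tconv_def by (rule LIMSEQ_Suc)

text \<open>For \<open>w = star y * y\<close> the trace property gives
  \<open>N w = N (y * star y)\<close>, and one factor is estimated in norm. This turns convergence
  of traces below a supremum into 2-norm convergence. It is stated for \<open>positive\<close>
  because \<open>pos\<close> is not yet known to be the same cone.\<close>

lemma N_positive: assumes "positive star w" shows "N w \<le> norm w * tr w"
proof -
  obtain y where y: "w = star y * y" using assms by (auto simp: positive_def)
  have "N (y * star y) \<le> norm w * N y"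
    using N_mult_right[of y "star y"] by (simp add: y norm_star_mult mult.commute)
  moreover have "N (y * star y) = N w"
  proof -
    have "N (y * star y) = tr (y * (star y * y * star y))" by (simp add: N_def star_simps mult.assoc)
    also have "\<dots> = tr ((star y * y * star y) * y)" by (rule tr_comm)
    finally show ?thesis by (simp add: N_def y star_simps mult.assoc)
  qed
  ultimately show ?thesis by (simp add: y N_def)
qed

text \<open>Normality makes the trace of the supremum the supremum of the traces. Members whose
  traces come within \<open>1 / (n + 1)\<close> of it converge by \<open>N_positive\<close>, even if
  they are not monotone in \<open>n\<close>.\<close>

lemma op_lub_tconv:
  assumes "bdd_directed star D"
  obtains s X where "star s = s" "\<And>x. x \<in> D \<Longrightarrow> positive star (s - x)"
    "\<And>n. X n \<in> D" "tconv X s" "tr s = (SUP x\<in>D. tr x)"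
proof -
  obtain s where s: "is_op_lub star D s" using monotone_complete[OF assms] by blast
  have trs: "tr s = (SUP x\<in>D. tr x)" using normal[OF assms s] by (simp add: tr_def)
  have ss: "star s = s" and ub: "\<And>x. x \<in> D \<Longrightarrow> positive star (s - x)"
    using s by (auto simp: is_op_lub_def selfadj_def ople_def)
  obtain K where K: "\<And>x. x \<in> D \<Longrightarrow> norm x \<le> K" and ne: "D \<noteq> {}"
    using assms unfolding bdd_directed_def by blast
  have le: "tr x \<le> tr s" if "x \<in> D" for x
    using tau_positive[OF ub[OF that]] tr_diff[of s x] by (simp add: tr_def)
  have "\<exists>x\<in>D. tr s - inverse (real (Suc n)) < tr x" for n
  proof -
    have "tr s - inverse (real (Suc n)) < (SUP x\<in>D. tr x)" unfolding trs by simp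
    then show ?thesis by (subst (asm) less_cSUP_iff) (use ne le in \<open>auto intro!: bdd_aboveI2\<close>)
  qed
  then obtain X where X: "\<And>n. X n \<in> D" "\<And>n. tr s - inverse (real (Suc n)) < tr (X n)" by metis
  have "tconv X s"
  proof (rule tconvI)
    fix n
    have 1: "norm (s - X n) \<le> norm s + K"
      using norm_triangle_ineq4[of s "X n"] K[OF X(1)[of n]] by simp
    have "N (X n - s) = N (s - X n)" by (rule N_commute)
    also have "\<dots> \<le> norm (s - X n) * tr (s - X n)" by (rule N_positive[OF ub[OF X(1)]])
    also have "\<dots> \<le> (norm s + K) * inverse (real (Suc n))"
      using 1 X(2)[of n] le[OF X(1)[of n]] order_trans[OF norm_ge_zero 1]
      by (intro mult_mono) (auto simp: tr_simps)
    finally show "N (X n - s) \<le> (norm s + K) * inverse (real (Suc n))" .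
    show "(\<lambda>n. (norm s + K) * inverse (real (Suc n))) \<longlonglongrightarrow> 0"
      using tendsto_mult_right_zero[OF LIMSEQ_inverse_real_of_nat] .
  qed
  then show ?thesis using that ss ub X(1) trs by blast
qed

lemma increasing_tconv:
  assumes sa: "\<And>n. star (X n) = X n" and inc: "\<And>n. pos (X (Suc n) - X n)"
    and bd: "\<And>n. norm (X n) \<le> K"
  obtains s where "star s = s" "tconv X s" "\<And>n. positive star (s - X n)"
proof -
  have mono: "pos (X (n + k) - X n)" for n k
  proof (induction k)
    case (Suc k)
    then show ?case using pos_trans[OF Suc inc[of "n + k"]] by simp
  qed simp
  then have mono': "m \<le> n \<Longrightarrow> positive star (X n - X m)" for m n
    using pos_positive le_Suc_ex by metis
  have "bdd_directed star (range X)"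
    unfolding bdd_directed_def
  proof (intro conjI ballI)
    fix x y assume "x \<in> range X" "y \<in> range X"
    then obtain m n where "x = X m" "y = X n" by auto
    then show "\<exists>z\<in>range X. ople star x z \<and> ople star y z"
      using mono'[of m "max m n"] mono'[of n "max m n"] by (auto simp: ople_def)
  qed (use sa bd in \<open>auto simp: selfadj_def\<close>)
  then obtain s Y where s: "star s = s" "\<And>x. x \<in> range X \<Longrightarrow> positive star (s - x)"
     "tr s = (SUP x\<in>range X. tr x)"
    using op_lub_tconv by metis
  have le: "tr (X n) \<le> tr s" for n
    using tau_positive[OF s(2)[of "X n"]] tr_diff[of s "X n"] by (simp add: tr_def)
  have "incseq (\<lambda>n. tr (X n))"
    by (rule incseq_SucI) (use inc tr_mono in auto)
  then have lim: "(\<lambda>n. tr (X n)) \<longlonglongrightarrow> tr s"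
    unfolding s(3) image_image by (intro LIMSEQ_incseq_SUP bdd_aboveI2[of _ _ "tr s"] le)
  have "tconv X s"
  proof (rule tconvI)
    fix n
    have 1: "norm (s - X n) \<le> norm s + K"
      using norm_triangle_ineq4[of s "X n"] bd[of n] by simp
    have "N (X n - s) = N (s - X n)" by (rule N_commute)
    also have "\<dots> \<le> norm (s - X n) * tr (s - X n)" by (rule N_positive) (simp add: s(2))
    also have "\<dots> \<le> (norm s + K) * (tr s - tr (X n))"
      using 1 le[of n] by (auto simp: tr_simps intro!: mult_right_mono)
    finally show "N (X n - s) \<le> (norm s + K) * (tr s - tr (X n))" .
    show "(\<lambda>n. (norm s + K) * (tr s - tr (X n))) \<longlonglongrightarrow> 0"
      using lim by (auto intro!: tendsto_eq_intros)
  qed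
  then show ?thesis using that s by blast
qed

section \<open>Support projections and the positive and negative parts\<close>

lemma projD: "proj p \<Longrightarrow> star p = p" "proj p \<Longrightarrow> p * p = p"
  by (auto simp: is_projection_def)

lemma pos_proj: "proj p \<Longrightarrow> pos p" using pos_square[of p] by (simp add: is_projection_def)
lemma proj_compl: "proj p \<Longrightarrow> proj (1 - p)" by (simp add: is_projection_def star_simps algebra_simps)
lemma proj_0[simp]: "proj 0" by (simp add: is_projection_def)
lemma proj_1[simp]: "proj 1" by (simp add: is_projection_def)

lemma pos_power: "pos h \<Longrightarrow> pos (h ^ n)"
  by (induction n) (auto intro!: pos_comm_mult simp: power_commutes)

text \<open>The support of \<open>y\<close> with \<open>0 \<le> y \<le> 1\<close> is the limit of the increasing sequence \<open>1 - (1 - y)\<^sup>n\<close>.\<close>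

lemma support_contraction:
  assumes y: "pos y" "norm y \<le> 1"
  shows "\<exists>s. proj s \<and> y * s = y \<and> (\<forall>z. z * y = y * z \<longrightarrow> z * s = s * z) \<and> (\<forall>w. y * w = 0 \<longrightarrow> s * w = 0)"
proof -
  define h where "h = 1 - y"
  have ph: "pos h" using pos_norm_diff[of y 1] y by (simp add: h_def pos_star)
  have nh: "norm h \<le> 1" using pos_norm_ge[OF y] by (simp add: h_def)
  have nhn: "norm (h ^ n) \<le> 1" for n
    using norm_power_ineq[of h n] power_le_one[OF norm_ge_zero nh, of n] by linarith
  have yh: "y * h ^ n = h ^ n - h ^ Suc n" for n by (simp add: h_def algebra_simps)
  have inc: "pos (h ^ n - h ^ Suc n)" for n
  proof -
    have "y * h ^ n = h ^ n * y" using power_commuting_commutes[of h y n] by (simp add: h_def algebra_simps)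
    then have "pos (y * h ^ n)" using pos_comm_mult[OF y(1) pos_power[OF ph]] by simp
    then show ?thesis by (simp only: yh)
  qed
  obtain s where s: "star s = s" "tconv (\<lambda>n. 1 - h ^ n) s"
  proof (rule increasing_tconv[of "\<lambda>n. 1 - h ^ n" 2])
    show "norm (1 - h ^ n) \<le> 2" for n using norm_triangle_ineq4[of 1 "h ^ n"] nhn[of n] by simp
  qed (use inc pos_star[OF pos_power[OF ph]] in \<open>auto simp: star_simps pos_star[OF ph]\<close>)
  define t where "t = 1 - s"
  have ht: "tconv (\<lambda>n. h ^ n) t" using tconv_diff[OF tconv_const[of 1] s(2)] by (simp add: t_def)
  have "tconv (\<lambda>n. y * h ^ n) (t - t)"
    unfolding yh by (rule tconv_diff[OF ht tconv_Suc[OF ht]])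
  then have yt: "y * t = 0" using tconv_unique[OF tconv_mult_left[OF ht]] by simp
  \<comment> \<open>What \<open>y\<close> kills is fixed by \<open>h = 1 - y\<close>, hence by the
    limit \<open>t\<close> of the powers of \<open>h\<close>. Taking \<open>w = t\<close> yields
    idempotence of \<open>t\<close>.\<close>
  have fix_lim: "t * w = w" if "y * w = 0" for w
  proof -
    have "h * w = w" using that by (simp add: h_def algebra_simps)
    then have "h ^ n * w = w" for n by (induction n) (auto simp: mult.assoc)
    then show ?thesis using tconv_unique[OF tconv_mult_right[OF ht, of w]] tconv_const[of w] by simp
  qed
  have tt: "t * t = t" by (rule fix_lim[OF yt])
  have "proj s" using tt s(1) by (simp add: is_projection_def t_def algebra_simps)
  moreover have "y * s = y" using yt by (simp add: t_def algebra_simps)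
  moreover have "z * s = s * z" if "z * y = y * z" for z
  proof -
    have "h * z = z * h" using that by (simp add: h_def algebra_simps)
    then have "z * h ^ n = h ^ n * z" for n using power_commuting_commutes[of h z n] by simp
    then have "z * t = t * z"
      using tconv_unique[OF tconv_mult_left[OF ht, of z]] tconv_mult_right[OF ht, of z] by simp
    then show ?thesis by (simp add: t_def algebra_simps)
  qed
  moreover have "s * w = 0" if "y * w = 0" for w
    using fix_lim[OF that] by (simp add: t_def algebra_simps)
  ultimately show ?thesis by blast
qed

lemma support_exists:
  assumes y: "pos y"
  shows "\<exists>s. proj s \<and> y * s = y \<and> (\<forall>z. z * y = y * z \<longrightarrow> z * s = s * z) \<and> (\<forall>w. y * w = 0 \<longrightarrow> s * w = 0)"
proof -
  define c where "c = inverse (norm y + 1)"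
  have c: "c > 0" by (simp add: c_def add_nonneg_pos)
  have "c * norm y \<le> c * (norm y + 1)" using c by simp
  also have "\<dots> = 1" using c by (simp add: c_def)
  finally have "norm (c *\<^sub>R y) \<le> 1" using c by simp
  from support_contraction[OF pos_scaleR[OF y less_imp_le[OF c]] this] show ?thesis using c by simp
qed

text \<open>With \<open>z\<close> the absolute value of \<open>x\<close>, \<open>z + x\<close> is
  twice the positive part. It is not yet known to be positive, so the support \<open>s\<close> is
  taken of its square. Then \<open>(z + x) * (1 - s) = 0\<close> and \<open>s * (z - x) = 0\<close>:
  \<open>x\<close> equals \<open>z\<close> on \<open>s\<close> and \<open>- z\<close> on the
  complement.\<close>

lemma polar_projection:
  assumes sx: "star x = x"
  shows "\<exists>p. proj p \<and> (\<forall>z. z * x = x * z \<longrightarrow> z * p = p * z) \<and> pos (x * p) \<and> pos (- (x * (1 - p)))"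
proof -
  obtain z where z: "pos z" "z * z = x * x" "\<And>w. w * (x * x) = (x * x) * w \<Longrightarrow> w * z = z * w"
    using pos_sqrt[OF pos_square[OF sx]] by blast
  have xz: "x * z = z * x" by (rule z(3)) (simp add: mult.assoc)
  define y where "y = (z + x) * (z + x)"
  have szx: "star (z + x) = z + x" using z(1) sx by (simp add: star_simps pos_star)
  have py: "pos y" unfolding y_def by (rule pos_square[OF szx])
  obtain s where s: "proj s" "y * s = y" "\<And>w. w * y = y * w \<Longrightarrow> w * s = s * w" "\<And>w. y * w = 0 \<Longrightarrow> s * w = 0"
    using support_exists[OF py] by blast
  have comm: "w * s = s * w" if "w * x = x * w" for w
  proof -
    have "w * z = z * w" by (rule z(3)) (metis that mult.assoc)
    then have "w * (z + x) = (z + x) * w" using that by (simp add: algebra_simps)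
    then show ?thesis by (intro s(3)) (metis y_def mult.assoc)
  qed
  have xs: "x * s = s * x" and zs: "z * s = s * z" by (auto intro: comm simp: xz)
  have "star ((z + x) * (1 - s)) * ((z + x) * (1 - s)) = (1 - s) * (y * (1 - s))"
    by (simp only: star_mult szx mult.assoc y_def) (simp add: star_simps projD[OF s(1)])
  also have "y * (1 - s) = 0" using s(2) by (simp add: right_diff_distrib)
  finally have "star ((z + x) * (1 - s)) * ((z + x) * (1 - s)) = 0" by simp
  then have "(z + x) * (1 - s) = 0" by (rule star_mult_eq_0[THEN iffD1])
  then have 1: "- (x * (1 - s)) = z * (1 - s)"
    using eq_neg_iff_add_eq_0[of "z * (1 - s)" "x * (1 - s)"] by (simp only: distrib_right) simp
  have "y * (z - x) = (z + x) * ((z + x) * (z - x))" by (simp add: y_def mult.assoc)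
  also have "(z + x) * (z - x) = 0" by (simp add: algebra_simps z(2) xz)
  finally have "s * (z - x) = 0" using s(4) by simp
  then have 2: "x * s = z * s" by (simp add: xs zs algebra_simps)
  have "pos (z * s)" by (rule pos_comm_mult[OF z(1) pos_proj[OF s(1)] zs])
  moreover have "pos (z * (1 - s))"
    by (rule pos_comm_mult[OF z(1) pos_proj[OF proj_compl[OF s(1)]]]) (simp add: algebra_simps zs)
  ultimately show ?thesis using s(1) comm 1 2 by auto
qed

text \<open>The trace replaces the spectral argument in the proof that \<open>y\<^sup>* y\<close> is positive: if \<open>v\<^sup>* v\<close> is negative
  then \<open>\<tau> (v\<^sup>* v) = 0\<close>.\<close>

lemma pos_star_mult: "pos (star y * y)"
proof -
  define x where "x = star y * y"
  have "star x = x" by (simp add: x_def star_simps)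
  then obtain p where p: "proj p" "\<And>z. z * x = x * z \<Longrightarrow> z * p = p * z" "pos (x * p)" "pos (- (x * (1 - p)))"
    using polar_projection by blast
  have xp: "x * p = p * x" using p(2) by simp
  define v where "v = y * (1 - p)"
  have "star v * v = (1 - p) * x * (1 - p)" by (simp add: v_def x_def star_simps mult.assoc projD[OF p(1)])
  also have "\<dots> = x * (1 - p)" using xp projD[OF p(1)]
    by (simp add: algebra_simps) (metis mult.assoc)
  finally have v: "star v * v = x * (1 - p)" .
  have "tr (star v * v) \<le> 0" using tr_pos[OF p(4)] unfolding v by (simp add: tr_minus)
  then have "v = 0" using tr_star_mult_nonneg[of v] tr_star_mult_eq_0[of v] by simp
  then have "x * (1 - p) = 0" using v by simp
  then have "x * p = x" by (simp add: algebra_simps)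
  then show ?thesis using p(3) by (simp add: x_def)
qed

lemma positive_eq_pos: "positive star = pos"
  using pos_positive pos_star_mult by (auto simp: positive_def fun_eq_iff)

lemma ople_iff: "ople star x y \<longleftrightarrow> pos (y - x)" by (simp add: ople_def positive_eq_pos)

lemma pos_conj: assumes "pos x" shows "pos (star y * x * y)"
proof -
  obtain z where "pos z" "z * z = x" using pos_sqrt[OF assms] by blast
  then have "star y * x * y = star (z * y) * (z * y)" by (simp add: star_simps pos_star mult.assoc flip: \<open>z * z = x\<close>)
  then show ?thesis by (simp add: pos_star_mult)
qed

text \<open>Let \<open>q\<close> cut out the negative part of \<open>x\<close>. The traces of
  \<open>q * X n * q\<close> are non-negative and pass to the limit, so the negative part has trace
  zero and vanishes by faithfulness.\<close>

lemma pos_tconv: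
  assumes "\<And>n. pos (X n)" "tconv X x" shows "pos x"
proof -
  have "tconv X (star x)" using tconv_star[OF assms(2)] by (simp add: pos_star[OF assms(1)])
  then have sx: "star x = x" using assms(2) by (rule tconv_unique)
  obtain p where p: "proj p" "\<And>z. z * x = x * z \<Longrightarrow> z * p = p * z" "pos (x * p)" "pos (- (x * (1 - p)))"
    using polar_projection[OF sx] by blast
  define q where "q = 1 - p"
  have q: "proj q" using proj_compl[OF p(1)] by (simp add: q_def)
  have xq: "q * x = x * q" using p(2)[of x] by (simp add: q_def algebra_simps)
  have "tr (q * X n * q) \<ge> 0" for n
    using pos_conj[OF assms(1)[of n], of q] tr_pos by (simp add: projD[OF q])
  moreover have "(\<lambda>n. tr (q * X n * q)) \<longlonglongrightarrow> tr (q * x * q)"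
    by (intro tconv_tr tconv_mult_left tconv_mult_right assms(2))
  ultimately have "tr (q * x * q) \<ge> 0" by (intro LIMSEQ_le_const) auto
  moreover have "q * x * q = x * q" by (simp add: xq mult.assoc projD[OF q])
  ultimately have "tr (- (x * q)) = 0" using tr_pos[OF p(4)] by (simp add: q_def tr_minus)
  then have "x * q = 0" using tr_pos_eq_0[OF p(4)] by (simp add: q_def)
  then have "x * p = x" by (simp add: q_def algebra_simps)
  then show ?thesis using p(3) by simp
qed

section \<open>Spectral projections and singular values\<close>

lemma proj_le_iff:
  assumes "proj p" "proj q"
  shows "pos (q - p) \<longleftrightarrow> p * q = p"
proof
  assume "pos (q - p)"
  then have "pos (star (1 - q) * (q - p) * (1 - q))" by (rule pos_conj)
  also have "star (1 - q) * (q - p) * (1 - q) = - (star (p * (1 - q)) * (p * (1 - q)))"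
    using projD[OF assms(1)] projD[OF assms(2)]
    by (simp add: star_simps algebra_simps) (metis mult.assoc)
  finally have "star (p * (1 - q)) * (p * (1 - q)) = 0"
    using pos_antisym pos_star_mult by blast
  then have "p * (1 - q) = 0" by (rule star_mult_eq_0[THEN iffD1])
  then show "p * q = p" by (simp add: algebra_simps)
next
  assume pq: "p * q = p"
  then have "star (p * q) = p" using projD[OF assms(1)] by simp
  then have "q * p = p" using projD[OF assms(1)] projD[OF assms(2)] by (simp add: star_simps)
  then have "(q - p) * (q - p) = q - p" "star (q - p) = q - p"
    using pq projD[OF assms(1)] projD[OF assms(2)] by (simp_all add: star_simps algebra_simps)
  then show "pos (q - p)" using pos_square by metis
qed

lemma proj_le_mult:
  assumes "proj p" "proj q" "pos (q - p)"
  shows "p * q = p" "q * p = p"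
proof -
  show pq: "p * q = p" using proj_le_iff assms by blast
  then have "star (p * q) = p" using projD[OF assms(1)] by simp
  then show "q * p = p" using projD[OF assms(1)] projD[OF assms(2)] by (simp add: star_simps)
qed

lemma proj_diff:
  assumes "proj p" "proj q" "pos (q - p)"
  shows "proj (q - p)"
  using proj_le_mult[OF assms] projD[OF assms(1)] projD[OF assms(2)]
  by (simp add: is_projection_def star_simps algebra_simps)

lemma norm_proj_le: assumes "proj p" shows "norm p \<le> 1"
proof -
  have "norm p = (norm p)\<^sup>2" using norm_star_mult[of p] projD[OF assms] by simp
  then show ?thesis by (metis power2_eq_square mult_cancel_left1 order_refl zero_le_one)
qed

lemma pos_1_proj: "proj p \<Longrightarrow> pos (1 - p)" using pos_proj proj_compl by blast

lemma tr_proj_le: "proj p \<Longrightarrow> tr p \<le> 1" using tr_mono[OF pos_1_proj, of p] by simp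

lemma proj_mult:
  assumes "proj p" "proj q" "p * q = q * p" shows "proj (p * q)"
  using projD[OF assms(1)] projD[OF assms(2)] assms(3)
  by (auto simp: is_projection_def star_simps) (metis mult.assoc)

definition sproj :: "'a \<Rightarrow> real \<Rightarrow> 'a \<Rightarrow> bool" where
  "sproj x r p \<longleftrightarrow> proj p \<and> (\<forall>z. z * x = x * z \<longrightarrow> z * p = p * z)
     \<and> pos (x * p - r *\<^sub>R p) \<and> pos (r *\<^sub>R (1 - p) - x * (1 - p))"

lemma sproj_exists:
  assumes "star x = x" shows "\<exists>p. sproj x r p"
proof -
  have "star (x - r *\<^sub>R 1) = x - r *\<^sub>R 1" using assms by (simp add: star_simps)
  from polar_projection[OF this] obtain p where p: "proj p"
    "\<And>z. z * (x - r *\<^sub>R 1) = (x - r *\<^sub>R 1) * z \<Longrightarrow> z * p = p * z"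
    "pos ((x - r *\<^sub>R 1) * p)" "pos (- ((x - r *\<^sub>R 1) * (1 - p)))" by blast
  have "sproj x r p"
    unfolding sproj_def using p(1,3,4) by (auto intro!: p(2) simp: algebra_simps)
  then show ?thesis ..
qed

text \<open>\<open>E a r\<close> plays the role of the spectral projection of \<open>a\<close> for \<open>(r, \<infinity>)\<close> or \<open>[r, \<infinity>)\<close>; which one does
  not matter.\<close>

definition E :: "'a \<Rightarrow> real \<Rightarrow> 'a" where
  "E a r = (if r \<le> 0 then 1 else SOME p. sproj a r p)"

lemma sproj_E: assumes "pos a" shows "sproj a r (E a r)"
proof (cases "r \<le> 0")
  case True
  then have "pos (a - r *\<^sub>R 1)" using pos_add[OF assms pos_scaleR_one[of "-r"]] by simp
  then show ?thesis using True by (simp add: E_def sproj_def)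
next
  case False
  then show ?thesis using sproj_exists[OF pos_star[OF assms], of r] by (simp add: E_def someI_ex)
qed

text \<open>Fixing the value at 0 matters when \<open>a\<close> has a kernel: chains of spectral
  projections must start at 1 before they can be matched by a unitary.\<close>

lemma E_nonpos: "r \<le> 0 \<Longrightarrow> E a r = 1" by (simp add: E_def)

lemma E_props:
  assumes "pos a"
  shows E_proj: "proj (E a r)" and E_commute: "z * a = a * z \<Longrightarrow> z * E a r = E a r * z"
    and E_ge: "pos (a * E a r - r *\<^sub>R E a r)" and E_le: "pos (r *\<^sub>R (1 - E a r) - a * (1 - E a r))"
  using sproj_E[OF assms, of r] by (auto simp: sproj_def)

text \<open>On \<open>q\<close> the element would lie above \<open>r'\<close> and below
  \<open>r\<close>; taking traces gives \<open>(r - r') * tr q \<ge> 0\<close>.\<close>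

lemma sproj_separate:
  assumes "proj q" "star a = a" "q * a = a * q" "pos (a * q - r' *\<^sub>R q)" "pos (r *\<^sub>R q - a * q)" "r < r'"
  shows "q = 0"
proof -
  have "pos ((r - r') *\<^sub>R q)" using pos_add[OF assms(4,5)] by (simp add: algebra_simps)
  then have "(r - r') * tr q \<ge> 0" using tr_pos by (metis tr_scaleR)
  then have "tr q \<le> 0" using assms(6) by (simp add: zero_le_mult_iff)
  then show ?thesis using tr_pos[OF pos_proj[OF assms(1)]] tr_pos_eq_0[OF pos_proj[OF assms(1)]] by simp
qed

text \<open>The projections are chosen independently for each level, so monotonicity needs an
  argument: on \<open>p' * (1 - p)\<close> the element is at least \<open>r'\<close> and at most
  \<open>r\<close>, which \<open>sproj_separate\<close> excludes.\<close>

lemma E_antimono: assumes "pos a" "r \<le> r'" shows "pos (E a r - E a r')"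
proof (cases "r = r'")
  case False
  define p where "p = E a r" define p' where "p' = E a r'"
  note p = E_props[where r=r, OF assms(1), folded p_def] and p' = E_props[where r=r', OF assms(1), folded p'_def]
  have c: "a * p = p * a" "a * p' = p' * a" using p(2) p'(2) by auto
  have pp: "p' * p = p * p'" by (rule p(2)) (simp add: c)
  have "p' * (1 - p) = 0"
  proof (rule sproj_separate)
    show "proj (p' * (1 - p))" by (rule proj_mult[OF p'(1) proj_compl[OF p(1)]]) (simp add: algebra_simps pp)
    show "star a = a" using assms(1) by (rule pos_star)
    show "p' * (1 - p) * a = a * (p' * (1 - p))" using c by (simp add: algebra_simps) (metis mult.assoc)
    have "pos ((a * p' - r' *\<^sub>R p') * (1 - p))"
      by (rule pos_comm_mult[OF p'(3) pos_1_proj[OF p(1)]]) (use c pp in \<open>simp add: algebra_simps, metis mult.assoc\<close>)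
    then show "pos (a * (p' * (1 - p)) - r' *\<^sub>R (p' * (1 - p)))" by (simp add: left_diff_distrib mult.assoc)
    have "pos ((r *\<^sub>R (1 - p) - a * (1 - p)) * p')"
      by (rule pos_comm_mult[OF p(4) pos_proj[OF p'(1)]]) (use c pp in \<open>simp add: algebra_simps, metis mult.assoc\<close>)
    moreover have "(1 - p) * p' = p' * (1 - p)" by (simp add: algebra_simps pp)
    ultimately show "pos (r *\<^sub>R (p' * (1 - p)) - a * (p' * (1 - p)))" by (simp only: left_diff_distrib[of "r *\<^sub>R (1 - p)"] mult_scaleR_left mult.assoc)
    show "r < r'" using assms(2) False by simp
  qed
  then have "p' * p = p'" by (simp add: algebra_simps)
  then show ?thesis using proj_le_iff[OF p'(1) p(1)] by (simp add: p_def p'_def)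
qed simp

lemma E_zero: assumes "pos a" "norm a < r" shows "E a r = 0"
proof (rule sproj_separate[OF E_proj[OF assms(1)] pos_star[OF assms(1)] _ E_ge[OF assms(1)] _ assms(2)])
  have c: "a * E a r = E a r * a" by (rule E_commute[OF assms(1)]) simp
  then show "E a r * a = a * E a r" by simp
  have "pos ((norm a *\<^sub>R 1 - a) * E a r)"
    by (rule pos_comm_mult[OF pos_norm_diff[OF pos_star[OF assms(1)] order_refl] pos_proj[OF E_proj[OF assms(1)]]])
      (simp add: algebra_simps c)
  then show "pos (norm a *\<^sub>R E a r - a * E a r)" by (simp add: algebra_simps)
qed

section \<open>Inverse square roots and partial isometries on corners\<close>

lemma inverse_sqrt:
  assumes h: "pos (h - \<delta> *\<^sub>R 1)" and \<delta>: "\<delta> > 0"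
  shows "\<exists>g. pos g \<and> g * g * h = 1 \<and> (\<forall>z. z * h = h * z \<longrightarrow> z * g = g * z)"
proof -
  have "pos h" using pos_add[OF h pos_scaleR_one[of \<delta>]] \<delta> by simp
  then have sh: "star h = h" by (rule pos_star)
  define K where "K = norm h"
  have Kh: "pos (K *\<^sub>R 1 - h)" unfolding K_def by (rule pos_norm_diff[OF sh order_refl])
  have "tr (K *\<^sub>R 1 - \<delta> *\<^sub>R 1) \<ge> 0" by (rule tr_pos) (rule pos_trans[OF h Kh])
  then have K: "\<delta> \<le> K" by (simp add: tr_simps)
  then have K0: "K > 0" using \<delta> by simp
  \<comment> \<open>Now \<open>h = K (1 - v)\<close> with \<open>norm v < 1\<close>, so a geometric
    series inverts \<open>h\<close>. Its partial sums are positive because \<open>v\<close> is, so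
    the inverse has a root.\<close>
  define v where "v = 1 - (1 / K) *\<^sub>R h"
  have pv: "pos v" using pos_scaleR[OF Kh, of "1 / K"] K0 by (simp add: v_def scaleR_diff_right)
  have "norm v \<le> 1 - \<delta> / K"
  proof (rule norm_le_of_pos'[OF pv])
    show "pos ((1 - \<delta> / K) *\<^sub>R 1 - v)"
      using pos_scaleR[OF h, of "1 / K"] K0 by (simp add: v_def algebra_simps)
    show "1 - \<delta> / K \<ge> 0" using K K0 by simp
  qed
  then have "norm v < 1" using \<delta> K0 by (smt (verit) divide_pos_pos)
  then have sm: "summable (\<lambda>n. v ^ n)" by (rule complete_algebra_summable_geometric)
  define S where "S = (\<Sum>n. v ^ n)"
  have "S = 1 + (\<Sum>n. v * v ^ n)" unfolding S_def using suminf_split_head[OF sm] by simp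
  also have "\<dots> = 1 + v * S" unfolding S_def by (subst suminf_mult[OF sm]) simp
  finally have vS: "(1 - v) * S = 1" by (simp add: algebra_simps)
  have pS: "pos S"
  proof (rule pos_limit)
    show "(\<lambda>n. \<Sum>i<n. v ^ i) \<longlonglongrightarrow> S" unfolding S_def using sm by (rule summable_LIMSEQ)
  qed (simp add: pos_sum pos_power pv)
  have cS: "z * S = S * z" if "z * h = h * z" for z
  proof -
    have "v * z = z * v" using that by (simp add: v_def algebra_simps)
    then have "z * v ^ n = v ^ n * z" for n using power_commuting_commutes[of v z n] by simp
    then show ?thesis unfolding S_def using suminf_mult[OF sm, of z] suminf_mult2[OF sm, of z] by simp
  qed
  have hS: "h * S = K *\<^sub>R 1"
  proof -
    have "h = K *\<^sub>R (1 - v)" using K0 by (simp add: v_def)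
    then have "h * S = K *\<^sub>R ((1 - v) * S)" by simp
    then show ?thesis by (simp add: vS)
  qed
  have "pos ((1 / K) *\<^sub>R S)" using pS K0 by (simp add: pos_scaleR)
  from pos_sqrt[OF this] obtain g where g: "pos g" "g * g = (1 / K) *\<^sub>R S"
    "\<And>z. z * ((1 / K) *\<^sub>R S) = ((1 / K) *\<^sub>R S) * z \<Longrightarrow> z * g = g * z" by blast
  have "g * g * h = 1" using cS[of h] hS K0 unfolding g(2) by (metis mult_scaleR_left scaleR_scaleR scaleR_one nonzero_divide_eq_eq less_irrefl)
  moreover have "z * g = g * z" if "z * h = h * z" for z
    by (rule g(3)) (simp add: cS[OF that])
  ultimately show ?thesis using g(1) by blast
qed

lemma corner_inverse_sqrt:
  assumes h: "pos h" and e: "proj e" "e * h = h * e" and \<delta>: "pos (h * e - \<delta> *\<^sub>R e)" "\<delta> > 0"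
  obtains g where "star g = g" "e * g = g" "g * e = g" "g * g * h = e" "h * g = g * h"
proof -
  \<comment> \<open>Filling the complement of \<open>e\<close> with 1 makes the element invertible
    in the whole algebra, with lower bound the smaller of \<delta> and 1.\<close>
  define h' where "h' = h * e + (1 - e)"
  define m where "m = min \<delta> 1"
  have m: "m > 0" "m \<le> \<delta>" "m \<le> 1" using \<delta>(2) by (auto simp: m_def)
  have "pos ((h * e - \<delta> *\<^sub>R e) + (\<delta> - m) *\<^sub>R e + (1 - m) *\<^sub>R (1 - e))"
    by (intro pos_add pos_scaleR \<delta>(1) pos_proj pos_1_proj e(1)) (use m in auto)
  also have "(h * e - \<delta> *\<^sub>R e) + (\<delta> - m) *\<^sub>R e + (1 - m) *\<^sub>R (1 - e) = h' - m *\<^sub>R 1"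
    by (simp add: h'_def algebra_simps)
  finally have "pos (h' - m *\<^sub>R 1)" .
  from inverse_sqrt[OF this m(1)] obtain t where t: "pos t" "t * t * h' = 1"
    "\<And>z. z * h' = h' * z \<Longrightarrow> z * t = t * z" by blast
  have ee: "e * e = e" using projD[OF e(1)] by simp
  have h'e: "h' * e = h * e" by (simp add: h'_def algebra_simps ee mult.assoc)
  have eh': "e * h' = h' * e" by (simp add: h'_def algebra_simps ee) (metis e(2) ee mult.assoc)
  have hh': "h * h' = h' * h" by (simp add: h'_def algebra_simps e(2))
  have et: "e * t = t * e" and ht: "h * t = t * h" using t(3) eh' hh' by auto
  define g where "g = e * t"
  show thesis
  proof
    show "star g = g" using t(1) projD[OF e(1)] et by (simp add: g_def star_simps pos_star)
    show 1: "e * g = g" by (simp add: g_def flip: mult.assoc) (simp add: ee)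
    show 2: "g * e = g" unfolding g_def using et ee by (metis mult.assoc)
    have "g * g * h = t * t * (h' * e)"
      unfolding g_def h'e using et ee e(2) ht by (metis mult.assoc)
    also have "\<dots> = e" using t(2) by (simp flip: mult.assoc)
    finally show "g * g * h = e" .
    show "h * g = g * h" unfolding g_def using et e(2) ht by (metis mult.assoc)
  qed
qed

text \<open>Polar decomposition restricted to a corner where \<open>star x * x\<close> is bounded
  below. There \<open>g\<close> inverts the absolute value of \<open>x\<close>, so no limit is
  involved.\<close>

lemma partial_isometry_of_corner:
  assumes e: "proj e" "e * (star x * x) = (star x * x) * e"
    and \<delta>: "pos (star x * x * e - \<delta> *\<^sub>R e)" "\<delta> > 0"
  obtains g where "star (x * g) * (x * g) = e" "e * g = g" "star g = g" "g * g * (star x * x) = e"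
proof -
  obtain g where g: "star g = g" "e * g = g" "g * e = g" "g * g * (star x * x) = e"
      "(star x * x) * g = g * (star x * x)"
    using corner_inverse_sqrt[OF pos_star_mult e \<delta>] .
  have "star (x * g) * (x * g) = g * ((star x * x) * g)" by (simp add: star_simps g(1) mult.assoc)
  also have "\<dots> = e" using g(4,5) by (simp add: mult.assoc)
  finally show ?thesis using that g by blast
qed

lemma norm_partial_isometry: "star w * w = p \<Longrightarrow> proj p \<Longrightarrow> norm w \<le> 1"
  using norm_star_mult[of w] norm_proj_le[of p] by (simp add: power2_eq_square) (metis abs_le_square_iff abs_norm_cancel abs_one mult_1 power2_eq_square)

lemma range_proj_le:
  assumes w: "star w * w = p" "proj p" and q: "proj q" "q * w = w"
  shows "pos (q - w * star w)"
proof -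
  have "norm (w * star w) \<le> 1"
    using norm_partial_isometry[OF w] by (simp add: norm_mult_star power_le_one)
  then have "pos (1 *\<^sub>R 1 - w * star w)" by (intro pos_norm_diff) (auto simp: star_simps)
  then have "pos (star q * (1 - w * star w) * q)" using pos_conj by simp
  moreover have "star w * q = star w" using q by (metis star_mult projD(1))
  ultimately show ?thesis
    using q projD[OF q(1)] by (simp add: algebra_simps) (metis mult.assoc q(2))
qed

text \<open>On \<open>p = E a r'\<close> the element is at least \<open>r'\<close>, while its
  compression to \<open>e\<close> is at most \<open>r\<close>; hence
  \<open>norm (e * p * e) \<le> r / r' < 1\<close>. So \<open>(1 - e) * p\<close> is bounded below
  on \<open>p\<close>, and its polar part maps \<open>p\<close> under \<open>1 - e\<close>. Only the
  compression is assumed to be small, since \<open>e\<close> need not commute with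
  \<open>a\<close>.\<close>

lemma tr_E_le_compl:
  assumes a: "pos a" and e: "proj e" and le: "pos (r *\<^sub>R e - e * a * e)" and r: "0 \<le> r" "r < r'"
  shows "tr (E a r') \<le> tr (1 - e)"
proof -
  define p where "p = E a r'"
  note p = E_props[where r=r', OF a, folded p_def]
  have r': "r' > 0" using r by simp
  have ap: "a * p = p * a" using p(2)[of a] by simp
  have pp: "p * p = p" and sp: "star p = p" and ee: "e * e = e" and se: "star e = e"
    using projD[OF p(1)] projD[OF e] by auto
  have "pos (a * (1 - p))" by (rule pos_comm_mult[OF a pos_1_proj[OF p(1)]]) (simp add: algebra_simps ap)
  from pos_add[OF p(3) this] have "pos (a - r' *\<^sub>R p)" by (simp add: algebra_simps)
  from pos_conj[OF this, of e] have "pos (e * a * e - r' *\<^sub>R (e * p * e))" by (simp add: se algebra_simps)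
  then have 1: "pos (r *\<^sub>R e - r' *\<^sub>R (e * p * e))" using le by (rule pos_trans)
  define \<rho> where "\<rho> = r / r'"
  have \<rho>: "0 \<le> \<rho>" "\<rho> < 1" using r by (auto simp: \<rho>_def)
  have "norm (e * p * e) \<le> \<rho>"
  proof (rule norm_le_of_pos')
    show "pos (e * p * e)" using pos_conj[OF pos_proj[OF p(1)], of e] by (simp add: se)
    have "pos ((1 / r') *\<^sub>R (r *\<^sub>R e - r' *\<^sub>R (e * p * e)) + \<rho> *\<^sub>R (1 - e))"
      by (intro pos_add pos_scaleR 1 pos_1_proj e) (use r' \<rho> in auto)
    then show "pos (\<rho> *\<^sub>R 1 - e * p * e)" using r' by (simp add: \<rho>_def algebra_simps)
  qed (use \<rho> in simp)
  moreover have "norm (e * p * e) = norm (p * e * p)"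
  proof -
    have "norm (e * p * e) = norm (star (p * e) * (p * e))" using pp by (simp add: star_simps sp se) (metis mult.assoc)
    also have "\<dots> = norm ((p * e) * star (p * e))" by (simp add: norm_star_mult norm_mult_star)
    also have "\<dots> = norm (p * e * p)" using ee by (simp add: star_simps sp se) (metis mult.assoc)
    finally show ?thesis .
  qed
  ultimately have n: "norm (p * e * p) \<le> \<rho>" by simp
  define x where "x = (1 - e) * p"
  have h: "star x * x = p - p * e * p"
    using pp ee by (simp add: x_def star_simps sp se algebra_simps) (metis mult.assoc)
  have "pos (\<rho> *\<^sub>R 1 - p * e * p)" by (rule pos_norm_diff[OF _ n]) (simp add: star_simps sp se mult.assoc)
  from pos_conj[OF this, of p] have "pos (\<rho> *\<^sub>R p - p * e * p)"
    using pp by (simp add: sp algebra_simps) (metis mult.assoc)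
  then have \<delta>: "pos (star x * x * p - (1 - \<rho>) *\<^sub>R p)"
    unfolding h using pp by (simp add: algebra_simps)
  have "p * (star x * x) = star x * x * p" unfolding h by (simp add: algebra_simps pp) (metis mult.assoc pp)
  from partial_isometry_of_corner[OF p(1) this \<delta>] \<rho> obtain g where g: "star (x * g) * (x * g) = p" by auto
  have "(1 - e) * (x * g) = x * g"
    unfolding x_def using projD[OF proj_compl[OF e]] by (metis mult.assoc)
  then have "pos ((1 - e) - (x * g) * star (x * g))" by (rule range_proj_le[OF g p(1) proj_compl[OF e]])
  then have "tr ((x * g) * star (x * g)) \<le> tr (1 - e)" by (rule tr_mono)
  then show ?thesis using tr_comm[of "x * g" "star (x * g)"] g by (simp add: p_def)
qed

section \<open>Singular values in terms of spectral projections\<close>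

abbreviation mu :: "'a \<Rightarrow> real \<Rightarrow> real" where "mu \<equiv> sing_val star \<tau>"

lemma mu_eq: "mu x t = Inf {norm (x * e) | e. proj e \<and> tr (1 - e) \<le> t}"
  by (simp add: sing_val_def tr_def)

lemma mu_le: "proj e \<Longrightarrow> tr (1 - e) \<le> t \<Longrightarrow> mu x t \<le> norm (x * e)"
  unfolding mu_eq by (rule cInf_lower) (auto intro!: bdd_belowI[of _ 0])

lemma mu_greatest:
  assumes "t \<ge> 0" "\<And>e. proj e \<Longrightarrow> tr (1 - e) \<le> t \<Longrightarrow> c \<le> norm (x * e)"
  shows "c \<le> mu x t"
  unfolding mu_eq
proof (rule cInf_greatest)
  have "norm (x * 1) \<in> {norm (x * e) | e. proj e \<and> tr (1 - e) \<le> t}" using assms(1) by fastforce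
  then show "{norm (x * e) | e. proj e \<and> tr (1 - e) \<le> t} \<noteq> {}" by blast
qed (use assms(2) in auto)

lemma mu_nonneg: "t \<ge> 0 \<Longrightarrow> mu x t \<ge> 0" by (rule mu_greatest) auto

lemma mu_antimono: "0 \<le> s \<Longrightarrow> s \<le> t \<Longrightarrow> mu x t \<le> mu x s"
  by (rule mu_greatest) (auto intro: mu_le)

lemma mu_ge_1: "t \<ge> 1 \<Longrightarrow> mu x t = 0"
  using mu_le[of 0 t x] mu_nonneg[of t x] by simp

lemma mu_le_norm: "t \<ge> 0 \<Longrightarrow> mu x t \<le> norm x"
  using mu_le[of 1 t x] by simp

lemma mu_le_E:
  assumes a: "pos a" and r: "r \<ge> 0" "tr (E a r) \<le> t" shows "mu a t \<le> r"
proof -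
  define q where "q = 1 - E a r"
  have q: "proj q" unfolding q_def by (rule proj_compl[OF E_proj[OF a]])
  have "a * E a r = E a r * a" using E_commute[OF a, of a] by simp
  then have "pos (a * q)" by (intro pos_comm_mult[OF a pos_proj[OF q]]) (simp add: q_def algebra_simps)
  moreover have "pos (r *\<^sub>R 1 - a * q)"
    using pos_add[OF E_le[OF a, of r, folded q_def] pos_scaleR[OF pos_1_proj[OF q] r(1)]] by (simp add: algebra_simps)
  ultimately have "norm (a * q) \<le> r" using r(1) norm_le_of_pos' by blast
  moreover have "mu a t \<le> norm (a * q)" by (rule mu_le[OF q]) (simp add: q_def r(2))
  ultimately show ?thesis by simp
qed

text \<open>A projection \<open>e\<close> with \<open>norm (a * e) < r\<close> compresses
  \<open>a\<close> below some number less than \<open>r\<close>; by \<open>tr_E_le_compl\<close> its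
  complement then has trace at least \<open>tr (E a r)\<close>, too large to compete in the
  infimum.\<close>

lemma mu_ge_E:
  assumes a: "pos a" and t: "0 \<le> t" "t < tr (E a r)" shows "r \<le> mu a t"
proof (rule mu_greatest[OF t(1)])
  fix e assume e: "proj e" "tr (1 - e) \<le> t"
  show "r \<le> norm (a * e)"
  proof (rule ccontr)
    assume "\<not> r \<le> norm (a * e)"
    define \<rho> where "\<rho> = norm (a * e)"
    have \<rho>: "0 \<le> \<rho>" "\<rho> < r" using \<open>\<not> r \<le> norm (a * e)\<close> by (auto simp: \<rho>_def)
    have "norm (e * (a * e)) \<le> norm e * \<rho>" unfolding \<rho>_def by (rule norm_mult_ineq)
    then have "norm (e * a * e) \<le> \<rho>"
      using mult_right_mono[OF norm_proj_le[OF e(1)] \<rho>(1)] by (simp add: mult.assoc)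
    then have "pos (\<rho> *\<^sub>R 1 - e * a * e)"
      by (intro pos_norm_diff) (simp_all add: star_simps pos_star[OF a] projD[OF e(1)] mult.assoc)
    from pos_conj[OF this, of e] have "pos (\<rho> *\<^sub>R e - e * a * e)"
      using projD[OF e(1)] by (simp add: algebra_simps) (metis mult.assoc)
    from tr_E_le_compl[OF a e(1) this \<rho>] show False using e(2) t(2) by simp
  qed
qed

lemma tr_E_le_of_mu: "pos a \<Longrightarrow> 0 \<le> t \<Longrightarrow> mu a t < r \<Longrightarrow> tr (E a r) \<le> t"
  using mu_ge_E[of a t r] by force

lemma mu_le_of_E:
  assumes "pos a" "\<And>r. r > \<rho> \<Longrightarrow> tr (E a r) \<le> t" "\<rho> \<ge> 0"
  shows "mu a t \<le> \<rho>"
proof (rule field_le_epsilon)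
  fix \<epsilon> :: real assume "\<epsilon> > 0"
  then show "mu a t \<le> \<rho> + \<epsilon>" using assms by (intro mu_le_E) auto
qed

text \<open>Norms of \<open>a * e\<close> and \<open>c * e\<close> do not compare directly, but
  compressions do: with \<open>f = 1 - E c r\<close>,
  \<open>f * a * f \<le> f * c * f \<le> r f\<close>, although \<open>f\<close> need not commute
  with \<open>a\<close>.\<close>

lemma mu_mono:
  assumes a: "pos a" and ac: "pos (c - a)" and t: "t \<ge> 0"
  shows "mu a t \<le> mu c t"
proof -
  have c: "pos c" using pos_add[OF a ac] by simp
  define \<rho> where "\<rho> = mu c t"
  have \<rho>0: "\<rho> \<ge> 0" using mu_nonneg[OF t] by (simp add: \<rho>_def)
  show ?thesis unfolding \<rho>_def[symmetric]
  proof (rule mu_le_of_E[OF a _ \<rho>0])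
    fix r' assume "r' > \<rho>"
    then obtain r where r: "\<rho> < r" "r < r'" using dense by blast
    define f where "f = 1 - E c r"
    have f: "proj f" unfolding f_def by (rule proj_compl[OF E_proj[OF c]])
    have trf: "tr (1 - f) \<le> t" using tr_E_le_of_mu[OF c t, of r] r by (simp add: f_def \<rho>_def)
    have "c * E c r = E c r * c" using E_commute[OF c, of c] by simp
    then have "f * c * f = c * f" using projD[OF f] by (simp add: f_def algebra_simps mult.assoc) (metis mult.assoc)
    then have "pos (r *\<^sub>R f - f * c * f)" using E_le[OF c, of r] by (simp add: f_def)
    moreover have "pos (f * c * f - f * a * f)" using pos_conj[OF ac, of f] projD[OF f] by (simp add: algebra_simps)
    ultimately have "pos (r *\<^sub>R f - f * a * f)" using pos_trans by blast
    then have "tr (E a r') \<le> tr (1 - f)" using r \<rho>0 by (intro tr_E_le_compl[OF a f]) auto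
    then show "tr (E a r') \<le> t" using trf by simp
  qed
qed

text \<open>Domination is used at the single point \<open>t = tr (E b r)\<close>, where the singular
  value of \<open>b\<close> is at most \<open>r\<close> and hence below \<open>r'\<close>.\<close>

lemma spec_dom_tr_E:
  assumes a: "pos a" and b: "pos b" and sd: "spec_dom star \<tau> a b" and r: "0 \<le> r" "r < r'"
  shows "tr (E a r') \<le> tr (E b r)"
proof (rule tr_E_le_of_mu[OF a])
  show t: "0 \<le> tr (E b r)" by (rule tr_pos[OF pos_proj[OF E_proj[OF b]]])
  have "mu a (tr (E b r)) \<le> mu b (tr (E b r))" using sd t by (simp add: spec_dom_def)
  also have "\<dots> \<le> r" by (rule mu_le_E[OF b r(1) order_refl])
  finally show "mu a (tr (E b r)) < r'" using r(2) by simp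
qed

section \<open>Unitary orbits and their norm closures\<close>

abbreviation unitary :: "'a \<Rightarrow> bool" where "unitary \<equiv> is_unitary star"

lemma unitaryD: "unitary u \<Longrightarrow> star u * u = 1" "unitary u \<Longrightarrow> u * star u = 1"
  by (auto simp: is_unitary_def)

lemma norm_unitary: "unitary u \<Longrightarrow> norm u = 1"
  using norm_star_mult[of u] power2_eq_iff_nonneg[of "norm u" 1] by (simp add: is_unitary_def)

lemma norm_unitary_conj:
  assumes "unitary u" shows "norm (u * x * star u) \<le> norm x"
proof -
  have "norm (u * x * star u) \<le> norm u * norm x * norm (star u)"
    by (meson mult_right_mono norm_ge_zero norm_mult_ineq order_trans)
  then show ?thesis using norm_unitary[OF assms] by simp
qed

text \<open>Conjugating a competitor \<open>e\<close> for \<open>b\<close> by \<open>u\<close> gives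
  a competitor \<open>f\<close> of the same trace for \<open>c\<close>, with \<open>c * f\<close>
  within \<epsilon> of a conjugate of \<open>b * e\<close>.\<close>

lemma mu_approx_unitary:
  assumes ap: "\<And>\<epsilon>. \<epsilon> > 0 \<Longrightarrow> \<exists>u. unitary u \<and> norm (c - u * b * star u) < \<epsilon>" and t: "t \<ge> 0"
  shows "mu c t \<le> mu b t"
proof (rule mu_greatest[OF t], rule field_le_epsilon)
  fix e and \<epsilon> :: real
  assume e: "proj e" "tr (1 - e) \<le> t" and "\<epsilon> > 0"
  then obtain u where u: "unitary u" "norm (c - u * b * star u) < \<epsilon>" using ap by blast
  note uu = unitaryD[OF u(1)]
  define f where "f = u * e * star u"
  have f: "proj f"
    unfolding is_projection_def f_def using projD[OF e(1)] uu
    by (simp add: star_simps mult.assoc) (metis mult.assoc mult.left_neutral)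
  have "tr (u * e * star u) = tr (star u * (u * e))" by (rule tr_comm)
  also have "\<dots> = tr e" using uu by (simp flip: mult.assoc)
  finally have "tr (1 - f) \<le> t" using e(2) by (simp add: f_def tr_simps)
  then have "mu c t \<le> norm (c * f)" by (rule mu_le[OF f])
  also have "c * f = (c - u * b * star u) * f + u * (b * e) * star u"
    unfolding f_def using uu(1) by (simp add: algebra_simps) (metis mult.assoc mult.left_neutral)
  also have "norm \<dots> \<le> norm ((c - u * b * star u) * f) + norm (u * (b * e) * star u)" by (rule norm_triangle_ineq)
  also have "\<dots> \<le> \<epsilon> + norm (b * e)"
  proof (rule add_mono)
    have "norm ((c - u * b * star u) * f) \<le> norm (c - u * b * star u) * norm f" by (rule norm_mult_ineq)
    also have "\<dots> \<le> norm (c - u * b * star u) * 1" using norm_proj_le[OF f] by (intro mult_left_mono) auto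
    finally show "norm ((c - u * b * star u) * f) \<le> \<epsilon>" using u(2) by simp
  qed (rule norm_unitary_conj[OF u(1)])
  finally show "mu c t \<le> norm (b * e) + \<epsilon>" by simp
qed

lemma closure_orbit_iff:
  "c \<in> closure (unitary_orbit star b) \<longleftrightarrow> (\<forall>\<epsilon>>0. \<exists>u. unitary u \<and> norm (c - u * b * star u) < \<epsilon>)"
  unfolding closure_approachable unitary_orbit_def dist_norm
  by (simp add: norm_minus_commute[of c] Bex_def) blast

lemma mu_closure_orbit:
  assumes "c \<in> closure (unitary_orbit star b)" "t \<ge> 0"
  shows "mu c t = mu b t"
proof (rule antisym)
  show "mu c t \<le> mu b t"
    using assms by (intro mu_approx_unitary) (auto simp: closure_orbit_iff)
  show "mu b t \<le> mu c t"
  proof (rule mu_approx_unitary[OF _ assms(2)])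
    fix \<epsilon> :: real assume "\<epsilon> > 0"
    then obtain u where u: "unitary u" "norm (c - u * b * star u) < \<epsilon>"
      using assms(1) by (auto simp: closure_orbit_iff)
    have v: "unitary (star u)" using u(1) by (simp add: is_unitary_def)
    have "b - star u * c * u = - (star u * (c - u * b * star u) * u)"
      using unitaryD[OF u(1)] by (simp add: algebra_simps) (metis mult.assoc mult.left_neutral)
    then have "norm (b - star u * c * u) \<le> norm (c - u * b * star u)"
      using norm_unitary_conj[OF v, of "c - u * b * star u"] by simp
    then show "\<exists>u. unitary u \<and> norm (b - u * c * star u) < \<epsilon>"
      using v u(2) by (intro exI[of _ "star u"]) auto
  qed
qed

section \<open>Majorization\<close>

lemma mu_integrable: "0 \<le> u \<Longrightarrow> mu x integrable_on {u..v}"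
proof -
  assume "0 \<le> u"
  then have "mono_on {u..v} (\<lambda>t. - mu x t)" by (auto simp: mono_on_def intro!: mu_antimono)
  then have "(\<lambda>t. - mu x t) integrable_on {u..v}" by (rule integrable_on_mono_on)
  from integrable_neg[OF this] show ?thesis by simp
qed

section \<open>Horizontal layers of an element and of its singular values\<close>

lemma E_between:
  assumes a: "pos a" and r: "r \<le> r'"
  shows "pos (a * (E a r - E a r') - r *\<^sub>R (E a r - E a r'))"
    and "pos (r' *\<^sub>R (E a r - E a r') - a * (E a r - E a r'))"
proof -
  define p where "p = E a r" define p' where "p' = E a r'"
  note p = E_props[where r=r, OF a, folded p_def] and p' = E_props[where r=r', OF a, folded p'_def]
  have c: "a * p = p * a" "a * p' = p' * a" using p(2) p'(2) by auto
  have pp: "p' * p = p'" "p * p' = p'"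
    using proj_le_mult[OF p'(1) p(1)] E_antimono[OF a r] by (auto simp: p_def p'_def)
  have "pos ((a * p - r *\<^sub>R p) * (1 - p'))"
    by (rule pos_comm_mult[OF p(3) pos_1_proj[OF p'(1)]]) (use c pp in \<open>simp add: algebra_simps, metis mult.assoc\<close>)
  also have "(a * p - r *\<^sub>R p) * (1 - p') = a * (p - p') - r *\<^sub>R (p - p')"
    by (simp add: algebra_simps mult.assoc pp)
  finally show "pos (a * (E a r - E a r') - r *\<^sub>R (E a r - E a r'))" by (simp add: p_def p'_def)
  have "pos ((r' *\<^sub>R (1 - p') - a * (1 - p')) * p)"
    by (rule pos_comm_mult[OF p'(4) pos_proj[OF p(1)]]) (use c pp in \<open>simp add: algebra_simps, metis mult.assoc\<close>)
  also have "(r' *\<^sub>R (1 - p') - a * (1 - p')) * p = r' *\<^sub>R (p - p') - a * (p - p')"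
    by (simp add: algebra_simps mult.assoc pp)
  finally show "pos (r' *\<^sub>R (E a r - E a r') - a * (E a r - E a r'))" by (simp add: p_def p'_def)
qed

lemma layer_sum:
  assumes b: "pos b" and \<delta>: "\<delta> > 0" and n: "norm b \<le> real n * \<delta>"
  defines "S \<equiv> \<Sum>k=1..n. \<delta> *\<^sub>R E b (real k * \<delta>)"
  shows "pos (b - S)" "pos (\<delta> *\<^sub>R 1 - (b - S))"
proof -
  define p where "p m = E b (real m * \<delta>)" for m
  \<comment> \<open>Subtracting \<open>b - m \<delta>\<close> on \<open>p m\<close> truncates
    \<open>b\<close> at height \<open>m \<delta>\<close>, so \<open>Y m\<close> is the truncation
    minus its first \<open>m\<close> layers. Both \<open>Y m\<close> and its distance to
    \<open>\<delta> (1 - p m)\<close> grow with \<open>m\<close>, by the two slab estimates of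
    \<open>E_between\<close>.\<close>
  define Y where "Y m = b - (\<Sum>k=1..m. \<delta> *\<^sub>R p k) - (b * p m - (real m * \<delta>) *\<^sub>R p m)" for m
  have pr: "proj (p m)" for m unfolding p_def by (rule E_proj[OF b])
  have "pos (Y m) \<and> pos (\<delta> *\<^sub>R (1 - p m) - Y m)" for m
  proof (induction m)
    case 0
    then show ?case by (simp add: Y_def p_def E_nonpos)
  next
    case (Suc m)
    have 1: "Y (Suc m) - Y m = b * (p m - p (Suc m)) - (real m * \<delta>) *\<^sub>R (p m - p (Suc m))"
      by (simp add: Y_def algebra_simps)
    have 2: "(\<delta> *\<^sub>R (1 - p (Suc m)) - Y (Suc m)) - (\<delta> *\<^sub>R (1 - p m) - Y m)
        = (real (Suc m) * \<delta>) *\<^sub>R (p m - p (Suc m)) - b * (p m - p (Suc m))"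
      by (simp add: Y_def algebra_simps)
    have le: "real m * \<delta> \<le> real (Suc m) * \<delta>" using \<delta> by simp
    have "pos (Y (Suc m) - Y m)"
      unfolding 1 p_def by (rule E_between(1)[OF b le])
    moreover have "pos ((\<delta> *\<^sub>R (1 - p (Suc m)) - Y (Suc m)) - (\<delta> *\<^sub>R (1 - p m) - Y m))"
      unfolding 2 unfolding p_def by (rule E_between(2)[OF b le])
    ultimately show ?case
      using pos_add[of "Y m" "Y (Suc m) - Y m"]
        pos_add[of "\<delta> *\<^sub>R (1 - p m) - Y m" "(\<delta> *\<^sub>R (1 - p (Suc m)) - Y (Suc m)) - (\<delta> *\<^sub>R (1 - p m) - Y m)"]
        Suc by simp
  qed
  from this[of n] have Y: "pos (Y n)" "pos (\<delta> *\<^sub>R (1 - p n) - Y n)" by auto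
  have c: "b * p n = p n * b" unfolding p_def using E_commute[OF b, of b] by simp
  have "pos (((real n * \<delta>) *\<^sub>R 1 - b) * p n)"
    by (rule pos_comm_mult[OF pos_norm_diff[OF pos_star[OF b] n] pos_proj[OF pr]]) (simp add: algebra_simps c)
  moreover have "pos (b * p n - (real n * \<delta>) *\<^sub>R p n)" unfolding p_def by (rule E_ge[OF b])
  moreover have "((real n * \<delta>) *\<^sub>R 1 - b) * p n = - (b * p n - (real n * \<delta>) *\<^sub>R p n)"
    by (simp add: algebra_simps)
  \<comment> \<open>The top projection may be non-zero when \<open>norm b = n \<delta>\<close>, but
    \<open>b\<close> equals \<open>n \<delta>\<close> on it, so the truncation at that height
    changes nothing.\<close>
  ultimately have "b * p n - (real n * \<delta>) *\<^sub>R p n = 0" using pos_antisym by metis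
  then have YS: "Y n = b - S" by (simp add: Y_def S_def p_def)
  show "pos (b - S)" using Y(1) YS by simp
  show "pos (\<delta> *\<^sub>R 1 - (b - S))"
    using pos_add[OF Y(2) pos_scaleR[OF pos_proj[OF pr[of n]], of \<delta>]] \<delta> by (simp add: YS algebra_simps)
qed

text \<open>The scalar counterpart of \<open>layer_sum\<close>: \<open>g t\<close> counts the layers
  whose trace exceeds \<open>t\<close>. The induction distinguishes whether \<open>t\<close> still
  lies in every layer so far or has left them, after which the count is frozen and the singular
  value is trapped.\<close>

lemma mu_layer:
  assumes a: "pos a" and \<delta>: "\<delta> > 0" and n: "norm a \<le> real n * \<delta>" and t: "t \<ge> 0"
  defines "g \<equiv> \<lambda>t. \<Sum>k=1..n. \<delta> * (if t < tr (E a (real k * \<delta>)) then 1 else 0)"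
  shows "g t \<le> mu a t" "mu a t \<le> g t + \<delta>"
proof -
  define d where "d m = tr (E a (real m * \<delta>))" for m
  define G where "G m = (\<Sum>k=1..m. \<delta> * (if t < d k then 1 else 0))" for m
  have anti: "d (Suc m) \<le> d m" for m
    unfolding d_def by (rule tr_mono[OF E_antimono[OF a]]) (use \<delta> in simp)
  have "(G m = real m * \<delta> \<and> (m = 0 \<or> t < d m)) \<or> (G m \<le> mu a t \<and> mu a t \<le> G m + \<delta> \<and> \<not> t < d m)" for m
  proof (induction m)
    case 0
    then show ?case by (simp add: G_def)
  next
    case (Suc m)
    have GS: "G (Suc m) = G m + \<delta> * (if t < d (Suc m) then 1 else 0)" by (simp add: G_def)
    show ?case
    proof (cases "t < d (Suc m)")
      case True
      then have "t < d m" using anti[of m] by simp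
      then show ?thesis using Suc True by (auto simp: GS algebra_simps)
    next
      case False
      have "mu a t \<le> real (Suc m) * \<delta>"
        using False \<delta> by (intro mu_le_E[OF a]) (auto simp: d_def)
      moreover have "real m * \<delta> \<le> mu a t" if "m = 0 \<or> t < d m"
        using that mu_ge_E[OF a t, of "real m * \<delta>"] mu_nonneg[OF t] by (auto simp: d_def)
      ultimately show ?thesis using Suc False by (auto simp: GS algebra_simps)
    qed
  qed
  from this[of n] have "G n \<le> mu a t \<and> mu a t \<le> G n + \<delta>"
  proof
    assume "G n = real n * \<delta> \<and> (n = 0 \<or> t < d n)"
    moreover from this have "real n * \<delta> \<le> mu a t"
      using mu_ge_E[OF a t, of "real n * \<delta>"] mu_nonneg[OF t] by (auto simp: d_def)
    ultimately show ?thesis using mu_le_norm[OF t, of a] n \<delta> by simp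
  qed auto
  then show "g t \<le> mu a t" "mu a t \<le> g t + \<delta>" by (auto simp: G_def g_def d_def)
qed

text \<open>For every mesh \<delta> both sides lie within \<delta> above the sum \<open>s\<close>,
  which is the trace of the layer sum as well as the integral of the staircase of
  \<open>mu_layer\<close>.\<close>

lemma tr_eq_integral_mu:
  assumes a: "pos a" shows "tr a = integral {0..1} (mu a)"
proof -
  have "\<bar>tr a - integral {0..1} (mu a)\<bar> \<le> \<delta>" if \<delta>: "\<delta> > 0" for \<delta>
  proof -
    obtain n where n: "norm a \<le> real n * \<delta>"
      using reals_Archimedean3[OF \<delta>] less_imp_le by blast
    define d where "d m = tr (E a (real m * \<delta>))" for m
    define s where "s = (\<Sum>k=1..n. \<delta> * d k)"
    define g where "g t = (\<Sum>k=1..n. \<delta> * (if t < d k then 1 else 0))" for t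
    have d: "0 \<le> d k" "d k \<le> 1" for k
      unfolding d_def using tr_pos[OF pos_proj[OF E_proj[OF a]]] tr_proj_le[OF E_proj[OF a]] by auto
    have "tr (\<Sum>k=1..n. \<delta> *\<^sub>R E a (real k * \<delta>)) = s" by (simp add: s_def d_def tr_simps)
    then have 1: "s \<le> tr a" "tr a \<le> s + \<delta>"
      using tr_pos[OF layer_sum(1)[OF a \<delta> n]] tr_pos[OF layer_sum(2)[OF a \<delta> n]] by (auto simp: tr_diff tr_scaleR)
    have "((\<lambda>t. if t < d k then 1 else 0) has_integral d k) {0..1::real}" for k
    proof -
      have "((\<lambda>t. 1) has_integral d k) {0..d k}"
        using has_integral_const_real[of "1::real" 0 "d k"] d[of k] by simp
      then have "((\<lambda>t. if t \<in> {0..d k} then 1 else 0) has_integral d k) {0..1}"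
        using d[of k] by (subst has_integral_restrict) auto
      then show ?thesis
        by (rule has_integral_spike_finite[of "{d k}", rotated 2]) auto
    qed
    then have g: "(g has_integral s) {0..1}"
      unfolding g_def s_def by (intro has_integral_sum has_integral_mult_right) auto
    have gd: "((\<lambda>t. g t + \<delta>) has_integral s + \<delta>) {0..1}"
      using has_integral_add[OF g, of "\<lambda>t. \<delta>" \<delta>] has_integral_const_real[of \<delta> 0 1] by simp
    have m: "(mu a has_integral integral {0..1} (mu a)) {0..1}"
      by (rule integrable_integral, rule mu_integrable) simp
    have "s \<le> integral {0..1} (mu a)"
      by (rule has_integral_le[OF g m]) (unfold g_def d_def, rule mu_layer(1)[OF a \<delta> n], simp)
    moreover have "integral {0..1} (mu a) \<le> s + \<delta>"
      by (rule has_integral_le[OF m gd]) (unfold g_def d_def, rule mu_layer(2)[OF a \<delta> n], simp)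
    ultimately show ?thesis using 1 by simp
  qed
  then have "\<bar>tr a - integral {0..1} (mu a)\<bar> \<le> 0" by (rule field_le_epsilon) simp
  then show ?thesis by simp
qed

lemma tau_eq_tr: "pos x \<Longrightarrow> \<tau> x = of_real (tr x)"
  using tau_positive[of x] by (simp add: positive_eq_pos tr_def complex_eq_iff)

lemma integral_mu_combine:
  assumes "0 \<le> u" "u \<le> v"
  shows "integral {0..v} (mu x) = integral {0..u} (mu x) + integral {u..v} (mu x)"
  using Henstock_Kurzweil_Integration.integral_combine[OF assms mu_integrable] by simp

lemma integral_mu_ge_1: assumes "s \<ge> 1" shows "integral {0..s} (mu x) = integral {0..1} (mu x)"
proof -
  have "integral {1..s} (mu x) = integral {1..s} (\<lambda>t. 0)"
    by (rule Henstock_Kurzweil_Integration.integral_cong) (simp add: mu_ge_1)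
  then show ?thesis using integral_mu_combine[of 1 s x] assms by simp
qed

text \<open>\<open>upper_cut a r\<close> is \<open>max a r\<close>.\<close>

definition upper_cut :: "'a \<Rightarrow> real \<Rightarrow> 'a" where
  "upper_cut a r = a * E a r + r *\<^sub>R (1 - E a r)"

lemma upper_cut_ge: "pos a \<Longrightarrow> pos (upper_cut a r - a)"
  using E_le[of a r] by (simp add: upper_cut_def algebra_simps)

lemma upper_cut_ge_scalar: "pos a \<Longrightarrow> pos (upper_cut a r - r *\<^sub>R 1)"
  using E_ge[of a r] by (simp add: upper_cut_def algebra_simps)

lemma pos_upper_cut: "pos a \<Longrightarrow> pos (upper_cut a r)"
  using pos_add[OF _ upper_cut_ge[of a r], of a] by simp

lemma upper_cut_commute: "pos a \<Longrightarrow> z * a = a * z \<Longrightarrow> z * upper_cut a r = upper_cut a r * z"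
  using E_commute[of a z r] by (simp add: upper_cut_def algebra_simps) (metis mult.assoc)

lemma upper_cut_0: "upper_cut a 0 = a" by (simp add: upper_cut_def E_nonpos)

text \<open>Raising the level from \<open>r\<close> to \<open>r'\<close> increases
  \<open>max a r\<close> by something between 0 and \<open>r' - r\<close>. The resulting continuity
  allows the trace to be tuned by the intermediate value theorem.\<close>

lemma tr_upper_cut_lipschitz:
  assumes a: "pos a" and r: "r \<le> r'"
  shows "tr (upper_cut a r) \<le> tr (upper_cut a r')" "tr (upper_cut a r') \<le> tr (upper_cut a r) + (r' - r)"
proof -
  define p where "p = E a r" define p' where "p' = E a r'"
  have p: "proj p" "proj p'" unfolding p_def p'_def by (rule E_proj[OF a])+
  have 1: "upper_cut a r' - upper_cut a r = (r' - r) *\<^sub>R (1 - p) + (r' *\<^sub>R (p - p') - a * (p - p'))"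
    by (simp add: upper_cut_def p_def p'_def algebra_simps)
  have 2: "(r' - r) *\<^sub>R 1 - (upper_cut a r' - upper_cut a r) = (r' - r) *\<^sub>R p' + (a * (p - p') - r *\<^sub>R (p - p'))"
    unfolding 1 by (simp add: algebra_simps)
  have "pos (upper_cut a r' - upper_cut a r)"
    unfolding 1 using r
    by (intro pos_add[OF pos_scaleR[OF pos_1_proj[OF p(1)]]]) (auto simp: p_def p'_def intro: E_between[OF a r])
  then show "tr (upper_cut a r) \<le> tr (upper_cut a r')" by (rule tr_mono)
  have "pos ((r' - r) *\<^sub>R 1 - (upper_cut a r' - upper_cut a r))"
    unfolding 2 using r
    by (intro pos_add[OF pos_scaleR[OF pos_proj[OF p(2)]]]) (auto simp: p_def p'_def intro: E_between[OF a r])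
  then have "tr (upper_cut a r' - upper_cut a r) \<le> tr ((r' - r) *\<^sub>R 1)" by (rule tr_mono)
  then show "tr (upper_cut a r') \<le> tr (upper_cut a r) + (r' - r)" by (simp add: tr_simps)
qed

lemma exists_upper_cut:
  assumes a: "pos a" and t: "tr a \<le> t"
  shows "\<exists>r\<ge>0. tr (upper_cut a r) = t"
proof -
  have t0: "0 \<le> t" using tr_pos[OF a] t by simp
  have "continuous_on {0..t} (\<lambda>r. tr (upper_cut a r))"
  proof (rule continuous_on_subset[OF _ subset_UNIV], rule Lipschitz.lipschitz_on_continuous_on)
    show "1-lipschitz_on UNIV (\<lambda>r. tr (upper_cut a r))"
    proof (rule lipschitz_onI)
      fix r r' :: real
      show "dist (tr (upper_cut a r)) (tr (upper_cut a r')) \<le> 1 * dist r r'"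
        using tr_upper_cut_lipschitz[OF a, of r r'] tr_upper_cut_lipschitz[OF a, of r' r]
        by (cases "r \<le> r'") (auto simp: dist_real_def)
    qed simp
  qed
  moreover have "t \<le> tr (upper_cut a t)"
    using tr_mono[OF upper_cut_ge_scalar[OF a, of t]] by (simp add: tr_simps)
  ultimately show ?thesis
    using IVT'[of "\<lambda>r. tr (upper_cut a r)" 0 t t] t t0 by (auto simp: upper_cut_0)
qed

lemma mu_upper_cut_le:
  assumes a: "pos a" and r: "r \<ge> 0" and t: "tr (E a r) \<le> t"
  shows "mu (upper_cut a r) t \<le> r"
proof -
  define q where "q = 1 - E a r"
  have q: "proj q" unfolding q_def by (rule proj_compl[OF E_proj[OF a]])
  have p: "E a r * E a r = E a r" using projD[OF E_proj[OF a]] by simp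
  have "mu (upper_cut a r) t \<le> norm (upper_cut a r * q)" by (rule mu_le[OF q]) (simp add: q_def t)
  also have "upper_cut a r * q = r *\<^sub>R q"
    by (simp add: upper_cut_def q_def algebra_simps mult.assoc p)
  also have "norm (r *\<^sub>R q) \<le> r" using norm_proj_le[OF q] r by (simp add: mult_left_le)
  finally show ?thesis .
qed

lemma mu_ge_scalar:
  assumes c: "pos c" and cr: "pos (c - r *\<^sub>R 1)" and t: "0 \<le> t" "t < 1"
  shows "r \<le> mu c t"
proof (rule dense_le)
  fix s assume s: "s < r"
  define q where "q = 1 - E c s"
  have q: "proj q" unfolding q_def by (rule proj_compl[OF E_proj[OF c]])
  have qc: "q * c = c * q" using E_commute[OF c, of c s] by (simp add: q_def algebra_simps)
  have "q = 0"
  proof (rule sproj_separate[OF q pos_star[OF c] qc _ _ s])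
    have "pos ((c - r *\<^sub>R 1) * q)" by (rule pos_comm_mult[OF cr pos_proj[OF q]]) (simp add: algebra_simps qc)
    then show "pos (c * q - r *\<^sub>R q)" by (simp add: algebra_simps)
    show "pos (s *\<^sub>R q - c * q)" unfolding q_def by (rule E_le[OF c])
  qed
  then have "E c s = 1" by (simp add: q_def)
  then show "s \<le> mu c t" using t by (intro mu_ge_E[OF c]) auto
qed

text \<open>Take \<open>s > mu a t\<close>; the hypothesis on \<open>t\<close> forces
  \<open>s \<ge> r\<close>. Off \<open>E a s\<close>, \<open>max a r\<close> consists of a slab of
  \<open>a\<close> below \<open>s\<close> and the constant \<open>r\<close>, so the projection
  showing that \<open>mu a t\<close> is small serves the cut element too.\<close>

lemma mu_upper_cut_le_mu:
  assumes a: "pos a" and r: "r \<ge> 0" and t: "0 \<le> t" "t < tr (E a r)"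
  shows "mu (upper_cut a r) t \<le> mu a t"
proof (rule dense_ge)
  fix s assume s: "mu a t < s"
  then have rs: "r \<le> s" using mu_ge_E[OF a t] by simp
  define p where "p = E a r" define q where "q = E a s"
  have p: "proj p" and q: "proj q" unfolding p_def q_def by (rule E_proj[OF a])+
  have pq: "p * q = q" using proj_le_mult[OF q p] E_antimono[OF a rs] by (simp add: p_def q_def)
  let ?x = "upper_cut a r * (1 - q)"
  have x: "?x = a * (p - q) + r *\<^sub>R (1 - p)"
    by (simp add: upper_cut_def p_def[symmetric] algebra_simps mult.assoc pq)
  have "pos (upper_cut a r * (1 - q))"
  proof (rule pos_comm_mult[OF pos_upper_cut[OF a] pos_1_proj[OF q]])
    have "a * q = q * a" unfolding q_def using E_commute[OF a, of a s] by simp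
    then show "upper_cut a r * (1 - q) = (1 - q) * upper_cut a r"
      using upper_cut_commute[OF a, of q r] by (simp add: algebra_simps)
  qed
  moreover have "pos (s *\<^sub>R q + (s *\<^sub>R (p - q) - a * (p - q)) + (s - r) *\<^sub>R (1 - p))"
    unfolding p_def q_def using rs r
    by (intro pos_add pos_scaleR E_between(2)[OF a rs] pos_proj pos_1_proj E_proj[OF a]) auto
  then have "pos (s *\<^sub>R 1 - ?x)" unfolding x by (simp add: algebra_simps)
  ultimately have "norm ?x \<le> s" using norm_le_of_pos' rs r by simp
  moreover have "mu (upper_cut a r) t \<le> norm ?x"
    by (rule mu_le[OF proj_compl[OF q]]) (use tr_E_le_of_mu[OF a t(1) s] in \<open>simp add: q_def\<close>)
  ultimately show "mu (upper_cut a r) t \<le> s" by simp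
qed

text \<open>Beyond \<open>d = tr (E a r)\<close> the comparison depends on the value of
  \<open>mu b\<close> at \<open>s\<close>. If it is at least \<open>r\<close>, so is
  \<open>mu b\<close> on all of \<open>{d..s}\<close>, and one integrates forward from
  \<open>d\<close>. Otherwise \<open>mu b \<le> r \<le> mu c\<close> on \<open>{s..1}\<close> up to
  the endpoint, and one integrates backward from 1, where the totals agree.\<close>

lemma weak_maj_upper_cut:
  assumes a: "pos a" and b: "pos b" and wm: "weak_maj star \<tau> a b" and r: "r \<ge> 0"
    and trc: "tr (upper_cut a r) = tr b"
  shows "weak_maj star \<tau> (upper_cut a r) b"
proof -
  define c where "c = upper_cut a r"
  define d where "d = tr (E a r)"
  have c: "pos c" unfolding c_def by (rule pos_upper_cut[OF a])
  have d: "0 \<le> d" "d \<le> 1" unfolding d_def using tr_pos[OF pos_proj[OF E_proj[OF a]]] tr_proj_le[OF E_proj[OF a]] by auto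
  have tot: "integral {0..1} (mu c) = integral {0..1} (mu b)"
    using tr_eq_integral_mu[OF b] tr_eq_integral_mu[OF c] trc by (simp add: c_def)
  have low: "integral {0..s} (mu c) \<le> integral {0..s} (mu b)" if s: "0 \<le> s" "s \<le> d" for s
  proof -
    have "integral {0..s} (mu c) \<le> integral {0..s} (mu a)"
      by (rule integral_le_except_point[where p=d])
        (use s in \<open>auto intro!: mu_integrable mu_upper_cut_le_mu[OF a r] simp: c_def d_def\<close>)
    also have "\<dots> \<le> integral {0..s} (mu b)" using wm s by (simp add: weak_maj_def)
    finally show ?thesis .
  qed
  have high: "integral {0..s} (mu c) \<le> integral {0..s} (mu b)" if s: "d \<le> s" "s \<le> 1" for s
  proof (cases "mu b s \<ge> r")
    case True
    have "integral {d..s} (mu c) \<le> integral {d..s} (\<lambda>t. r)"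
      by (rule integral_le) (use d in \<open>auto intro!: mu_integrable mu_upper_cut_le[OF a r] simp: c_def d_def\<close>)
    also have "\<dots> \<le> integral {d..s} (mu b)"
    proof (rule integral_le)
      fix t assume "t \<in> {d..s}"
      then show "r \<le> mu b t" using mu_antimono[of t s b] True d by simp
    qed (use d in \<open>auto intro!: mu_integrable\<close>)
    finally show ?thesis
      using low[OF d(1) order_refl] integral_mu_combine[OF d(1) s(1)] by simp
  next
    case False
    have s0: "0 \<le> s" using d s by simp
    have "integral {s..1} (mu b) \<le> integral {s..1} (\<lambda>t. r)"
    proof (rule integral_le)
      fix t assume "t \<in> {s..1}"
      then show "mu b t \<le> r" using mu_antimono[of s t b] False s0 by simp
    qed (use s0 in \<open>auto intro!: mu_integrable\<close>)
    \<comment> \<open>The endpoint 1 is excluded: \<open>mu c\<close> is at least \<open>r\<close>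
      before it and vanishes at it.\<close>
    also have "\<dots> \<le> integral {s..1} (mu c)"
      by (rule integral_le_except_point[where p=1])
        (use s0 in \<open>auto intro!: mu_integrable mu_ge_scalar[OF c] upper_cut_ge_scalar[OF a, of r, folded c_def]\<close>)
    finally show ?thesis using tot integral_mu_combine[OF s0 s(2)] by simp
  qed
  show ?thesis
    unfolding weak_maj_def c_def[symmetric]
  proof (intro allI impI)
    fix s :: real assume "0 \<le> s"
    then consider "s \<le> d" | "d \<le> s" "s \<le> 1" | "1 \<le> s" by linarith
    then show "integral {0..s} (mu c) \<le> integral {0..s} (mu b)"
      using low high \<open>0 \<le> s\<close> integral_mu_ge_1[of s] tot by cases auto
  qed
qed

lemma weak_maj_imp_maj_above:
  assumes a: "pos a" and b: "pos b" and wm: "weak_maj star \<tau> a b"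
  shows "\<exists>c. pos c \<and> pos (c - a) \<and> maj star \<tau> c b \<and> c * a = a * c"
proof -
  have "tr a \<le> tr b"
    using wm tr_eq_integral_mu[OF a] tr_eq_integral_mu[OF b] by (simp add: weak_maj_def)
  then obtain r where r: "r \<ge> 0" "tr (upper_cut a r) = tr b" using exists_upper_cut[OF a] by blast
  show ?thesis
  proof (intro exI conjI)
    show "maj star \<tau> (upper_cut a r) b"
      unfolding maj_def using weak_maj_upper_cut[OF a b wm r] r(2)
      by (simp add: tau_eq_tr[OF b] tau_eq_tr[OF pos_upper_cut[OF a]])
    show "upper_cut a r * a = a * upper_cut a r" using upper_cut_commute[OF a, of a r] by simp
  qed (use a in \<open>auto intro: pos_upper_cut upper_cut_ge\<close>)
qed

lemma maj_above_imp_weak_maj: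
  assumes a: "pos a" and ac: "pos (c - a)" and m: "maj star \<tau> c b"
  shows "weak_maj star \<tau> a b"
  unfolding weak_maj_def
proof (intro allI impI)
  fix s :: real assume s: "0 \<le> s"
  have "integral {0..s} (mu a) \<le> integral {0..s} (mu c)"
    by (rule integral_le) (auto intro!: mu_integrable mu_mono[OF a ac])
  also have "\<dots> \<le> integral {0..s} (mu b)" using m s by (simp add: maj_def weak_maj_def)
  finally show "integral {0..s} (mu a) \<le> integral {0..s} (mu b)" .
qed

section \<open>Equivalence of projections\<close>

lemma proj_tconv:
  assumes "\<And>n. proj (X n)" "tconv X s" shows "proj s"
proof -
  have "tconv (\<lambda>n. X n * X n) (s * s)"
    by (rule tconv_mult[OF assms(2,2)]) (use norm_proj_le[OF assms(1)] in auto)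
  then have "tconv X (s * s)" by (simp add: projD[OF assms(1)])
  then have "s * s = s" using assms(2) by (rule tconv_unique)
  moreover have "tconv X (star s)" using tconv_star[OF assms(2)] by (simp add: projD[OF assms(1)])
  then have "star s = s" using assms(2) by (rule tconv_unique)
  ultimately show ?thesis by (simp add: is_projection_def)
qed

lemma increasing_proj_tconv:
  assumes pr: "\<And>n. proj (X n)" and inc: "\<And>n. pos (X (Suc n) - X n)"
  obtains s where "proj s" "tconv X s" "\<And>n. pos (s - X n)"
proof -
  obtain s where s: "tconv X s" "\<And>n. positive star (s - X n)"
    by (rule increasing_tconv[of X 1]) (use pr inc projD norm_proj_le in auto)
  show thesis using that[OF proj_tconv[OF pr s(1)] s(1)] s(2) by (simp add: positive_eq_pos)
qed

lemma proj_add: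
  assumes "proj p" "proj q" "p * q = 0" shows "proj (p + q)"
proof -
  have "star (p * q) = 0" using assms(3) by simp
  then have "q * p = 0" using projD[OF assms(1)] projD[OF assms(2)] by (simp add: star_simps)
  then show ?thesis using assms projD[OF assms(1)] projD[OF assms(2)]
    by (simp add: is_projection_def star_simps algebra_simps)
qed

lemma central_proj_trivial:
  assumes z: "proj z" and c: "\<And>y. z * y = y * z"
  shows "z = 0 \<or> z = 1"
proof -
  obtain w where "z = cscale j w 1" using trivial_center c by blast
  then have zw: "z = Re w *\<^sub>R 1 + Im w *\<^sub>R j" by (simp add: cscale_def)
  have "star z = Re w *\<^sub>R 1 - Im w *\<^sub>R j" unfolding zw by (simp add: star_simps star_j)
  then have "Im w *\<^sub>R j + Im w *\<^sub>R j = 0"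
    using projD(1)[OF z] zw by (simp add: algebra_simps)
  then have "2 *\<^sub>R (Im w *\<^sub>R j) = 0" by (simp only: scaleR_2)
  then have "Im w *\<^sub>R j = 0" by simp
  then have zr: "z = Re w *\<^sub>R 1" using zw by simp
  then have "(Re w * Re w) *\<^sub>R (1::'a) = Re w *\<^sub>R 1" using projD(2)[OF z] by simp
  then have "Re w = 0 \<or> Re w = 1" by simp
  then show ?thesis using zr by auto
qed

text \<open>If every \<open>q * y * p\<close> vanished, the two-sided ideal \<open>I\<close> would
  contain \<open>q\<close> but not 1. Its largest projection \<open>z\<close> is a left unit of
  \<open>I\<close>; since \<open>y * z\<close> lies in \<open>I\<close>,
  \<open>z * y * z = y * z\<close>, and adjoints make \<open>z\<close> central.\<close>

lemma factor_connect:
  assumes p: "proj p" "p \<noteq> 0" and q: "proj q" "q \<noteq> 0"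
  shows "\<exists>y. q * y * p \<noteq> 0"
proof (rule ccontr)
  assume "\<not> (\<exists>y. q * y * p \<noteq> 0)"
  then have qyp: "q * y * p = 0" for y by blast
  define I where "I = {x. \<forall>y. p * y * x = 0}"
  have qI: "q \<in> I"
  proof -
    have "p * y * q = star (q * star y * p)" for y by (simp add: star_simps projD p q mult.assoc)
    then show ?thesis by (simp add: I_def qyp)
  qed
  obtain z where z: "z \<in> {z \<in> I. proj z}" "\<And>y. y \<in> {z \<in> I. proj z} \<Longrightarrow> pos (y - z) \<Longrightarrow> tr y \<le> tr z"
  proof (rule maximal_by_measure[of 0 "{z \<in> I. proj z}" "\<lambda>x y. pos (y - x)" tr 1])
    fix X assume X: "\<And>n. X n \<in> {z \<in> I. proj z}" "\<And>n. pos (X (Suc n) - X n)"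
    then obtain s where s: "proj s" "tconv X s" "\<And>n. pos (s - X n)"
      using increasing_proj_tconv[of X] by blast
    have "p * y * s = 0" for y
    proof (rule tconv_unique[OF tconv_mult_left[OF s(2)]])
      show "tconv (\<lambda>n. p * y * X n) 0" using X(1) by (simp add: I_def tconv_const)
    qed
    then show "\<exists>u\<in>{z \<in> I. proj z}. \<forall>n. pos (u - X n)" using s by (auto simp: I_def)
  qed (auto simp: I_def intro: tr_mono tr_proj_le pos_trans)
  have zp: "proj z" and zI: "z \<in> I" using z(1) by auto
  have zx: "z * x = x" if x: "x \<in> I" for x
  proof -
    \<comment> \<open>The support of \<open>x' * star x'\<close> lies in \<open>I\<close> and is
      orthogonal to \<open>z\<close>. Adding it to \<open>z\<close> would exceed the maximal trace
      unless it is zero.\<close>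
    define x' where "x' = (1 - z) * x"
    have x': "p * y * x' = 0" for y
    proof -
      have "p * y * x' = p * (y * (1 - z)) * x" by (simp add: x'_def mult.assoc)
      then show ?thesis using x by (simp add: I_def)
    qed
    have "pos (x' * star x')" using pos_star_mult[of "star x'"] by simp
    then obtain s where s: "proj s" "(x' * star x') * s = x' * star x'" "\<And>w. (x' * star x') * w = 0 \<Longrightarrow> s * w = 0"
      using support_exists by blast
    have "s * star (p * y) = 0" for y
    proof (rule s(3))
      have "(x' * star x') * star (p * y) = star (p * y * x' * star x')" by (simp add: star_simps mult.assoc)
      then show "(x' * star x') * star (p * y) = 0" by (simp add: x')
    qed
    then have "star (s * star (p * y)) = 0" for y by simp
    then have sI: "s \<in> I" by (simp add: I_def star_mult projD[OF s(1)])
    have "star x' * z = 0" by (simp add: x'_def star_simps projD[OF zp] algebra_simps)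
    then have "s * z = 0" by (intro s(3)) (simp add: mult.assoc)
    then have "proj (s + z)" by (rule proj_add[OF s(1) zp])
    moreover have "s + z \<in> I" using sI zI by (simp add: I_def algebra_simps)
    ultimately have "tr s \<le> 0" using z(2)[of "s + z"] pos_proj[OF s(1)] by (simp add: tr_simps)
    then have "s = 0" using tr_pos[OF pos_proj[OF s(1)]] tr_pos_eq_0[OF pos_proj[OF s(1)]] by simp
    then have "x' * star x' = 0" using s(2) by simp
    then have "x' = 0" using star_mult_eq_0[of "star x'"] by (metis star_star star_0)
    then show ?thesis by (simp add: x'_def algebra_simps)
  qed
  have 1: "z * y * z = y * z" for y
  proof -
    have "p * w * (y * z) = p * (w * y) * z" for w by (simp add: mult.assoc)
    then have "y * z \<in> I" using zI by (simp add: I_def)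
    then show ?thesis using zx by (simp add: mult.assoc)
  qed
  have "z * y = y * z" for y
  proof -
    have "star (z * star y * z) = star (star y * z)" by (simp only: 1)
    then have "z * y * z = z * y" by (simp add: star_simps projD[OF zp] mult.assoc)
    then show ?thesis using 1 by simp
  qed
  then have "z = 0 \<or> z = 1" by (rule central_proj_trivial[OF zp])
  moreover have "z \<noteq> 0" using zx[OF qI] q(2) by auto
  moreover have "z \<noteq> 1"
  proof
    assume "z = 1"
    then have "p * 1 * 1 = 0" using zI unfolding I_def by blast
    then show False using p(2) by simp
  qed
  ultimately show False by blast
qed

section \<open>Partial isometries and their extensions\<close>

lemma partial_isometry_mult:
  assumes "proj (star v * v)" shows "v * (star v * v) = v"
proof -
  define e where "e = star v * v"
  have e: "e * e = e" "star e = e" using projD[OF assms] by (auto simp: e_def)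
  have "star (v * (1 - e)) * (v * (1 - e)) = (1 - e) * (e * (1 - e))"
    by (simp only: star_mult mult.assoc e_def) (simp add: star_simps)
  also have "e * (1 - e) = 0" using e by (simp add: algebra_simps)
  finally have "star (v * (1 - e)) * (v * (1 - e)) = 0" by simp
  then have "v * (1 - e) = 0" by (rule star_mult_eq_0[THEN iffD1])
  then show ?thesis by (simp add: e_def algebra_simps)
qed

lemma partial_isometry_range:
  assumes "proj (star v * v)" shows "proj (v * star v)"
  using partial_isometry_mult[OF assms]
  by (simp add: is_projection_def star_simps) (metis mult.assoc)

text \<open>A non-zero \<open>x = q * y * p\<close> is divided by its absolute value where
  \<open>h = star x * x\<close> is at least half its norm. That spectral projection is non-zero, as
  otherwise \<open>h\<close> would be bounded by half its own norm.\<close>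

lemma nonzero_partial_isometry:
  assumes p: "proj p" "p \<noteq> 0" and q: "proj q" "q \<noteq> 0"
  obtains w where "w \<noteq> 0" "proj (star w * w)" "w * p = w" "q * w = w"
proof -
  obtain y where "q * y * p \<noteq> 0" using factor_connect[OF assms] by blast
  define x where "x = q * y * p"
  have x0: "x \<noteq> 0" using \<open>q * y * p \<noteq> 0\<close> by (simp add: x_def)
  have xp: "x * p = x" and qx: "q * x = x" using projD[OF p(1)] projD[OF q(1)]
    unfolding x_def by (metis mult.assoc)+
  define h where "h = star x * x"
  have h: "pos h" unfolding h_def by (rule pos_star_mult)
  have h0: "h \<noteq> 0" using x0 by (simp add: h_def star_mult_eq_0)
  define r where "r = norm h / 2"
  have r: "r > 0" using h0 by (simp add: r_def)
  define e where "e = E h r"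
  note e = E_props[where r=r, OF h, folded e_def]
  have e0: "e \<noteq> 0"
  proof
    assume "e = 0"
    then have "pos (r *\<^sub>R 1 - h)" using e(4) by simp
    then have "norm h \<le> r" using norm_le_of_pos'[OF h] r by simp
    then show False using h0 by (simp add: r_def)
  qed
  have eh: "e * h = h * e" using e(2)[of h] by simp
  obtain g where g: "star (x * g) * (x * g) = e" "e * g = g" "star g = g" "g * g * h = e"
    using partial_isometry_of_corner[OF e(1), of x r] eh e(3) r unfolding h_def by metis
  have ge: "g * e = g" using g(2,3) projD[OF e(1)] by (metis star_mult)
  have "h * p = h" by (simp add: h_def mult.assoc xp)
  then have gp: "g * p = g" using g(4) ge by (metis mult.assoc)
  show thesis
  proof
    show "x * g \<noteq> 0" using g(1) e0 by auto
    show "proj (star (x * g) * (x * g))" using g(1) e(1) by simp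
    show "x * g * p = x * g" using gp by (simp add: mult.assoc)
    show "q * (x * g) = x * g" using qx by (simp flip: mult.assoc)
  qed
qed

text \<open>\<open>v'\<close> extends \<open>v\<close>. Initial and final projections are included
  as equations, so that transitivity and passage to limits are pure algebra.\<close>

definition piso_le :: "'a \<Rightarrow> 'a \<Rightarrow> bool" where
  "piso_le v v' \<longleftrightarrow> v' * (star v * v) = v \<and> (v * star v) * v' = v
     \<and> (star v' * v') * (star v * v) = star v * v \<and> (v' * star v') * (v * star v) = v * star v"

lemma piso_leD:
  assumes v: "proj (star v * v)" and v': "proj (star v' * v')" and le: "piso_le v v'"
  shows "(star v * v) * (star v' * v') = star v * v" "(v * star v) * (v' * star v') = v * star v"
    "pos (star v' * v' - star v * v)" "pos (v' * star v' - v * star v)"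
proof -
  note r = partial_isometry_range[OF v] partial_isometry_range[OF v']
  have "star ((star v' * v') * (star v * v)) = star (star v * v)" using le by (simp add: piso_le_def)
  then show 1: "(star v * v) * (star v' * v') = star v * v"
    using projD[OF v] projD[OF v'] by (simp only: star_mult[of "star v' * v'"])
  have "star ((v' * star v') * (v * star v)) = star (v * star v)" using le by (simp add: piso_le_def)
  then show 2: "(v * star v) * (v' * star v') = v * star v"
    using projD[OF r(1)] projD[OF r(2)] by (simp only: star_mult[of "v' * star v'"])
  show "pos (star v' * v' - star v * v)" using proj_le_iff[OF v v'] 1 by simp
  show "pos (v' * star v' - v * star v)" using proj_le_iff[OF r] 2 by simp
qed

lemma piso_le_refl: "proj (star v * v) \<Longrightarrow> piso_le v v"
  using partial_isometry_mult[of v] projD[of "star v * v"] projD(2)[OF partial_isometry_range[of v]]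
  by (simp add: piso_le_def mult.assoc)

lemma piso_le_trans:
  assumes v: "proj (star v * v)" and v': "proj (star v' * v')" and v'': "proj (star v'' * v'')"
    and le: "piso_le v v'" "piso_le v' v''"
  shows "piso_le v v''"
proof -
  define e where "e = star v * v" define f where "f = v * star v"
  define e' where "e' = star v' * v'" define f' where "f' = v' * star v'"
  define e'' where "e'' = star v'' * v''" define f'' where "f'' = v'' * star v''"
  have 1: "v' * e = v" "f * v' = v" "e' * e = e" "f' * f = f"
    using le(1) by (auto simp: piso_le_def e_def f_def e'_def f'_def)
  have 2: "v'' * e' = v'" "f' * v'' = v'" "e'' * e' = e'" "f'' * f' = f'"
    using le(2) by (auto simp: piso_le_def e''_def f''_def e'_def f'_def)
  have 3: "f * f' = f" using piso_leD(2)[OF v v' le(1)] by (simp add: f_def f'_def)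
  have "v'' * e = v" "f * v'' = v" "e'' * e = e" "f'' * f = f"
    using 1 2 3 by (metis mult.assoc)+
  then show ?thesis by (simp add: piso_le_def e_def f_def e''_def f''_def)
qed

text \<open>For a partial isometry \<open>u\<close> and a scalar \<open>c\<close> of modulus one,
  \<open>u\<^sup>* u + u u\<^sup>* + c u\<^sup>* + c\<^sup>* u\<close> is the square of \<open>u\<^sup>* u + c u\<^sup>*\<close>. These elements increase
  along \<open>piso_le\<close>, so monotone completeness gives limits of increasing partial isometries.\<close>

lemma pos_polarization:
  assumes "proj (star u * u)"
  shows "pos (star u * u + u * star u + (u + star u))"
    and "pos (star u * u + u * star u + (j * star u - j * u))"
proof -
  define p where "p = star u * u"
  have p: "p * p = p" "star p = p" using projD[OF assms] by (auto simp: p_def)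
  have up: "u * p = u" using partial_isometry_mult[OF assms] by (simp add: p_def)
  then have "star (u * p) = star u" by simp
  then have pu: "p * star u = star u" by (simp add: star_mult p)
  have "star (p + star u) * (p + star u) = p + u * star u + (u + star u)"
    by (simp add: star_simps p algebra_simps up pu)
  then show "pos (star u * u + u * star u + (u + star u))" using pos_star_mult p_def by metis
  have "star (p + j * star u) * (p + j * star u) = p + u * star u + (j * star u - j * u)"
    by (simp add: star_simps p algebra_simps up pu j_mult_mult[of p] j_mult_mult[of u] j_mult_j mult.assoc)
  then show "pos (star u * u + u * star u + (j * star u - j * u))" using pos_star_mult p_def by metis
qed

text \<open>The increment is again a partial isometry, between the increments of the initial and
  final projections, so \<open>pos_polarization\<close> applies to each step of an increasing
  sequence.\<close>

lemma piso_diff: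
  assumes v: "proj (star v * v)" and v': "proj (star v' * v')" and le: "piso_le v v'"
  shows "star (v' - v) * (v' - v) = star v' * v' - star v * v"
    and "(v' - v) * star (v' - v) = v' * star v' - v * star v"
proof -
  have 1: "v' * (star v * v) = v" "(v * star v) * v' = v" using le by (auto simp: piso_le_def)
  have vv: "v * (star v * v) = v" by (rule partial_isometry_mult[OF v])
  then have sv: "star v * (v * star v) = star v" by (metis star_mult star_star mult.assoc)
  have a: "star v * v' = star v * v" using sv 1(2) by (metis mult.assoc)
  have b: "v' * star v = v * star v" using sv 1(1) by (metis mult.assoc)
  have a': "star v' * v = star v * v" using a by (metis star_mult star_star)
  have b': "v * star v' = v * star v" using b by (metis star_mult star_star)
  show "star (v' - v) * (v' - v) = star v' * v' - star v * v"
    by (simp add: star_simps algebra_simps a a')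
  show "(v' - v) * star (v' - v) = v' * star v' - v * star v"
    by (simp add: star_simps algebra_simps b b')
qed

lemma tconv_shift: "tconv X x \<Longrightarrow> tconv (\<lambda>n. X (n + m)) x"
  unfolding tconv_def by (rule LIMSEQ_ignore_initial_segment)

lemma piso_seq_limit:
  assumes pr: "\<And>n. proj (star (X n) * X n)" and le: "\<And>n. piso_le (X n) (X (Suc n))"
  obtains v where "proj (star v * v)" "tconv X v" "\<And>n. piso_le (X n) v"
proof -
  define e where "e n = star (X n) * X n" for n
  define f where "f n = X n * star (X n)" for n
  have e: "proj (e n)" and f: "proj (f n)" for n
    using pr partial_isometry_range[OF pr] by (auto simp: e_def f_def)
  have nX: "norm (X n) \<le> 1" for n by (rule norm_partial_isometry[OF refl pr])
  have d: "star (X (Suc n) - X n) * (X (Suc n) - X n) = e (Suc n) - e n"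
       "(X (Suc n) - X n) * star (X (Suc n) - X n) = f (Suc n) - f n" for n
    using piso_diff[OF pr pr le] by (auto simp: e_def f_def)
  have einc: "pos (e (Suc n) - e n)" and finc: "pos (f (Suc n) - f n)" for n
    using piso_leD(3,4)[OF pr pr le] by (auto simp: e_def f_def)
  have pd: "proj (star (X (Suc n) - X n) * (X (Suc n) - X n))" for n
    unfolding d by (rule proj_diff[OF e e einc])
  note pol = pos_polarization[OF pd, unfolded d]
  obtain s where s: "proj s" "tconv e s" using increasing_proj_tconv[of e, OF e einc] .
  obtain t where t: "proj t" "tconv f t" using increasing_proj_tconv[of f, OF f finc] .
  have nb: "norm (e n + f n + c) \<le> 4" if "norm c \<le> 2" for n c
    using norm_triangle_ineq[of "e n + f n" c] norm_triangle_ineq[of "e n" "f n"] norm_proj_le[OF e, of n]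
      norm_proj_le[OF f, of n] that by linarith
  have sef: "star (e n) = e n" "star (f n) = f n" for n using projD(1)[OF e] projD(1)[OF f] by auto
  obtain A where A: "tconv (\<lambda>n. e n + f n + (X n + star (X n))) A"
  proof (rule increasing_tconv[of "\<lambda>n. e n + f n + (X n + star (X n))" 4])
    fix n
    show "pos (e (Suc n) + f (Suc n) + (X (Suc n) + star (X (Suc n))) - (e n + f n + (X n + star (X n))))"
      using pol(1)[of n] by (simp add: star_simps algebra_simps)
    show "norm (e n + f n + (X n + star (X n))) \<le> 4"
      using norm_triangle_ineq[of "X n" "star (X n)"] nX[of n] by (intro nb) simp
  qed (auto simp: star_simps sef)
  obtain B where B: "tconv (\<lambda>n. e n + f n + (j * star (X n) - j * X n)) B"
  proof (rule increasing_tconv[of "\<lambda>n. e n + f n + (j * star (X n) - j * X n)" 4])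
    fix n
    show "pos (e (Suc n) + f (Suc n) + (j * star (X (Suc n)) - j * X (Suc n)) - (e n + f n + (j * star (X n) - j * X n)))"
      using pol(2)[of n] by (simp add: star_simps algebra_simps)
    show "norm (e n + f n + (j * star (X n) - j * X n)) \<le> 4"
      using norm_triangle_ineq4[of "j * star (X n)" "j * X n"] nX[of n] by (intro nb) simp
  qed (auto simp: star_simps sef)
  have ef: "tconv (\<lambda>n. e n + f n) (s + t)" by (rule tconv_add[OF s(2) t(2)])
  have "tconv (\<lambda>n. X n + star (X n)) (A - (s + t))" using tconv_diff[OF A ef] by simp
  moreover have "tconv (\<lambda>n. j * star (X n) - j * X n) (B - (s + t))" using tconv_diff[OF B ef] by simp
  then have "tconv (\<lambda>n. j * (j * star (X n) - j * X n)) (j * (B - (s + t)))" by (rule tconv_j_mult)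
  \<comment> \<open>Multiplying the second combination by \<open>j\<close> gives
    \<open>X n - star (X n)\<close>, so half of the sum recovers \<open>X n\<close>.\<close>
  ultimately have "tconv (\<lambda>n. (1/2) *\<^sub>R ((X n + star (X n)) + j * (j * star (X n) - j * X n)))
     ((1/2) *\<^sub>R (A - (s + t) + j * (B - (s + t))))"
    by (intro tconv_scaleR tconv_add)
  moreover have "(1/2) *\<^sub>R ((X n + star (X n)) + j * (j * star (X n) - j * X n)) = X n" for n
    by (simp add: right_diff_distrib j_mult_j flip: scaleR_2)
  ultimately obtain v where v: "tconv X v" by auto
  have vv: "star v * v = s"
    by (rule tconv_unique[OF tconv_mult[OF tconv_star[OF v] v, of 1]]) (use nX s in \<open>auto simp: e_def[abs_def]\<close>)
  have vv': "v * star v = t"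
    by (rule tconv_unique[OF tconv_mult[OF v tconv_star[OF v], of 1]]) (use nX t in \<open>auto simp: f_def[abs_def]\<close>)
  have le': "piso_le (X m) (X (n + m))" for m n
  proof (induction n)
    case 0
    then show ?case using piso_le_refl[OF pr] by simp
  next
    case (Suc n)
    then show ?case using piso_le_trans[OF pr pr pr Suc le[of "n + m"]] by simp
  qed
  have "piso_le (X m) v" for m
  proof -
    have L: "X (n + m) * e m = X m" "f m * X (n + m) = X m" "e (n + m) * e m = e m" "f (n + m) * f m = f m" for n
      using le'[of m n] by (auto simp: piso_le_def e_def f_def)
    have "v * e m = X m" by (rule tconv_unique[OF tconv_mult_right[OF tconv_shift[OF v, of m]]]) (simp add: L tconv_const)
    moreover have "f m * v = X m" by (rule tconv_unique[OF tconv_mult_left[OF tconv_shift[OF v, of m]]]) (simp add: L tconv_const)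
    moreover have "s * e m = e m" by (rule tconv_unique[OF tconv_mult_right[OF tconv_shift[OF s(2), of m]]]) (simp add: L tconv_const)
    moreover have "t * f m = f m" by (rule tconv_unique[OF tconv_mult_right[OF tconv_shift[OF t(2), of m]]]) (simp add: L tconv_const)
    ultimately show ?thesis by (simp add: piso_le_def vv vv' e_def f_def)
  qed
  then show thesis using that[OF _ v] s(1) unfolding vv by blast
qed

text \<open>Take a partial isometry from under \<open>p\<close> to under \<open>q\<close> whose
  initial trace no extension exceeds. A remainder of \<open>p\<close> would, by equality of traces,
  come with a remainder of \<open>q\<close>, and a non-zero partial isometry between the two would
  extend \<open>v\<close> with larger trace.\<close>

lemma proj_equivalent:
  assumes p: "proj p" and q: "proj q" and tr: "tr p = tr q"
  shows "\<exists>v. star v * v = p \<and> v * star v = q"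
proof -
  define S where "S = {v. proj (star v * v) \<and> v * p = v \<and> q * v = v}"
  obtain v where v: "v \<in> S" and max: "\<And>y. y \<in> S \<Longrightarrow> piso_le v y \<Longrightarrow> tr (star y * y) \<le> tr (star v * v)"
  proof (rule maximal_by_measure[of 0 S piso_le "\<lambda>v. tr (star v * v)" 1])
    fix X assume X: "\<And>n. X n \<in> S" "\<And>n. piso_le (X n) (X (Suc n))"
    obtain u where u: "proj (star u * u)" "tconv X u" "\<And>n. piso_le (X n) u"
      by (rule piso_seq_limit[of X]) (use X in \<open>auto simp: S_def\<close>)
    have "u * p = u"
      by (rule tconv_unique[OF tconv_mult_right[OF u(2)]]) (use X(1) u(2) in \<open>simp add: S_def\<close>)
    moreover have "q * u = u"
      by (rule tconv_unique[OF tconv_mult_left[OF u(2)]]) (use X(1) u(2) in \<open>simp add: S_def\<close>)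
    ultimately show "\<exists>u\<in>S. \<forall>n. piso_le (X n) u" using u by (auto simp: S_def)
  next
    fix x y assume "x \<in> S" "y \<in> S" "piso_le x y"
    then show "tr (star x * x) \<le> tr (star y * y)" using piso_leD(3) by (intro tr_mono) (auto simp: S_def)
  qed (auto simp: S_def intro: piso_le_refl piso_le_trans tr_proj_le)
  define e where "e = star v * v" define f where "f = v * star v"
  have pv: "proj (star v * v)" and vp: "v * p = v" and qv: "q * v = v" using v by (auto simp: S_def)
  have e: "proj e" and f: "proj f" unfolding e_def f_def using pv partial_isometry_range by auto
  have ve: "v * e = v" unfolding e_def by (rule partial_isometry_mult[OF pv])
  have fv: "f * v = v" using ve by (simp add: f_def e_def mult.assoc)
  have "star (v * p) = star v" "star (q * v) = star v" "star (v * e) = star v" "star (f * v) = star v"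
    by (simp_all add: vp qv ve fv)
  then have svp: "p * star v = star v" and svq: "star v * q = star v"
    and sve: "e * star v = star v" and svf: "star v * f = star v"
    by (simp_all add: star_mult projD p q e f)
  have ep: "e * p = e" by (simp add: e_def mult.assoc vp)
  have fq: "f * q = f" by (simp add: f_def mult.assoc svq)
  have pe: "pos (p - e)" and qf: "pos (q - f)" using proj_le_iff e f p q ep fq by auto
  have ee: "e * e = e" "p * e = e" "f * f = f" "q * f = f"
    using projD[OF e] projD[OF f] proj_le_mult[OF e p pe] proj_le_mult[OF f q qf] by auto
  have tref: "tr e = tr f" unfolding e_def f_def by (rule tr_comm)
  have "p - e = 0"
  proof (rule ccontr)
    assume 1: "p - e \<noteq> 0"
    then have "tr (p - e) \<noteq> 0" using tr_pos_eq_0[OF pe] by blast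
    then have 2: "q - f \<noteq> 0" using tr tref by (auto simp: tr_simps)
    obtain w where w: "w \<noteq> 0" "proj (star w * w)" "w * (p - e) = w" "(q - f) * w = w"
      using nonzero_partial_isometry[OF proj_diff[OF e p pe] 1 proj_diff[OF f q qf] 2] .
    have z: "(p - e) * e = 0" "f * (q - f) = 0" "(p - e) * p = p - e" "q * (q - f) = q - f"
      using ee ep fq projD(2)[OF p] projD(2)[OF q] by (simp_all add: left_diff_distrib right_diff_distrib)
    have we: "w * e = 0" using w(3) z(1) by (metis mult.assoc mult_zero_right)
    have wp: "w * p = w" using w(3) z(3) by (metis mult.assoc)
    have fw: "f * w = 0" using w(4) z(2) by (metis mult.assoc mult_zero_left)
    have qw: "q * w = w" using w(4) z(4) by (metis mult.assoc)
    have "star (w * e) = 0" "star (f * w) = 0" by (simp_all add: we fw)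
    then have ew': "e * star w = 0" and wf': "star w * f = 0" by (simp_all add: star_mult projD e f)
    have vw: "star v * w = 0" using svf fw by (metis mult.assoc mult_zero_right)
    have wv: "w * star v = 0" using sve we by (metis mult.assoc mult_zero_left)
    have wv': "star w * v = 0" "v * star w = 0" using vw wv by (metis star_mult star_star star_0)+
    define y where "y = v + w"
    have yy: "star y * y = e + star w * w" by (simp add: y_def star_simps algebra_simps vw wv' e_def)
    have yy': "y * star y = f + w * star w" by (simp add: y_def star_simps algebra_simps wv wv' f_def)
    have "e * (star w * w) = 0" by (simp add: ew' flip: mult.assoc)
    then have "proj (star y * y)" unfolding yy by (rule proj_add[OF e w(2)])
    then have "y \<in> S" by (simp add: S_def y_def distrib_right distrib_left vp wp qv qw)
    moreover have "piso_le v y"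
      unfolding piso_le_def yy yy' e_def[symmetric] f_def[symmetric]
      by (simp add: y_def distrib_left distrib_right ve we fv fw ee mult.assoc wf')
    ultimately have "tr (star y * y) \<le> tr (star v * v)" by (rule max)
    then have "tr (star w * w) \<le> 0" unfolding yy by (simp add: e_def tr_simps)
    then show False using tr_star_mult_nonneg[of w] tr_star_mult_eq_0[of w] w(1) by simp
  qed
  then have pe': "e = p" by simp
  then have "tr (q - f) = 0" using tr tref by (simp add: tr_simps)
  then have "q - f = 0" by (rule tr_pos_eq_0[OF qf])
  then show ?thesis using pe' by (auto simp: e_def f_def)
qed

text \<open>Consecutive differences of each chain are orthogonal blocks adding up to 1. Summing
  partial isometries between corresponding blocks gives one unitary that carries all members of the
  chain simultaneously.\<close>

lemma chain_unitary_equivalent: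
  fixes A B :: "nat \<Rightarrow> 'a"
  assumes A: "\<And>k. proj (A k)" "\<And>k. pos (A k - A (Suc k))" "A 0 = 1" "A (Suc n) = 0"
    and B: "\<And>k. proj (B k)" "\<And>k. pos (B k - B (Suc k))" "B 0 = 1" "B (Suc n) = 0"
    and tr: "\<And>k. tr (A k) = tr (B k)"
  obtains u where "unitary u" "\<And>k. u * A k * star u = B k"
proof -
  have dec: "pos (C i - C (i + k))" if "\<And>k. pos (C k - C (Suc k))" for C :: "nat \<Rightarrow> 'a" and i k
  proof (induction k)
    case (Suc k)
    then show ?case using pos_trans[OF that[of "i + k"] Suc] by simp
  qed simp
  have mult_le: "C m * C k = C k" "C k * C m = C k"
    if "\<And>k. proj (C k)" "\<And>k. pos (C k - C (Suc k))" "m \<le> k" for C :: "nat \<Rightarrow> 'a" and k m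
    using proj_le_mult[of "C k" "C m"] that(1) dec[of C m "k - m", OF that(2)] that(3) by auto
  note MLA = mult_le[of A, OF A(1,2)] and MLB = mult_le[of B, OF B(1,2)]
  define D where "D k = A k - A (Suc k)" for k
  define D' where "D' k = B k - B (Suc k)" for k
  have "\<exists>v. star v * v = D k \<and> v * star v = D' k" for k
    unfolding D_def D'_def
    by (rule proj_equivalent) (use A B tr in \<open>auto intro!: proj_diff simp: tr_simps\<close>)
  then obtain v where v: "\<And>k. star (v k) * v k = D k" "\<And>k. v k * star (v k) = D' k" by metis
  have pD: "proj (star (v k) * v k)" for k unfolding v(1) D_def by (rule proj_diff[OF A(1,1,2)])
  have vD: "v k * D k = v k" for k using partial_isometry_mult[OF pD] by (simp add: v(1))
  have Dv: "D' k * v k = v k" for k using vD[of k] by (simp add: mult.assoc flip: v)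
  have DA: "D k * A m = (if m \<le> k then D k else 0)" for k m
    using MLA[of m k] MLA[of m "Suc k"] MLA[of k m]
      MLA[of "Suc k" m] by (auto simp: D_def algebra_simps not_less_eq_eq)
  have BD: "B m * D' k = (if m \<le> k then D' k else 0)" for k m
    using MLB[of m k] MLB[of m "Suc k"] MLB[of k m]
      MLB[of "Suc k" m] by (auto simp: D'_def algebra_simps not_less_eq_eq)
  have vA: "v k * A m = (if m \<le> k then v k else 0)" for k m
  proof -
    have "v k * A m = v k * (D k * A m)" by (simp add: vD flip: mult.assoc)
    then show ?thesis by (simp add: DA vD)
  qed
  have Bv: "B m * v k = (if m \<le> k then v k else 0)" for k m
  proof -
    have "B m * v k = (B m * D' k) * v k" by (simp add: Dv mult.assoc)
    then show ?thesis by (simp add: BD Dv)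
  qed
  have vDl: "v l * D k = (if k = l then v l else 0)" for k l
    unfolding D_def by (auto simp: right_diff_distrib vA)
  have Dvl: "D' k * v l = (if k = l then v l else 0)" for k l
    unfolding D'_def by (auto simp: left_diff_distrib Bv)
  have vv: "star (v k) * v l = (if k = l then D k else 0)" for k l
  proof -
    have "star (D' k * v k) = star (v k)" by (simp only: Dv)
    then have "star (v k) * D' k = star (v k)"
      using projD(1)[OF proj_diff[OF B(1,1,2)]] by (simp add: star_mult D'_def)
    then have "star (v k) * v l = star (v k) * (D' k * v l)" by (simp flip: mult.assoc)
    then show ?thesis by (auto simp: Dvl v)
  qed
  have vv': "v k * star (v l) = (if k = l then D' k else 0)" for k l
  proof -
    have "star (v l * D l) = star (v l)" by (simp only: vD)
    then have "D l * star (v l) = star (v l)"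
      using projD(1)[OF proj_diff[OF A(1,1,2)]] by (simp add: star_mult D_def)
    then have "v k * star (v l) = (v k * D l) * star (v l)" by (simp add: mult.assoc)
    then show ?thesis by (auto simp: vDl v)
  qed
  define u where "u = (\<Sum>k\<le>n. v k)"
  have "star u * u = (\<Sum>k\<le>n. D k)"
    by (simp add: u_def star_simps sum_product vv if_distrib cong: if_cong)
  also have "\<dots> = 1" unfolding D_def by (simp only: sum_telescope A) simp
  finally have 1: "star u * u = 1" .
  have "u * star u = (\<Sum>k\<le>n. D' k)"
    by (simp add: u_def star_simps sum_product vv' if_distrib cong: if_cong)
  also have "\<dots> = 1" unfolding D'_def by (simp only: sum_telescope B) simp
  finally have 2: "u * star u = 1" .
  have "u * A k = B k * u" for k
    by (simp add: u_def sum_distrib_left sum_distrib_right vA Bv)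
  then have "u * A k * star u = B k" for k using 2 by (simp add: mult.assoc)
  then show thesis using that 1 2 by (auto simp: is_unitary_def)
qed

section \<open>Chains of projections and spectral domination\<close>

text \<open>A spectral projection of \<open>y\<close> cuts \<open>p\<close> in 0 or in
  \<open>p\<close>, so on \<open>p\<close> every number is an upper or a lower bound of
  \<open>y\<close>. The trace decides which, and the change happens at
  \<open>tr y / tr p\<close>.\<close>

lemma minimal_corner_sa_scalar:
  assumes p: "proj p" "p \<noteq> 0" and min: "\<And>f. proj f \<Longrightarrow> f * p = f \<Longrightarrow> f = 0 \<or> f = p"
    and y: "star y = y" "y * p = y"
  shows "\<exists>r. y = r *\<^sub>R p"
proof -
  have "p * y = star (y * p)" by (simp only: star_mult projD(1)[OF p(1)] y(1))
  then have py: "p * y = y" by (simp only: y)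
  have trp: "tr p > 0" using tr_pos[OF pos_proj[OF p(1)]] tr_pos_eq_0[OF pos_proj[OF p(1)]] p(2) by force
  define r0 where "r0 = tr y / tr p"
  have dich: "pos (y - r *\<^sub>R p) \<or> pos (r *\<^sub>R p - y)" for r
  proof -
    obtain q where q: "proj q" "\<And>z. z * y = y * z \<Longrightarrow> z * q = q * z"
      "pos (y * q - r *\<^sub>R q)" "pos (r *\<^sub>R (1 - q) - y * (1 - q))"
      using sproj_exists[OF y(1), of r] by (auto simp: sproj_def)
    have pq: "p * q = q * p" by (rule q(2)) (simp add: py y)
    have "p * q = 0 \<or> p * q = p"
      by (rule min[OF proj_mult[OF p(1) q(1) pq]]) (use projD[OF p(1)] pq in \<open>metis mult.assoc\<close>)
    then show ?thesis
    proof
      assume 0: "p * q = 0"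
      have "p * (r *\<^sub>R (1 - q) - y * (1 - q)) * p = r *\<^sub>R p - y"
        using 0 pq projD[OF p(1)] py y(2) by (simp add: algebra_simps)
      then show ?thesis using pos_conj[OF q(4), of p] projD[OF p(1)] by simp
    next
      assume 1: "p * q = p"
      have "p * (y * q - r *\<^sub>R q) * p = y - r *\<^sub>R p"
        using 1 pq projD[OF p(1)] py y(2) by (simp add: algebra_simps)
      then show ?thesis using pos_conj[OF q(3), of p] projD[OF p(1)] by simp
    qed
  qed
  have up: "pos (r *\<^sub>R p - y)" if "r > r0" for r
  proof -
    have "\<not> pos (y - r *\<^sub>R p)"
      using tr_pos[of "y - r *\<^sub>R p"] that trp by (auto simp: tr_simps r0_def field_simps)
    then show ?thesis using dich by blast
  qed
  have lo: "pos (y - r *\<^sub>R p)" if "r < r0" for r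
  proof -
    have "\<not> pos (r *\<^sub>R p - y)"
      using tr_pos[of "r *\<^sub>R p - y"] that trp by (auto simp: tr_simps r0_def field_simps)
    then show ?thesis using dich by blast
  qed
  have "pos (r0 *\<^sub>R p - y)"
    by (rule pos_closure[where y=p]) (use up[of "r0 + _"] in \<open>simp add: algebra_simps\<close>)
  moreover have "pos (y - r0 *\<^sub>R p)"
    by (rule pos_closure[where y=p]) (use lo[of "r0 - _"] in \<open>simp add: algebra_simps\<close>)
  ultimately have "y - r0 *\<^sub>R p = 0" using pos_antisym[of "y - r0 *\<^sub>R p"] by simp
  then show ?thesis by auto
qed

lemma minimal_corner_scalar:
  assumes p: "proj p" "p \<noteq> 0" and min: "\<And>f. proj f \<Longrightarrow> f * p = f \<Longrightarrow> f = 0 \<or> f = p"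
  shows "\<exists>r s. p * x * p = r *\<^sub>R p + s *\<^sub>R (j * p)"
proof -
  define y where "y = p * x * p"
  have pp: "p * p = p" "star p = p" using projD[OF p(1)] by auto
  have yp: "y * p = y" by (simp add: y_def mult.assoc pp)
  have syp: "star y * p = star y" by (simp add: y_def star_simps mult.assoc pp)
  obtain r where r: "y + star y = r *\<^sub>R p"
    using minimal_corner_sa_scalar[OF assms, of "y + star y"] by (auto simp: star_simps distrib_right yp syp)
  have "star (j * (star y - y)) = j * (star y - y)"
    by (simp add: star_simps algebra_simps)
  moreover have "j * (star y - y) * p = j * (star y - y)" by (simp add: left_diff_distrib mult.assoc yp syp)
  ultimately obtain s where s: "j * (star y - y) = s *\<^sub>R p"
    using minimal_corner_sa_scalar[OF assms, of "j * (star y - y)"] by auto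
  have "2 *\<^sub>R y = (y + star y) + j * (j * (star y - y))" by (simp add: j_mult_j scaleR_2)
  also have "\<dots> = r *\<^sub>R p + s *\<^sub>R (j * p)" by (simp only: r s) simp
  finally have "(1/2) *\<^sub>R (2 *\<^sub>R y) = (r/2) *\<^sub>R p + (s/2) *\<^sub>R (j * p)"
    by (simp only: scaleR_add_right scaleR_scaleR) simp
  then show ?thesis unfolding y_def by auto
qed

text \<open>If \<open>p\<close> were minimal, a maximal family of partial isometries from \<open>p\<close> onto orthogonal
  projections would be a column of matrix units for the whole algebra.\<close>

lemma no_minimal_proj:
  assumes p: "proj p" "p \<noteq> 0"
  shows "\<exists>f. proj f \<and> f * p = f \<and> f \<noteq> 0 \<and> f \<noteq> p"
proof (rule ccontr)
  assume "\<not> ?thesis"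
  then have min: "proj f \<Longrightarrow> f * p = f \<Longrightarrow> f = 0 \<or> f = p" for f by blast
  have trp: "tr p > 0" using tr_pos[OF pos_proj[OF p(1)]] tr_pos_eq_0[OF pos_proj[OF p(1)]] p(2) by force
  \<comment> \<open>A family of length \<open>n\<close> consists of partial isometries with initial
    projection \<open>p\<close> and orthogonal ranges. The ranges have total trace
    \<open>n * tr p\<close>, at most 1, so a longest family exists.\<close>
  define fam where "fam n v \<longleftrightarrow> (\<forall>i<n. \<forall>k<n. star (v i) * v k = (if i = k then p else 0))"
    for n :: nat and v :: "nat \<Rightarrow> 'a"
  define P where "P n v = (\<Sum>i<n. v i * star (v i))" for n :: nat and v :: "nat \<Rightarrow> 'a"
  have vp: "v i * p = v i" if "fam n v" "i < n" for n v i
    using partial_isometry_mult[of "v i"] that p(1) by (simp add: fam_def)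
  have pv: "p * star (v i) = star (v i)" if "fam n v" "i < n" for n v i
  proof -
    have "star (v i * p) = star (v i)" using vp[OF that] by simp
    then show ?thesis by (simp add: star_mult projD[OF p(1)])
  qed
  have vP: "star (v i) * P n v = star (v i)" if "fam n v" "i < n" for n v i
  proof -
    have "star (v i) * P n v = (\<Sum>k<n. (star (v i) * v k) * star (v k))"
      by (simp add: P_def sum_distrib_left mult.assoc)
    also have "\<dots> = (\<Sum>k<n. if i = k then p * star (v k) else 0)"
      using that by (intro sum.cong) (auto simp: fam_def)
    finally show ?thesis using that pv[OF that] by simp
  qed
  have Pp: "proj (P n v)" if "fam n v" for n v
  proof -
    have "P n v * P n v = (\<Sum>i<n. v i * (star (v i) * P n v))"
      unfolding P_def by (subst sum_distrib_right) (simp add: mult.assoc)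
    then have "P n v * P n v = P n v" using vP[OF that] by (simp add: P_def)
    then show ?thesis by (simp add: is_projection_def P_def star_simps)
  qed
  have "tr (P n v) = real n * tr p" if "fam n v" for n v
  proof -
    have "tr (P n v) = (\<Sum>i<n. tr (star (v i) * v i))" by (simp add: P_def tr_sum tr_comm)
    then show ?thesis using that by (simp add: fam_def)
  qed
  then have bd: "real n * tr p \<le> 1" if "fam n v" for n v using tr_proj_le[OF Pp[OF that]] that by simp
  have bd': "n < Suc (nat \<lceil>1 / tr p\<rceil>)" if "\<exists>v. fam n v" for n
  proof -
    have "real n \<le> 1 / tr p" using bd that trp by (auto simp: field_simps)
    then show ?thesis by linarith
  qed
  have "\<exists>v. fam 0 v" by (simp add: fam_def)
  then obtain n where n: "\<exists>v. fam n v" "\<And>m. \<exists>v. fam m v \<Longrightarrow> m \<le> n"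
    using ex_has_greatest_nat[of "\<lambda>n. \<exists>v. fam n v" 0 "\<lambda>n. n"] bd' by blast
  obtain v where v: "fam n v" using n(1) by blast
  define e where "e = 1 - P n v"
  have e: "proj e" unfolding e_def by (rule proj_compl[OF Pp[OF v]])
  have "e = 0"
  proof (rule ccontr)
    assume "e \<noteq> 0"
    then obtain w where w: "w \<noteq> 0" "proj (star w * w)" "w * p = w" "e * w = w"
      using nonzero_partial_isometry[OF p e] by blast
    have "star w * w = 0 \<or> star w * w = p" by (rule min[OF w(2)]) (simp add: mult.assoc w(3))
    then have ww: "star w * w = p" using w(1) star_mult_eq_0 by blast
    have vw: "star (v i) * w = 0" if "i < n" for i
    proof -
      have "star (v i) * w = (star (v i) * e) * w" by (simp add: w(4) mult.assoc)
      then show ?thesis using vP[OF v that] by (simp add: e_def right_diff_distrib)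
    qed
    have wv: "star w * v i = 0" if "i < n" for i using vw[OF that] by (metis star_mult star_star star_0)
    have "fam (Suc n) (v(n := w))"
      using v vw wv ww by (auto simp: fam_def less_Suc_eq)
    then show False using n(2)[of "Suc n"] by auto
  qed
  then have P1: "P n v = 1" by (simp add: e_def)
  \<comment> \<open>The span is real, so every matrix unit also enters multiplied by
    \<open>j\<close>.\<close>
  define B where "B = (\<lambda>(i, k). v i * star (v k)) ` ({..<n} \<times> {..<n}) \<union> (\<lambda>(i, k). j * (v i * star (v k))) ` ({..<n} \<times> {..<n})"
  have "x \<in> span B" for x
  proof -
    have "x = P n v * x * P n v" by (simp add: P1)
    also have "\<dots> = (\<Sum>i<n. \<Sum>k<n. v i * (star (v i) * x * v k) * star (v k))"
      by (simp add: P_def sum_distrib_left sum_distrib_right mult.assoc) (rule sum.swap)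
    also have "\<dots> \<in> span B"
    proof (intro span_sum)
      fix i k assume ik: "i \<in> {..<n}" "k \<in> {..<n}"
      obtain r s where rs: "p * (star (v i) * x * v k) * p = r *\<^sub>R p + s *\<^sub>R (j * p)"
        using minimal_corner_scalar[OF p min] by blast
      have "v i * (p * (star (v i) * x * v k) * p) * star (v k)
          = (v i * p) * (star (v i) * x * v k) * (p * star (v k))" by (simp only: mult.assoc)
      then have "v i * (star (v i) * x * v k) * star (v k) = v i * (p * (star (v i) * x * v k) * p) * star (v k)"
        using vp[OF v, of i] pv[OF v, of k] ik by simp
      also have "\<dots> = r *\<^sub>R (v i * star (v k)) + s *\<^sub>R (j * (v i * star (v k)))"
        unfolding rs using vp[OF v, of i] ik
        by (simp add: distrib_left distrib_right j_mult_mult[of "v i"] mult.assoc)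
      also have "\<dots> \<in> span B"
        by (intro span_add span_scale span_base) (use ik in \<open>auto simp: B_def\<close>)
      finally show "v i * (star (v i) * x * v k) * star (v k) \<in> span B" .
    qed
    finally show ?thesis .
  qed
  then have "span B = UNIV" by blast
  moreover have "finite B" by (simp add: B_def)
  ultimately show False using infinite_dim by blast
qed

section \<open>Maximal chains of projections\<close>

definition pchain :: "'a set \<Rightarrow> bool" where
  "pchain C \<longleftrightarrow> (\<forall>p\<in>C. proj p) \<and> (\<forall>p\<in>C. \<forall>q\<in>C. pos (q - p) \<or> pos (p - q))"

text \<open>Within a chain the trace determines the order: if the projections compare the other way
  round, faithfulness makes them equal.\<close>

lemma pchain_le_of_tr:
  assumes "pchain C" "p \<in> C" "q \<in> C" "tr p \<le> tr q" shows "pos (q - p)"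
proof (cases "pos (q - p)")
  case False
  then have 1: "pos (p - q)" using assms by (auto simp: pchain_def)
  then have "tr (p - q) = 0" using tr_pos[OF 1] assms(4) by (simp add: tr_simps)
  then have "p - q = 0" by (rule tr_pos_eq_0[OF 1])
  then show ?thesis by simp
qed

lemma pchain_commute: assumes "pchain C" "p \<in> C" "q \<in> C" shows "p * q = q * p"
proof -
  have "proj p" "proj q" "pos (q - p) \<or> pos (p - q)" using assms by (auto simp: pchain_def)
  then show ?thesis using proj_le_mult[of p q] proj_le_mult[of q p] by auto
qed

lemma maximal_pchain:
  assumes "pchain C0"
  obtains C where "C0 \<subseteq> C" "pchain C"
    "\<And>q. proj q \<Longrightarrow> (\<And>p. p \<in> C \<Longrightarrow> pos (q - p) \<or> pos (p - q)) \<Longrightarrow> q \<in> C"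
proof -
  let ?A = "{C. C0 \<subseteq> C \<and> pchain C}"
  have "\<exists>M\<in>?A. \<forall>X\<in>?A. M \<subseteq> X \<longrightarrow> X = M"
  proof (rule subset_Zorn_nonempty)
    show "?A \<noteq> {}" using assms by blast
    fix \<C> assume ne: "\<C> \<noteq> {}" and ch: "subset.chain ?A \<C>"
    have 1: "pchain X" "C0 \<subseteq> X" if "X \<in> \<C>" for X using ch that by (auto simp: subset.chain_def)
    have "pos (q - p) \<or> pos (p - q)" if "X \<in> \<C>" "Y \<in> \<C>" "p \<in> X" "q \<in> Y" for X Y p q
    proof -
      have "X \<subseteq> Y \<or> Y \<subseteq> X" using ch that unfolding subset.chain_def by blast
      then show ?thesis using 1(1)[OF that(1)] 1(1)[OF that(2)] that(3,4) unfolding pchain_def by blast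
    qed
    moreover have "proj p" if "X \<in> \<C>" "p \<in> X" for X p using 1(1)[OF that(1)] that(2) by (simp add: pchain_def)
    ultimately have "pchain (\<Union>\<C>)" unfolding pchain_def by blast
    then show "\<Union>\<C> \<in> ?A" using ne 1(2) by blast
  qed
  then obtain C where "C \<in> ?A" and M: "\<forall>X\<in>?A. C \<subseteq> X \<longrightarrow> X = C" ..
  then have C: "C0 \<subseteq> C" "pchain C" by auto
  have max: "X = C" if "C0 \<subseteq> X" "pchain X" "C \<subseteq> X" for X using M that by simp
  show thesis
  proof (rule that[OF C])
    fix q assume q: "proj q" "\<And>p. p \<in> C \<Longrightarrow> pos (q - p) \<or> pos (p - q)"
    have "pchain (insert q C)" using C(2) q unfolding pchain_def by auto
    then have "insert q C = C" using C(1) by (intro max) auto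
    then show "q \<in> C" by blast
  qed
qed

text \<open>The chain may be uncountable, so the supremum comes from directed completeness. A
  sequence of members converging to it still suffices to transfer idempotence, upper bounds and
  bounds on traces.\<close>

lemma pchain_sup:
  assumes D: "pchain D" "D \<noteq> {}"
  shows "\<exists>s. proj s \<and> (\<forall>p\<in>D. pos (s - p)) \<and> (\<forall>q. (\<forall>p\<in>D. pos (q - p)) \<longrightarrow> pos (q - s))
    \<and> (\<forall>t. (\<forall>p\<in>D. tr p \<le> t) \<longrightarrow> tr s \<le> t)"
proof -
  have pr: "\<And>p. p \<in> D \<Longrightarrow> proj p" using D(1) by (simp add: pchain_def)
  have "bdd_directed star D"
    unfolding bdd_directed_def
  proof (intro conjI ballI)
    fix x y assume xy: "x \<in> D" "y \<in> D"
    then have "pos (y - x) \<or> pos (x - y)" using D(1) by (simp add: pchain_def)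
    then show "\<exists>z\<in>D. ople star x z \<and> ople star y z"
      using xy by (auto simp: ople_iff intro: bexI[of _ x] bexI[of _ y])
  next
    show "\<exists>K. \<forall>x\<in>D. norm x \<le> K" using pr norm_proj_le by blast
  qed (use D(2) pr in \<open>auto simp: selfadj_def projD\<close>)
  then obtain s X where s: "\<And>x. x \<in> D \<Longrightarrow> positive star (s - x)" "\<And>n. X n \<in> D" "tconv X s"
    using op_lub_tconv by metis
  show ?thesis
  proof (intro exI[of _ s] conjI allI impI ballI)
    show "proj s" using pr[OF s(2)] s(3) by (rule proj_tconv)
    show "pos (s - p)" if "p \<in> D" for p using s(1)[OF that] by (simp add: positive_eq_pos)
    show "pos (q - s)" if "\<forall>p\<in>D. pos (q - p)" for q
      by (rule pos_tconv[OF _ tconv_diff[OF tconv_const s(3)]]) (use that s(2) in blast)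
    show "tr s \<le> t" if "\<forall>p\<in>D. tr p \<le> t" for t
      by (rule LIMSEQ_le_const2[OF tconv_tr[OF s(3)]]) (use that s(2) in auto)
  qed
qed

text \<open>If \<open>t\<close> is skipped, let \<open>e1\<close> be the supremum of the members of
  smaller trace and \<open>e2\<close> the infimum of the others, formed through complements.
  Maximality puts both into \<open>C\<close>. A projection strictly between 0 and
  \<open>e2 - e1\<close>, added to \<open>e1\<close>, is comparable with all members but lies
  strictly inside the gap.\<close>

lemma maximal_pchain_values:
  assumes C: "pchain C" and max: "\<And>q. proj q \<Longrightarrow> (\<And>p. p \<in> C \<Longrightarrow> pos (q - p) \<or> pos (p - q)) \<Longrightarrow> q \<in> C"
    and t: "0 \<le> t" "t \<le> 1"
  shows "\<exists>e\<in>C. tr e = t"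
proof (rule ccontr)
  assume no: "\<not> ?thesis"
  have pr: "\<And>p. p \<in> C \<Longrightarrow> proj p" and cmp: "\<And>p q. p \<in> C \<Longrightarrow> q \<in> C \<Longrightarrow> pos (q - p) \<or> pos (p - q)"
    using C by (auto simp: pchain_def)
  have 0: "0 \<in> C" by (rule max) (use pr pos_proj in auto)
  have 1: "1 \<in> C" by (rule max) (use pr pos_1_proj in auto)
  define L where "L = {p \<in> C. tr p \<le> t}"
  define U where "U = (\<lambda>p. 1 - p) ` {p \<in> C. t \<le> tr p}"
  have L: "pchain L" "L \<noteq> {}" using C 0 t by (auto simp: pchain_def L_def)
  obtain e1 where e1: "proj e1" "\<forall>p\<in>L. pos (e1 - p)" "\<forall>q. (\<forall>p\<in>L. pos (q - p)) \<longrightarrow> pos (q - e1)"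
     "\<forall>s. (\<forall>p\<in>L. tr p \<le> s) \<longrightarrow> tr e1 \<le> s"
    using pchain_sup[OF L] by (elim exE conjE) (rule that)
  note e1 = e1[rule_format]
  have tre1: "tr e1 \<le> t" by (rule e1(4)) (simp add: L_def)
  have U: "pchain U" unfolding pchain_def U_def
  proof (intro conjI ballI)
    fix x y assume "x \<in> (\<lambda>p. 1 - p) ` {p \<in> C. t \<le> tr p}" "y \<in> (\<lambda>p. 1 - p) ` {p \<in> C. t \<le> tr p}"
    then obtain p q where "p \<in> C" "q \<in> C" "x = 1 - p" "y = 1 - q" by blast
    then show "pos (y - x) \<or> pos (x - y)" using cmp[of q p] by simp
  qed (use pr proj_compl in auto)
  have U': "U \<noteq> {}" using 1 t by (auto simp: U_def)
  obtain s where s: "proj s" "\<forall>p\<in>U. pos (s - p)" "\<forall>q. (\<forall>p\<in>U. pos (q - p)) \<longrightarrow> pos (q - s)"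
     "\<forall>t. (\<forall>p\<in>U. tr p \<le> t) \<longrightarrow> tr s \<le> t"
    using pchain_sup[OF U U'] by (elim exE conjE) (rule that)
  note s = s[rule_format]
  have trs: "tr s \<le> 1 - t" by (rule s(4)) (auto simp: U_def tr_simps)
  define e2 where "e2 = 1 - s"
  have e2: "proj e2" "t \<le> tr e2" using proj_compl[OF s(1)] trs by (auto simp: e2_def tr_simps)
  have e2le: "pos (p - e2)" if "p \<in> C" "t \<le> tr p" for p
    using s(2)[of "1 - p"] that by (auto simp: U_def e2_def algebra_simps)
  have e2ge: "pos (e2 - q)" if "\<And>p. p \<in> C \<Longrightarrow> t \<le> tr p \<Longrightarrow> pos (p - q)" for q
  proof -
    have "pos (1 - q - s)" by (rule s(3)) (use that in \<open>auto simp: U_def\<close>)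
    then show ?thesis by (simp add: e2_def algebra_simps)
  qed
  have LU: "pos (p - q)" if "q \<in> C" "p \<in> C" "tr q \<le> t" "t \<le> tr p" for p q
    using pchain_le_of_tr[OF C that(1,2)] that(3,4) by simp
  have e1C: "e1 \<in> C"
  proof (rule max[OF e1(1)])
    fix p assume p: "p \<in> C"
    show "pos (e1 - p) \<or> pos (p - e1)"
    proof (cases "tr p \<le> t")
      case True
      then show ?thesis using e1(2)[of p] p by (auto simp: L_def)
    next
      case False
      then have "pos (p - e1)" using p LU by (intro e1(3)) (auto simp: L_def)
      then show ?thesis ..
    qed
  qed
  have e2C: "e2 \<in> C"
  proof (rule max[OF e2(1)])
    fix p assume p: "p \<in> C"
    show "pos (e2 - p) \<or> pos (p - e2)"
    proof (cases "t \<le> tr p")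
      case True
      then show ?thesis using e2le p by blast
    next
      case False
      then have "pos (e2 - p)" using p LU by (intro e2ge) auto
      then show ?thesis ..
    qed
  qed
  have lt: "tr e1 < t" "t < tr e2" using no e1C e2C tre1 e2(2) by (auto simp: less_le)
  have 12: "pos (e2 - e1)" by (rule LU[OF e1C e2C tre1 e2(2)])
  define g where "g = e2 - e1"
  have g: "proj g" unfolding g_def by (rule proj_diff[OF e1(1) e2(1) 12])
  have "g \<noteq> 0" using lt by (auto simp: g_def)
  then obtain f where f: "proj f" "f * g = f" "f \<noteq> 0" "f \<noteq> g" using no_minimal_proj[OF g] by blast
  have gf: "pos (g - f)" using proj_le_iff[OF f(1) g] f(2) by simp
  have "g * e1 = 0" using proj_le_mult[OF e1(1) e2(1) 12] projD[OF e1(1)] by (simp add: g_def algebra_simps)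
  then have "f * e1 = 0" using f(2) by (metis mult.assoc mult_zero_right)
  then have q: "proj (f + e1)" by (rule proj_add[OF f(1) e1(1)])
  have "f + e1 \<in> C"
  proof (rule max[OF q])
    fix p assume p: "p \<in> C"
    show "pos (f + e1 - p) \<or> pos (p - (f + e1))"
    proof (cases "tr p \<le> t")
      case True
      then have "pos (e1 - p)" using e1(2)[of p] p by (auto simp: L_def)
      from pos_add[OF pos_proj[OF f(1)] this] show ?thesis by (simp add: add_diff_eq)
    next
      case False
      then have "pos (p - e2)" using e2le p by simp
      from pos_add[OF this gf] show ?thesis by (simp add: g_def algebra_simps)
    qed
  qed
  then have "pos (e1 - (f + e1)) \<or> pos (f + e1 - e2)"
    using e1(2)[of "f + e1"] e2le[of "f + e1"] by (cases "tr (f + e1) \<le> t") (auto simp: L_def)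
  then show False
  proof
    assume "pos (e1 - (f + e1))"
    then show False using pos_antisym[OF pos_proj[OF f(1)]] f(3) by simp
  next
    assume "pos (f + e1 - e2)"
    then have "pos (- (g - f))" by (simp add: g_def algebra_simps)
    then show False using pos_antisym[OF gf] f(4) by simp
  qed
qed

lemma pchain_E: "pos a \<Longrightarrow> pchain (range (E a))"
  using E_antimono[of a] E_proj[of a] unfolding pchain_def by (auto; metis linear)

lemma spectral_flow:
  assumes a: "pos a"
  obtains C e where "pchain C" "range (E a) \<subseteq> C" "\<And>t. 0 \<le> t \<Longrightarrow> t \<le> 1 \<Longrightarrow> e t \<in> C \<and> tr (e t) = t"
proof -
  obtain C where C: "range (E a) \<subseteq> C" "pchain C"
    "\<And>q. proj q \<Longrightarrow> (\<And>p. p \<in> C \<Longrightarrow> pos (q - p) \<or> pos (p - q)) \<Longrightarrow> q \<in> C"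
    using maximal_pchain[OF pchain_E[OF a]] by blast
  have "\<forall>t\<in>{0..1}. \<exists>e. e \<in> C \<and> tr e = t" using maximal_pchain_values[OF C(2,3)] by (metis atLeastAtMost_iff)
  then obtain e where "\<And>t. t \<in> {0..1} \<Longrightarrow> e t \<in> C \<and> tr (e t) = t" by metis
  then show thesis by (intro that[of C e, OF C(2,1)]) auto
qed

section \<open>Riemann sums along a flow of projections\<close>

lemma layer_refine:
  assumes pr: "\<And>k. proj (A k)" and dec: "\<And>k. pos (A k - A (Suc k))" and A0: "A 0 = 1"
  shows "norm ((\<Sum>k=1..2*m. A k) - (\<Sum>k=1..m. 2 *\<^sub>R A (2 * k))) \<le> 1"
proof -
  \<comment> \<open>Halving the mesh leaves the sum of \<open>A (2 k - 1) - A (2 k)\<close>. The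
    gaps interlacing with these sum with them to \<open>1 - A (2 m)\<close>, whence the bound
    1.\<close>
  define T where "T m = (\<Sum>k=1..2*m. A k) - (\<Sum>k=1..m. 2 *\<^sub>R A (2 * k))" for m
  have "pos (T m) \<and> pos (1 - A (2 * m) - T m)" for m
  proof (induction m)
    case 0
    then show ?case by (simp add: T_def A0)
  next
    case (Suc m)
    have 1: "T (Suc m) = T m + (A (Suc (2 * m)) - A (Suc (Suc (2 * m))))"
      by (simp add: T_def scaleR_2)
    have 2: "1 - A (2 * Suc m) - T (Suc m) = (1 - A (2 * m) - T m) + (A (2 * m) - A (Suc (2 * m)))"
      unfolding 1 by (simp add: algebra_simps)
    show ?case unfolding 2 unfolding 1 using Suc dec by (intro conjI pos_add) auto
  qed
  from this[of m] have "pos (T m)" "pos (1 *\<^sub>R 1 - T m)"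
    using pos_add[OF _ pos_proj[OF pr[of "2 * m"]], of "1 - A (2 * m) - T m"] by auto
  then have "norm (T m) \<le> 1" by (intro norm_le_of_pos') auto
  then show ?thesis by (simp add: T_def)
qed

lemma geometric_Cauchy_limit:
  fixes S :: "nat \<Rightarrow> 'a"
  assumes "\<And>n. norm (S (Suc n) - S n) \<le> (1/2) ^ Suc n"
  obtains c where "S \<longlonglongrightarrow> c" "\<And>n. norm (c - S n) \<le> (1/2) ^ n"
proof -
  have step: "norm (S (n + m) - S n) \<le> (1/2) ^ n - (1/2) ^ (n + m)" for n m
  proof (induction m)
    case (Suc m)
    have "norm (S (n + Suc m) - S n) \<le> norm (S (Suc (n + m)) - S (n + m)) + norm (S (n + m) - S n)"
      using norm_triangle_ineq[of "S (Suc (n + m)) - S (n + m)" "S (n + m) - S n"] by simp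
    also have "\<dots> \<le> (1/2) ^ Suc (n + m) + ((1/2) ^ n - (1/2) ^ (n + m))"
      by (rule add_mono[OF assms Suc])
    finally show ?case by simp
  qed simp
  then have le: "norm (S (n + m) - S n) \<le> (1/2) ^ n" for n m
    using zero_le_power[of "1/2::real" "n + m"] by (smt (verit) divide_nonneg_nonneg)
  have "Cauchy S"
  proof (rule metric_CauchyI)
    fix \<epsilon> :: real assume "\<epsilon> > 0"
    then obtain N where N: "(1/2::real) ^ N < \<epsilon> / 2" using real_arch_pow_inv[of "\<epsilon> / 2" "1/2"] by auto
    have d: "dist (S m) (S N) < \<epsilon> / 2" if "m \<ge> N" for m
      using le[of N "m - N"] N that by (simp add: dist_norm)
    have "dist (S m) (S n) < \<epsilon>" if "m \<ge> N" "n \<ge> N" for m n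
      using d[OF that(1)] d[OF that(2)] dist_triangle_half_l by blast
    then show "\<exists>M. \<forall>m\<ge>M. \<forall>n\<ge>M. dist (S m) (S n) < \<epsilon>" by blast
  qed
  then obtain c where c: "S \<longlonglongrightarrow> c" using Cauchy_convergent convergent_def by blast
  have "norm (c - S n) \<le> (1/2) ^ n" for n
  proof (rule LIMSEQ_le_const2)
    show "(\<lambda>m. norm (S (m + n) - S n)) \<longlonglongrightarrow> norm (c - S n)"
      by (intro tendsto_intros LIMSEQ_ignore_initial_segment c)
  qed (use le[of n] in \<open>auto simp: add.commute\<close>)
  then show thesis using that c by blast
qed

text \<open>A right-endpoint Riemann sum over \<open>[0, m]\<close>. Here \<open>m\<close> bounds
  \<open>norm b\<close>, beyond which the integrand has trace 0; dyadic meshes are used so that each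
  sum refines the preceding one.\<close>

definition rearranged :: "(real \<Rightarrow> 'a) \<Rightarrow> 'a \<Rightarrow> nat \<Rightarrow> nat \<Rightarrow> 'a" where
  "rearranged e b m n = (\<Sum>k=1..m * 2 ^ n. (1/2) ^ n *\<^sub>R e (tr (E b (real k * (1/2) ^ n))))"

text \<open>The rearrangement of \<open>b\<close> along a flow \<open>e\<close> of projections, \<open>\<integral> e (\<tau> (E b r)) dr\<close>, is the norm limit of
  its Riemann sums, each of which is unitarily equivalent to the corresponding sum for \<open>b\<close>.\<close>

lemma rearrangement:
  assumes C: "pchain C" and e: "\<And>t. 0 \<le> t \<Longrightarrow> t \<le> 1 \<Longrightarrow> e t \<in> C \<and> tr (e t) = t"
    and b: "pos b" and m: "norm b \<le> real m"
  obtains c where "c \<in> closure (unitary_orbit star b)" "rearranged e b m \<longlonglongrightarrow> c"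
    "\<And>n. norm (c - rearranged e b m n) \<le> (1/2) ^ n"
proof -
  define Q where "Q r = e (tr (E b r))" for r
  have d: "0 \<le> tr (E b r)" "tr (E b r) \<le> 1" for r
    using tr_pos[OF pos_proj[OF E_proj[OF b]]] tr_proj_le[OF E_proj[OF b]] by auto
  have QC: "Q r \<in> C" and trQ: "tr (Q r) = tr (E b r)" for r using e[OF d] by (auto simp: Q_def)
  have Qp: "proj (Q r)" for r using C QC by (simp add: pchain_def)
  have Qdec: "pos (Q r - Q r')" if "r \<le> r'" for r r'
    by (rule pchain_le_of_tr[OF C QC QC]) (simp add: trQ tr_mono[OF E_antimono[OF b that]])
  have Q0: "Q 0 = 1"
    using tr_pos_eq_0[OF pos_1_proj[OF Qp[of 0]]] by (simp add: tr_simps trQ E_nonpos)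
  have Q_zero: "Q r = 0" if "norm b < r" for r
    using tr_pos_eq_0[OF pos_proj[OF Qp[of r]]] by (simp add: trQ E_zero[OF b that])
  define S where "S n = rearranged e b m n" for n
  have S: "S n = (1/2) ^ n *\<^sub>R (\<Sum>k=1..m * 2 ^ n. Q (real k * (1/2) ^ n))" for n
    by (simp add: S_def rearranged_def Q_def scaleR_sum_right)
  have "norm (S (Suc n) - S n) \<le> (1/2) ^ Suc n" for n
  proof -
    define h :: real where "h = (1/2) ^ Suc n"
    have h: "h > 0" by (simp add: h_def)
    have hn: "(1/2) ^ n = 2 * h" by (simp add: h_def)
    have "S (Suc n) - S n = h *\<^sub>R ((\<Sum>k=1..2 * (m * 2 ^ n). Q (real k * h)) - (\<Sum>k=1..m * 2 ^ n. 2 *\<^sub>R Q (real (2 * k) * h)))"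
      unfolding S hn h_def[symmetric] by (simp add: scaleR_diff_right scaleR_sum_right mult_ac)
    moreover have "norm ((\<Sum>k=1..2 * (m * 2 ^ n). Q (real k * h)) - (\<Sum>k=1..m * 2 ^ n. 2 *\<^sub>R Q (real (2 * k) * h))) \<le> 1"
      by (rule layer_refine[of "\<lambda>k. Q (real k * h)"]) (use h in \<open>auto intro!: Qp Qdec simp: Q0\<close>)
    ultimately show ?thesis using h by (simp add: h_def mult_left_le)
  qed
  then obtain c where c: "S \<longlonglongrightarrow> c" "\<And>n. norm (c - S n) \<le> (1/2) ^ n"
    using geometric_Cauchy_limit[of S] by blast
  have "c \<in> closure (unitary_orbit star b)"
    unfolding closure_orbit_iff
  proof (intro allI impI)
    fix \<epsilon> :: real assume "\<epsilon> > 0"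
    then obtain n where n: "(1/2::real) ^ n < \<epsilon> / 2" using real_arch_pow_inv[of "\<epsilon> / 2" "1/2"] by auto
    define h :: real where "h = (1/2) ^ n"
    have h: "h > 0" by (simp add: h_def)
    define K where "K = m * 2 ^ n"
    have Kh: "real K * h = real m" by (simp add: K_def h_def power_one_over)
    then have nK: "norm b \<le> real K * h" using m by simp
    \<comment> \<open>Both chains need one index beyond the \<open>K\<close> layers: at height
      \<open>K * h = m\<close> the projections may be non-zero when
      \<open>norm b = m\<close>.\<close>
    have "real (Suc K) * h > norm b" using nK h by (simp add: distrib_right)
    then have last: "E b (real (Suc K) * h) = 0" "Q (real (Suc K) * h) = 0" using E_zero[OF b] Q_zero by auto
    obtain u where u: "unitary u" "\<And>k. u * E b (real k * h) * star u = Q (real k * h)"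
      by (rule chain_unitary_equivalent[of "\<lambda>k. E b (real k * h)" K "\<lambda>k. Q (real k * h)"])
        (use h last in \<open>auto intro!: E_proj[OF b] E_antimono[OF b] Qp Qdec simp: Q0 E_nonpos trQ\<close>)
    define T where "T = (\<Sum>k=1..K. h *\<^sub>R E b (real k * h))"
    have "u * T * star u = (\<Sum>k=1..K. h *\<^sub>R (u * E b (real k * h) * star u))"
      by (simp add: T_def sum_distrib_left sum_distrib_right)
    then have uT: "u * T * star u = S n" by (simp add: u(2)[unfolded h_def] S scaleR_sum_right K_def h_def)
    have "norm (b - T) \<le> h"
      using layer_sum[OF b h nK] norm_le_of_pos' h unfolding T_def by simp
    then have "norm (T - b) \<le> h" by (simp add: norm_minus_commute)
    then have 1: "norm (u * (T - b) * star u) \<le> h" using norm_unitary_conj[OF u(1)] order_trans by blast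
    have "c - u * b * star u = (c - S n) + u * (T - b) * star u" by (simp add: algebra_simps uT[symmetric])
    then have "norm (c - u * b * star u) \<le> norm (c - S n) + norm (u * (T - b) * star u)"
      by (metis norm_triangle_ineq)
    also have "\<dots> \<le> h + h" using c(2)[of n] 1 by (simp add: h_def)
    finally show "\<exists>u. unitary u \<and> norm (c - u * b * star u) < \<epsilon>" using u(1) n by (auto simp: h_def)
  qed
  then show thesis using that c unfolding S_def by blast
qed

text \<open>The traces at \<open>r < r'\<close> compare only \<open>X (k + 1)\<close> with
  \<open>Y k\<close>. The unmatched \<open>X 1\<close> is paid for by the summand 1, which scaling
  turns into one mesh width.\<close>

lemma shifted_sum_le:
  assumes "pos (1 - X 1)" "\<And>k. pos (X k)" "\<And>k. pos (Y k - X (Suc k))"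
  shows "pos (1 + (\<Sum>k=1..n. Y k) - (\<Sum>k=1..n. X k))"
proof -
  have "pos (1 + (\<Sum>k=1..n. Y k) - (\<Sum>k=1..Suc n. X k))"
  proof (induction n)
    case (Suc n)
    have "1 + (\<Sum>k=1..Suc n. Y k) - (\<Sum>k=1..Suc (Suc n). X k) =
      (1 + (\<Sum>k=1..n. Y k) - (\<Sum>k=1..Suc n. X k)) + (Y (Suc n) - X (Suc (Suc n)))" by (simp add: algebra_simps)
    then show ?case using pos_add[OF Suc assms(3)[of "Suc n"]] by (simp only:)
  qed (use assms(1) in simp)
  from pos_add[OF this assms(2)[of "Suc n"]] show ?thesis by simp
qed

lemma commute_limit:
  assumes "X \<longlonglongrightarrow> x" "\<And>n. z * X n = X n * z" shows "z * x = x * (z :: 'a)"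
proof (rule LIMSEQ_unique)
  show "(\<lambda>n. z * X n) \<longlonglongrightarrow> z * x" by (intro tendsto_intros assms)
  show "(\<lambda>n. z * X n) \<longlonglongrightarrow> x * z" unfolding assms(2) by (intro tendsto_intros assms(1))
qed

lemma layer_dyadic:
  assumes b: "pos b" and m: "norm b \<le> real m"
  shows "pos (b - (\<Sum>k=1..m * 2 ^ n. (1/2) ^ n *\<^sub>R E b (real k * (1/2) ^ n)))"
    and "pos ((1/2) ^ n *\<^sub>R 1 - (b - (\<Sum>k=1..m * 2 ^ n. (1/2) ^ n *\<^sub>R E b (real k * (1/2) ^ n))))"
proof -
  have "norm b \<le> real (m * 2 ^ n) * (1/2) ^ n" using m by (simp add: power_one_over)
  from layer_sum[OF b _ this]
  show "pos (b - (\<Sum>k=1..m * 2 ^ n. (1/2) ^ n *\<^sub>R E b (real k * (1/2) ^ n)))"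
    and "pos ((1/2) ^ n *\<^sub>R 1 - (b - (\<Sum>k=1..m * 2 ^ n. (1/2) ^ n *\<^sub>R E b (real k * (1/2) ^ n))))"
    by simp_all
qed

text \<open>An element is the norm limit of its layer sums, which are combinations of its spectral
  projections.\<close>

lemma commute_of_commute_E:
  assumes a: "pos a" and z: "\<And>r. z * E a r = E a r * z"
  shows "z * a = a * z"
proof -
  obtain m where m: "norm a \<le> real m" using real_arch_simple by blast
  define X where "X n = (\<Sum>k=1..m * 2 ^ n. (1/2) ^ n *\<^sub>R E a (real k * (1/2) ^ n))" for n
  have "norm (a - X n) \<le> (1/2) ^ n" for n
    by (rule norm_le_of_pos') (use layer_dyadic[OF a m, of n] in \<open>auto simp: X_def\<close>)
  then have le: "\<forall>\<^sub>F n in sequentially. norm (X n - a) \<le> (1/2) ^ n"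
    by (simp add: norm_minus_commute)
  have "(\<lambda>n. (1/2::real) ^ n) \<longlonglongrightarrow> 0" by (rule LIMSEQ_power_zero) simp
  with le have "(\<lambda>n. X n - a) \<longlonglongrightarrow> 0" by (rule Lim_null_comparison)
  then have "X \<longlonglongrightarrow> a" by (simp add: LIM_zero_iff)
  then show ?thesis
    by (rule commute_limit) (simp add: X_def sum_distrib_left sum_distrib_right z)
qed

lemma pos_dyadic_limit:
  assumes "\<And>n. pos (x + (K * (1/2) ^ n) *\<^sub>R 1)" shows "pos x"
proof (rule pos_limit[OF assms])
  have "(\<lambda>n. x + (K * (1/2) ^ n) *\<^sub>R 1) \<longlonglongrightarrow> x + (K * 0) *\<^sub>R 1"
    by (intro tendsto_intros LIMSEQ_power_zero) simp
  then show "(\<lambda>n. x + (K * (1/2) ^ n) *\<^sub>R 1) \<longlonglongrightarrow> x" by simp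
qed

lemma star_closure_orbit:
  assumes "pos b" "c \<in> closure (unitary_orbit star b)" shows "star c = c"
proof -
  obtain X where X: "\<And>n. X n \<in> unitary_orbit star b" "X \<longlonglongrightarrow> c"
    using assms(2) closure_sequential by metis
  have "star (X n) = X n" for n
    using X(1)[of n] by (auto simp: unitary_orbit_def star_simps pos_star[OF assms(1)] mult.assoc)
  then have "X \<longlonglongrightarrow> star c" using bounded_linear.tendsto[OF bounded_linear_star X(2)] by simp
  then show ?thesis using X(2) by (rule LIMSEQ_unique)
qed

section \<open>Order relations between \<open>a\<close>, \<open>b\<close> and the closures of their
  orbits\<close>

lemma spec_dom_above:
  assumes a: "pos a" and b: "pos b" and sd: "spec_dom star \<tau> a b"
  shows "\<exists>c\<in>closure (unitary_orbit star b). pos (c - a) \<and> c * a = a * c"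
proof -
  obtain C e where C: "pchain C" "range (E a) \<subseteq> C" and e: "\<And>t. 0 \<le> t \<Longrightarrow> t \<le> 1 \<Longrightarrow> e t \<in> C \<and> tr (e t) = t"
    using spectral_flow[OF a] by metis
  obtain m :: nat where "max (norm a) (norm b) \<le> real m" using real_arch_simple by blast
  then have ma: "norm a \<le> real m" and mb: "norm b \<le> real m" by auto
  obtain c where c: "c \<in> closure (unitary_orbit star b)" "rearranged e b m \<longlonglongrightarrow> c"
    "\<And>n. norm (c - rearranged e b m n) \<le> (1/2) ^ n"
    using rearrangement[OF C(1) e b mb] by blast
  have d: "0 \<le> tr (E b r)" "tr (E b r) \<le> 1" for r
    using tr_pos[OF pos_proj[OF E_proj[OF b]]] tr_proj_le[OF E_proj[OF b]] by auto
  \<comment> \<open>The three mesh widths come from the index shift, from \<open>a\<close> exceeding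
    its layer sum, and from replacing \<open>c\<close> by its Riemann sum.\<close>
  have "pos (c - a + (3 * (1/2) ^ n) *\<^sub>R 1)" for n
  proof -
    define h :: real where "h = (1/2) ^ n"
    have h: "h > 0" by (simp add: h_def)
    define S where "S = (\<Sum>k=1..m * 2 ^ n. e (tr (E b (real k * h))))"
    define T where "T = (\<Sum>k=1..m * 2 ^ n. E a (real k * h))"
    have 1: "pos (1 + S - T)" unfolding S_def T_def
    proof (rule shifted_sum_le)
      fix k
      have "tr (E a (real (Suc k) * h)) \<le> tr (E b (real k * h))"
        by (rule spec_dom_tr_E[OF a b sd]) (use h in auto)
      then show "pos (e (tr (E b (real k * h))) - E a (real (Suc k) * h))"
        using e[OF d] C by (intro pchain_le_of_tr[OF C(1)]) auto
    qed (auto intro: pos_1_proj pos_proj E_proj[OF a])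
    have 2: "pos (h *\<^sub>R 1 - (a - h *\<^sub>R T))"
      using layer_dyadic(2)[OF a ma, of n] by (simp add: T_def h_def scaleR_sum_right)
    have hS: "rearranged e b m n = h *\<^sub>R S" by (simp add: rearranged_def S_def h_def scaleR_sum_right)
    have "star (h *\<^sub>R S) = h *\<^sub>R S"
      unfolding S_def using e[OF d] C(1) by (simp add: star_simps pchain_def projD)
    then have "star (c - h *\<^sub>R S) = c - h *\<^sub>R S" by (simp only: star_diff star_closure_orbit[OF b c(1)])
    then have 3: "pos (h *\<^sub>R 1 + (c - h *\<^sub>R S))"
      using c(3)[of n] unfolding hS h_def[symmetric] by (rule pos_norm_add)
    have "pos (h *\<^sub>R (1 + S - T))" using 1 h by (simp add: pos_scaleR)
    from pos_add[OF pos_add[OF this 2] 3] show ?thesis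
      by (simp add: algebra_simps flip: h_def) (simp add: mult.commute flip: scaleR_add_left)
  qed
  then have "pos (c - a)" by (rule pos_dyadic_limit)
  \<comment> \<open>Every projection of the chain commutes with all \<open>E a r\<close>, hence with
    \<open>a\<close>; the Riemann sums and their limit inherit this.\<close>
  moreover have "a * c = c * a"
  proof (rule commute_limit[OF c(2)])
    have "e t * a = a * e t" if "0 \<le> t" "t \<le> 1" for t
      by (rule commute_of_commute_E[OF a], rule pchain_commute[OF C(1)]) (use e[OF that] C(2) in auto)
    then show "a * rearranged e b m n = rearranged e b m n * a" for n
      using d by (simp add: rearranged_def sum_distrib_left sum_distrib_right)
  qed
  ultimately show ?thesis using c(1) by auto
qed

lemma spec_dom_below:
  assumes a: "pos a" and b: "pos b" and sd: "spec_dom star \<tau> a b"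
  shows "\<exists>d\<in>closure (unitary_orbit star a). pos (b - d) \<and> d * b = b * d"
proof -
  obtain C e where C: "pchain C" "range (E b) \<subseteq> C" and e: "\<And>t. 0 \<le> t \<Longrightarrow> t \<le> 1 \<Longrightarrow> e t \<in> C \<and> tr (e t) = t"
    using spectral_flow[OF b] by metis
  obtain m :: nat where "max (norm a) (norm b) \<le> real m" using real_arch_simple by blast
  then have ma: "norm a \<le> real m" and mb: "norm b \<le> real m" by auto
  obtain c where c: "c \<in> closure (unitary_orbit star a)" "rearranged e a m \<longlonglongrightarrow> c"
    "\<And>n. norm (c - rearranged e a m n) \<le> (1/2) ^ n"
    using rearrangement[OF C(1) e a ma] by blast
  have d: "0 \<le> tr (E a r)" "tr (E a r) \<le> 1" for r
    using tr_pos[OF pos_proj[OF E_proj[OF a]]] tr_proj_le[OF E_proj[OF a]] by auto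
  have ep: "proj (e (tr (E a r)))" for r using e[OF d] C(1) by (simp add: pchain_def)
  \<comment> \<open>Two mesh widths suffice, since the layer sum of \<open>b\<close> already lies
    below \<open>b\<close>; only the index shift and the Riemann sum of \<open>c\<close> cost
    something.\<close>
  have "pos (b - c + (2 * (1/2) ^ n) *\<^sub>R 1)" for n
  proof -
    define h :: real where "h = (1/2) ^ n"
    have h: "h > 0" by (simp add: h_def)
    define S where "S = (\<Sum>k=1..m * 2 ^ n. e (tr (E a (real k * h))))"
    define T where "T = (\<Sum>k=1..m * 2 ^ n. E b (real k * h))"
    have 1: "pos (1 + T - S)" unfolding S_def T_def
    proof (rule shifted_sum_le)
      fix k
      have "tr (E a (real (Suc k) * h)) \<le> tr (E b (real k * h))"
        by (rule spec_dom_tr_E[OF a b sd]) (use h in auto)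
      then show "pos (E b (real k * h) - e (tr (E a (real (Suc k) * h))))"
        using e[OF d] C by (intro pchain_le_of_tr[OF C(1)]) auto
    qed (auto intro: pos_1_proj pos_proj ep)
    have 2: "pos (b - h *\<^sub>R T)"
      using layer_dyadic(1)[OF b mb, of n] by (simp add: T_def h_def scaleR_sum_right)
    have hS: "rearranged e a m n = h *\<^sub>R S" by (simp add: rearranged_def S_def h_def scaleR_sum_right)
    have "star (h *\<^sub>R S) = h *\<^sub>R S" unfolding S_def by (simp add: star_simps projD[OF ep])
    then have "star (c - h *\<^sub>R S) = c - h *\<^sub>R S" by (simp only: star_diff star_closure_orbit[OF a c(1)])
    then have 3: "pos (h *\<^sub>R 1 - (c - h *\<^sub>R S))"
      using c(3)[of n] unfolding hS h_def[symmetric] by (rule pos_norm_diff)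
    have "pos (h *\<^sub>R (1 + T - S))" using 1 h by (simp add: pos_scaleR)
    from pos_add[OF pos_add[OF this 2] 3] show ?thesis
      by (simp add: algebra_simps flip: h_def) (simp add: mult.commute flip: scaleR_add_left)
  qed
  then have "pos (b - c)" by (rule pos_dyadic_limit)
  moreover have "b * c = c * b"
  proof (rule commute_limit[OF c(2)])
    have "e t * b = b * e t" if "0 \<le> t" "t \<le> 1" for t
      by (rule commute_of_commute_E[OF b], rule pchain_commute[OF C(1)]) (use e[OF that] C(2) in auto)
    then show "b * rearranged e a m n = rearranged e a m n * b" for n
      using d by (simp add: rearranged_def sum_distrib_left sum_distrib_right)
  qed
  ultimately show ?thesis using c(1) by auto
qed

lemma spec_dom_of_above:
  assumes a: "pos a" and c: "c \<in> closure (unitary_orbit star b)" "pos (c - a)"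
  shows "spec_dom star \<tau> a b"
  unfolding spec_dom_def using mu_mono[OF a c(2)] mu_closure_orbit[OF c(1)] by simp

lemma spec_dom_of_below:
  assumes a: "pos a" and d: "d \<in> closure (unitary_orbit star a)" "pos (b - d)"
  shows "spec_dom star \<tau> a b"
proof -
  obtain X where X: "\<And>n. X n \<in> unitary_orbit star a" "X \<longlonglongrightarrow> d"
    using d(1) closure_sequential by metis
  have "pos (X n)" for n
    using X(1)[of n] pos_conj[OF a, of "star _"] by (auto simp: unitary_orbit_def)
  then have "pos d" using X(2) by (rule pos_limit)
  then show ?thesis
    unfolding spec_dom_def using mu_mono[OF _ d(2)] mu_closure_orbit[OF d(1)] by simp
qed

end

theorem theorem4p6:
  fixes star :: "'a::{real_normed_algebra_1,banach} \<Rightarrow> 'a" and j :: 'a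
    and \<tau> :: "'a \<Rightarrow> complex" and a b :: 'a
  assumes "II1_factor star j \<tau>"
    and "positive star a" and "positive star b"
  shows "(spec_dom star \<tau> a b \<longleftrightarrow>
            (\<exists>c\<in>closure (unitary_orbit star b). ople star a c))
       \<and> (spec_dom star \<tau> a b \<longleftrightarrow>
            (\<exists>d\<in>closure (unitary_orbit star a). ople star d b))
       \<and> (spec_dom star \<tau> a b \<longrightarrow>
            (\<exists>c\<in>closure (unitary_orbit star b). ople star a c \<and> c * a = a * c))
       \<and> (spec_dom star \<tau> a b \<longrightarrow>
            (\<exists>d\<in>closure (unitary_orbit star a). ople star d b \<and> d * b = b * d))
       \<and> (weak_maj star \<tau> a b \<longleftrightarrow>
            (\<exists>c. positive star c \<and> ople star a c \<and> maj star \<tau> c b))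
       \<and> (weak_maj star \<tau> a b \<longrightarrow>
            (\<exists>c. positive star c \<and> ople star a c \<and> maj star \<tau> c b \<and> c * a = a * c))"
proof -
  interpret II1 star j \<tau> by (rule II1.intro) (rule assms(1))
  have a: "pos a" and b: "pos b" using assms by (simp_all add: positive_eq_pos)
  show ?thesis
    unfolding ople_iff positive_eq_pos
    using spec_dom_above[OF a b] spec_dom_below[OF a b] spec_dom_of_above[OF a] spec_dom_of_below[OF a]
      weak_maj_imp_maj_above[OF a b] maj_above_imp_weak_maj[OF a]
    by blast
qed

end
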